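(* Consider the following five one-parameter deformations $(g_2(z,a),g_3(z,a))$: (1) $g_2=3(z-1)(z-a^2)^3$, $\ g_3=(z-1)(z-a^2)^4(z+a)$; (2) $g_2=12z^2(z^2+az+1)$, $\ g_3=4z^3(2z^3+3az^2+3az+2)$; (3) $g_2=12z^2(z^2+2az+1)$, $\ g_3=4z^3(2z^3+3(a^2+1)z^2+6az+2)$; (4) $g_2=3z^3(z+a)$, $\ g_3=z^5(z+1)$; (5) $g_2=3z^3(z+2a)$, $\ g_3=z^4(z^2+3az+1)$. The algebraic solutions $(\lambda(t),\alpha)$ of $\mathbf{PVI}_\alpha$ equations coming (in the sense explained in the context) from the deformations of the covering $\{(x,z)\in\mathbb{C}^2: 4x^3-g_2x-g_3=0\}\to\mathbb{C}$, $(x,z)\mapsto z$, with $g_2,g_3$ as in (1)–(5) are exactly the following, where $\lambda(t)$ is defined by $P(\lambda(t),t)\equiv0$. Solutions with stabilizer $D_4$, each occurring with four values of $\alpha$, the stabilizer of each of the corresponding equations $\mathbf{PVI}_\alpha$ being $S_2\times S_2$: 2A: $P=\lambda^2-t$, $\ \alpha\in\{(\frac18,\frac18,\frac1{18},\frac1{18}),(\frac1{18},\frac1{18},\frac18,\frac18),(\frac18,\frac18,\frac12,\frac12),(\frac12,\frac12,\frac18,\frac18)\}$; 2B: $P=\lambda^2-2\lambda+t$, $\ \alpha\in\{(\frac1{18},\frac18,\frac1{18},\frac18),(\frac18,\frac1{18},\frac18,\frac1{18}),(\frac12,\frac18,\frac12,\frac18),(\frac18,\frac12,\frac18,\frac12)\}$;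 2C: $P=\lambda^2-2\lambda t+t$, $\ \alpha\in\{(\frac1{18},\frac18,\frac18,\frac1{18}),(\frac18,\frac1{18},\frac1{18},\frac18),(\frac12,\frac18,\frac18,\frac12),(\frac18,\frac12,\frac12,\frac18)\}$. Solutions with stabilizer $S_3$, the stabilizer of $\mathbf{PVI}_\alpha$ being $S_3$: 3A: $P=\lambda^4-6\lambda^2t+4\lambda t+4\lambda t^2-3t^2$, $\ \alpha=(\frac18,\frac98,\frac18,\frac18)$; 3B: $P=3\lambda^4-4\lambda^3-4\lambda^3t+6\lambda^2t-t^2$, $\ \alpha=(\frac98,\frac18,\frac18,\frac18)$; 3C: $P=\lambda^4-4\lambda^3+6t\lambda^2-4t^2\lambda+t^2$, $\ \alpha=(\frac18,\frac18,\frac98,\frac18)$; 3D: $P=\lambda^4-4t\lambda^3+6t\lambda^2-4t\lambda+t^2$, $\ \alpha=(\frac18,\frac18,\frac18,\frac98)$. Solutions with stabilizer $S_3$, all with $\alpha=(\frac18,\frac18,\frac18,\frac18)$, the stabilizer of $\mathbf{PVI}_\alpha$ being $S_4$: 4A: $P=\lambda^4-2t\lambda^3-2\lambda^3+6t\lambda^2-2t^2\lambda-2t\lambda+t^3-t^2+t$; 4B: $P=\lambda^4-2t\lambda^3+2t^2\lambda-t^3$; 4C: $P=\lambda^4(t^2-t+1)-2\lambda^3t(t+1)+6t^2\lambda^2-2\lambda t^2(t+1)+t^3$; 4D: $P=\lambda^4-2\lambda^3+2t\lambda-t$. Solutions with stabilizer $S_2$, the stabilizer of $\mathbf{PVI}_\alpha$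 being $S_2$: 5A: $P=-2\lambda^3+3t\lambda^2+3\lambda^2-6t\lambda+t^2+t$, $\ \alpha=(\frac12,\frac1{18},\frac18,\frac18)$; 5B: $P=\lambda^3-3\lambda^2+3t\lambda-2t^2+t$, $\ \alpha=(\frac18,\frac1{18},\frac12,\frac18)$; 5C: $P=\lambda^3-3t\lambda^2+3t\lambda+t^2-2t$, $\ \alpha=(\frac18,\frac1{18},\frac18,\frac12)$; 5D: $P=2\lambda^3-3t\lambda^2+t^2$, $\ \alpha=(\frac12,\frac18,\frac1{18},\frac18)$; 5E: $P=\lambda^3-3t\lambda+2t^2$, $\ \alpha=(\frac18,\frac12,\frac1{18},\frac18)$; 5F: $P=\lambda^3-3t\lambda^2+3t\lambda-t^2$, $\ \alpha=(\frac18,\frac18,\frac1{18},\frac12)$; 5G: $P=\lambda^3(2-t)-3t\lambda^2+3t^2\lambda-t^2$, $\ \alpha=(\frac1{18},\frac18,\frac12,\frac18)$; 5H: $P=\lambda^3(t+1)-6t\lambda^2+3t(t+1)\lambda-2t^2$, $\ \alpha=(\frac1{18},\frac12,\frac18,\frac18)$; 5I: $P=(1-2t)\lambda^3+3t\lambda^2-3t\lambda+t^2$, $\ \alpha=(\frac1{18},\frac18,\frac18,\frac12)$; 5J: $P=\lambda^3-3\lambda^2+3t\lambda-t$, $\ \alpha=(\frac18,\frac18,\frac12,\frac1{18})$; 5K: $P=\lambda^3-3t\lambda+2t$, $\ \alpha=(\frac18,\frac12,\frac18,\frac1{18})$; 5L: $P=2\lambda^3-3\lambda^2+t$, $\ 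\alpha=(\frac12,\frac18,\frac18,\frac1{18})$.
   Context: For $\alpha=(\alpha_0,\alpha_1,\alpha_2,\alpha_3)\in\mathbb{C}^4$, $\mathbf{PVI}_\alpha$ denotes the Painlevé VI equation $$\frac{d^2\lambda}{dt^2}=\frac12\Big(\frac1\lambda+\frac1{\lambda-1}+\frac1{\lambda-t}\Big)\Big(\frac{d\lambda}{dt}\Big)^2-\Big(\frac1t+\frac1{t-1}+\frac1{\lambda-t}\Big)\frac{d\lambda}{dt}+\frac{\lambda(\lambda-1)(\lambda-t)}{t^2(t-1)^2}\Big[\alpha_0-\alpha_1\frac{t}{\lambda^2}+\alpha_2\frac{t-1}{(\lambda-1)^2}+\Big(\frac12-\alpha_3\Big)\frac{t(t-1)}{(\lambda-t)^2}\Big].$$ Solutions coming from a deformation of a covering. Let $g_2=g_2(z,a)$, $g_3=g_3(z,a)$ be one of the given pairs of polynomials in $z$ depending on a parameter $a\in\mathbb{C}$ (taken generic). Let $x_1(z),x_2(z)$ be two distinct roots of $4x^3-g_2x-g_3$ and put $\eta_1=x_1-x_2$, $\eta_2=x_1^2-x_2^2$. With $\triangle=g_2^3-27g_3^2$, $\delta=3g_3\frac{dg_2}{dz}-2g_2\frac{dg_3}{dz}$, and $\triangle'_z=\frac{d\triangle}{dz}$, these functions satisfy the Picard–Fuchs system $$\triangle\,\frac{d}{dz}\begin{pmatrix}\eta_1\\ \eta_2\end{pmatrix}=\begin{pmatrix}\frac{\triangle'_z}{6}&-3\delta\\ -\frac{g_2\delta}{2}&\frac{\triangle'_z}{3}\end{pmatrix}\begin{pmatrix}\eta_1\\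 \eta_2\end{pmatrix}.$$ Eliminating $\eta_2$ gives a second-order Fuchsian equation for $\eta_1$ in the variable $z$ which has four genuine singular points in $\mathbb{P}^1$ (the roots of $\triangle$ and $\infty$) and one apparent singular point, the root of $\delta$ that is not a root of $\triangle$. Apply a Möbius transformation in $z$ (depending on $a$) sending the four singular points, taken in any order, to $0,1,t,\infty$; here $t=t(a)$. Let $\lambda=\lambda(a)$ be the image of the apparent singular point. Eliminating $a$ gives an algebraic function $\lambda(t)$. The parameters are $\alpha_0=\frac12\kappa_\infty^2$, $\alpha_1=\frac12\kappa_0^2$, $\alpha_2=\frac12\kappa_1^2$, $\alpha_3=\frac12\kappa_t^2$, where $\kappa_p$ is the difference of the two local exponents of the (renormalized) second-order equation at the singular point $p$. The deformation with parameter $a$ is isomonodromic, $\lambda(t)$ is a solution of $\mathbf{PVI}_\alpha$, and $(\lambda(t),\alpha)$ is called the algebraic solution coming from the deformation. Stabilizers. The symmetric group $S_4$ is realized as the group generated by the transformations $x^1:(\lambda,t)\mapsto(1-\lambda,1-t)$, $x^2:(\lambda,t)\mapsto(\frac1\lambda,\frac1t)$, $x^3:(\lambda,t)\mapsto(\frac{t-\lambda}{t-1},\frac{t}{t-1})$; it acts on parameters by permutations: $x^1$ exchanges $\alpha_1,\alpha_2$; $x^2$ exchanges $\alpha_0,\alpha_1$; $x^3$ exchanges $\alpha_1,\alpha_3$. It maps solutions of $\mathbf{PVI}_\alpha$ to solutions of the equation with permuted parameters. The stabilizer of a solution is the subgroup preserving the curve $P(\lambda,t)=0$; the stabilizer of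 $\mathbf{PVI}_\alpha$ is the subgroup fixing $\alpha$. $D_4$ is the dihedral group of order $8$. *)

theory Defs
  imports
    "HOL-Algebra.Bij"
    "HOL-Algebra.Generated_Groups"
    "HOL-Algebra.Sym_Groups"
    "HOL-Complex_Analysis.Complex_Analysis"
begin

(* Frees the dollar sign for vector components. *)
no_notation fps_nth (infixl \<open>$\<close> 75)

section \<open>The Painleve VI equation and its algebraic solutions\<close>

text \<open>A parameter \<open>(\<alpha>\<^sub>0, \<alpha>\<^sub>1, \<alpha>\<^sub>2, \<alpha>\<^sub>3)\<close>, whose entries belong to the singular points
  \<open>\<infinity>, 0, 1, t\<close> in this order.\<close>

type_synonym params = "complex \<times> complex \<times> complex \<times> complex"

definition PVI_rhs :: "params \<Rightarrow> complex \<Rightarrow> complex \<Rightarrow> complex \<Rightarrow> complex" where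
  "PVI_rhs \<alpha> t l l' = (case \<alpha> of (\<alpha>0, \<alpha>1, \<alpha>2, \<alpha>3) \<Rightarrow>
     1/2 * (1 / l + 1 / (l - 1) + 1 / (l - t)) * l'\<^sup>2
     - (1 / t + 1 / (t - 1) + 1 / (l - t)) * l'
     + l * (l - 1) * (l - t) / (t\<^sup>2 * (t - 1)\<^sup>2)
       * (\<alpha>0 - \<alpha>1 * (t / l\<^sup>2) + \<alpha>2 * ((t - 1) / (l - 1)\<^sup>2)
          + (1/2 - \<alpha>3) * (t * (t - 1) / (l - t)\<^sup>2)))"

text \<open>Points of the plane are written \<open>(\<lambda>, t)\<close>. The following set consists of the points where no
  denominator of the equation vanishes.\<close>

definition regular_region :: "(complex \<times> complex) set" where
  "regular_region = {(l, t). t \<noteq> 0 \<and> t \<noteq> 1 \<and> l \<noteq> 0 \<and> l \<noteq> 1 \<and> l \<noteq> t}"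

definition satisfies_PVI :: "params \<Rightarrow> complex set \<Rightarrow> (complex \<Rightarrow> complex) \<Rightarrow> bool" where
  "satisfies_PVI \<alpha> U f \<longleftrightarrow> (\<forall>t\<in>U. deriv (deriv f) t = PVI_rhs \<alpha> t (f t) (deriv f t))"

definition curve :: "(complex \<Rightarrow> complex \<Rightarrow> complex) \<Rightarrow> (complex \<times> complex) set" where
  "curve P = {(l, t). P l t = 0}"

definition branch_of :: "(complex \<times> complex) set \<Rightarrow> complex set \<Rightarrow> (complex \<Rightarrow> complex) \<Rightarrow> bool" where
  "branch_of C U f \<longleftrightarrow> open U \<and> U \<noteq> {} \<and> f holomorphic_on U \<and>
     (\<forall>t\<in>U. (f t, t) \<in> C \<inter> regular_region)"

definition algebraic_PVI_solution :: "(complex \<times> complex) set \<Rightarrow> params \<Rightarrow> bool" where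
  "algebraic_PVI_solution C \<alpha> \<longleftrightarrow>
     (\<exists>U f. branch_of C U f) \<and> (\<forall>U f. branch_of C U f \<longrightarrow> satisfies_PVI \<alpha> U f)"


section \<open>The Picard--Fuchs system of a covering\<close>

definition disc_poly :: "complex poly \<Rightarrow> complex poly \<Rightarrow> complex poly" where
  "disc_poly g2 g3 = g2 ^ 3 - 27 * g3 ^ 2"

definition delta_poly :: "complex poly \<Rightarrow> complex poly \<Rightarrow> complex poly" where
  "delta_poly g2 g3 = 3 * g3 * pderiv g2 - 2 * g2 * pderiv g3"

definition PF_matrix :: "complex poly \<Rightarrow> complex poly \<Rightarrow> complex \<Rightarrow> complex^2^2" where
  "PF_matrix g2 g3 z =
    (let D = poly (disc_poly g2 g3) z; D' = poly (pderiv (disc_poly g2 g3)) z;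
         d = poly (delta_poly g2 g3) z
     in vector [vector [(D' / 6) / D, (- 3 * d) / D],
                vector [(- (poly g2 z * d) / 2) / D, (D' / 3) / D]])"

lemma PF_matrix_components:
  "PF_matrix g2 g3 z $ 1 $ 1 = poly (pderiv (disc_poly g2 g3)) z / 6 / poly (disc_poly g2 g3) z"
  "PF_matrix g2 g3 z $ 1 $ 2 = - 3 * poly (delta_poly g2 g3) z / poly (disc_poly g2 g3) z"
  "PF_matrix g2 g3 z $ 2 $ 1 =
     - (poly g2 z * poly (delta_poly g2 g3) z) / 2 / poly (disc_poly g2 g3) z"
  "PF_matrix g2 g3 z $ 2 $ 2 = poly (pderiv (disc_poly g2 g3)) z / 3 / poly (disc_poly g2 g3) z"
  by (simp_all add: PF_matrix_def Let_def)

text \<open>Eliminating \<open>y\<^sub>2\<close> from \<open>y' = A y\<close> yields \<open>y\<^sub>1'' + p y\<^sub>1' + q y\<^sub>1 = 0\<close> with the following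
  coefficients.\<close>

definition elim_p :: "(complex \<Rightarrow> complex^2^2) \<Rightarrow> complex \<Rightarrow> complex" where
  "elim_p A z = - (A z $ 1 $ 1 + A z $ 2 $ 2) - deriv (\<lambda>w. A w $ 1 $ 2) z / A z $ 1 $ 2"

definition elim_q :: "(complex \<Rightarrow> complex^2^2) \<Rightarrow> complex \<Rightarrow> complex" where
  "elim_q A z = A z $ 1 $ 1 * A z $ 2 $ 2 - A z $ 1 $ 2 * A z $ 2 $ 1
     - deriv (\<lambda>w. A w $ 1 $ 1) z + A z $ 1 $ 1 * deriv (\<lambda>w. A w $ 1 $ 2) z / A z $ 1 $ 2"

lemma elimination:
  assumes "open U" "z \<in> U"
    and "(\<lambda>w. A w $ 1 $ 1) field_differentiable at z"
    and "(\<lambda>w. A w $ 1 $ 2) field_differentiable at z" "A z $ 1 $ 2 \<noteq> 0"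
    and y1: "\<And>w. w \<in> U \<Longrightarrow> (y1 has_field_derivative A w $ 1 $ 1 * y1 w + A w $ 1 $ 2 * y2 w) (at w)"
    and y2: "\<And>w. w \<in> U \<Longrightarrow> (y2 has_field_derivative A w $ 2 $ 1 * y1 w + A w $ 2 $ 2 * y2 w) (at w)"
  shows "deriv (deriv y1) z + elim_p A z * deriv y1 z + elim_q A z * y1 z = 0"
proof -
  let ?a = "\<lambda>w. A w $ 1 $ 1" and ?b = "\<lambda>w. A w $ 1 $ 2"
  have d1: "deriv y1 w = ?a w * y1 w + ?b w * y2 w" if "w \<in> U" for w
    using y1[OF that] by (rule DERIV_imp_deriv)
  have a: "(?a has_field_derivative deriv ?a z) (at z)"
    and b: "(?b has_field_derivative deriv ?b z) (at z)"
    using assms(3,4) by (simp_all add: DERIV_deriv_iff_field_differentiable)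
  have "((\<lambda>w. ?a w * y1 w + ?b w * y2 w) has_field_derivative
      (deriv ?a z * y1 z + (?a z * y1 z + ?b z * y2 z) * ?a z) +
      (deriv ?b z * y2 z + (A z $ 2 $ 1 * y1 z + A z $ 2 $ 2 * y2 z) * ?b z)) (at z)"
    by (intro DERIV_add DERIV_mult a b y1 y2 assms)
  then have "(deriv y1 has_field_derivative
      (deriv ?a z * y1 z + (?a z * y1 z + ?b z * y2 z) * ?a z) +
      (deriv ?b z * y2 z + (A z $ 2 $ 1 * y1 z + A z $ 2 $ 2 * y2 z) * ?b z)) (at z)"
    by (rule has_field_derivative_transform_within_open[OF _ assms(1,2)]) (simp add: d1)
  then have "deriv (deriv y1) z =
      (deriv ?a z * y1 z + (?a z * y1 z + ?b z * y2 z) * ?a z) +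
      (deriv ?b z * y2 z + (A z $ 2 $ 1 * y1 z + A z $ 2 $ 2 * y2 z) * ?b z)"
    by (rule DERIV_imp_deriv)
  then show ?thesis
    using assms(5) by (simp add: d1[OF assms(2)] elim_p_def elim_q_def field_simps)
qed

text \<open>Differences of two roots of \<open>4x\<^sup>3 - g\<^sub>2 x - g\<^sub>3\<close> and of their squares indeed solve the system.\<close>

lemma root_derivative:
  assumes "poly (disc_poly g2 g3) z \<noteq> 0" "open U" "z \<in> U"
    and "(x has_field_derivative x') (at z)"
    and root: "\<And>w. w \<in> U \<Longrightarrow> 4 * x w ^ 3 - poly g2 w * x w - poly g3 w = 0"
  shows "poly (disc_poly g2 g3) z * x' =
    poly (pderiv (disc_poly g2 g3)) z / 6 * x z
      - 3 * poly (delta_poly g2 g3) z * ((x z)\<^sup>2 - poly g2 z / 6)"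
proof -
  define a b a' b' X where "a = poly g2 z" and "b = poly g3 z"
    and "a' = poly (pderiv g2) z" and "b' = poly (pderiv g3) z" and "X = x z"
  have "((\<lambda>w. 4 * x w ^ 3 - poly g2 w * x w - poly g3 w) has_field_derivative
      4 * (3 * X\<^sup>2 * x') - (a' * X + x' * a) - b') (at z)"
    unfolding a_def b_def a'_def b'_def X_def
    by (auto intro!: derivative_eq_intros assms(4) poly_DERIV simp: field_simps)
  moreover have "((\<lambda>w. 4 * x w ^ 3 - poly g2 w * x w - poly g3 w) has_field_derivative 0) (at z)"
    by (rule has_field_derivative_transform_within_open[OF DERIV_const[of 0] assms(2,3)])
      (simp add: root)
  ultimately have x': "12 * X\<^sup>2 * x' - a' * X - x' * a - b' = 0"
    using DERIV_unique by (fastforce simp: algebra_simps)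
  have X: "4 * X ^ 3 - a * X - b = 0"
    using root[OF assms(3)] by (simp add: a_def b_def X_def)
  have D: "poly (disc_poly g2 g3) z = a ^ 3 - 27 * b\<^sup>2"
    "poly (pderiv (disc_poly g2 g3)) z = 3 * a\<^sup>2 * a' - 54 * b * b'"
    "poly (delta_poly g2 g3) z = 3 * b * a' - 2 * a * b'"
    by (simp_all add: disc_poly_def delta_poly_def pderiv_diff pderiv_mult
        a_def b_def a'_def b'_def power2_eq_square power3_eq_cube algebra_simps)
  have ne: "12 * X\<^sup>2 - a \<noteq> 0"
  proof
    assume "12 * X\<^sup>2 - a = 0"
    with X have "a ^ 3 - 27 * b\<^sup>2 = 0" by algebra
    with assms(1) D show False by simp
  qed
  have "(12 * X\<^sup>2 - a) * (6 * ((a ^ 3 - 27 * b\<^sup>2) * x')) =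
    (12 * X\<^sup>2 - a) * ((3 * a\<^sup>2 * a' - 54 * b * b') * X - 3 * (3 * b * a' - 2 * a * b') * (6 * X\<^sup>2 - a))"
    using x' X by algebra
  with ne have 6: "6 * ((a ^ 3 - 27 * b\<^sup>2) * x') =
    (3 * a\<^sup>2 * a' - 54 * b * b') * X - 3 * (3 * b * a' - 2 * a * b') * (6 * X\<^sup>2 - a)"
    by simp
  have "u = p / 6 * X - 3 * d * (s - c / 6)"
    if "6 * u = p * X - 3 * d * (6 * s - c)" for u p d s c :: complex
  proof -
    have "u = (p * X - 3 * d * (6 * s - c)) / 6"
      using that by (simp add: eq_divide_eq mult.commute)
    then show ?thesis
      by (simp add: diff_divide_distrib right_diff_distrib)
  qed
  from this[OF 6] show ?thesis
    unfolding D a_def[symmetric] X_def[symmetric] .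
qed

lemma PF_system:
  assumes "poly (disc_poly g2 g3) z \<noteq> 0" "open U" "z \<in> U"
    and x1: "(x1 has_field_derivative x1') (at z)"
      "\<And>w. w \<in> U \<Longrightarrow> 4 * x1 w ^ 3 - poly g2 w * x1 w - poly g3 w = 0"
    and x2: "(x2 has_field_derivative x2') (at z)"
      "\<And>w. w \<in> U \<Longrightarrow> 4 * x2 w ^ 3 - poly g2 w * x2 w - poly g3 w = 0"
  defines "\<eta> \<equiv> \<lambda>w. vector [x1 w - x2 w, (x1 w)\<^sup>2 - (x2 w)\<^sup>2] :: complex^2"
  shows "((\<lambda>w. \<eta> w $ 1) has_field_derivative (PF_matrix g2 g3 z *v \<eta> z) $ 1) (at z)"
    and "((\<lambda>w. \<eta> w $ 2) has_field_derivative (PF_matrix g2 g3 z *v \<eta> z) $ 2) (at z)"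
proof -
  define D D' d a b where "D = poly (disc_poly g2 g3) z"
    and "D' = poly (pderiv (disc_poly g2 g3)) z"
    and "d = poly (delta_poly g2 g3) z" and "a = poly g2 z" and "b = poly g3 z"
  have r1: "D * x1' = D' / 6 * x1 z - 3 * d * ((x1 z)\<^sup>2 - a / 6)"
    unfolding D_def D'_def d_def a_def by (rule root_derivative[OF assms(1-3) x1])
  have r2: "D * x2' = D' / 6 * x2 z - 3 * d * ((x2 z)\<^sup>2 - a / 6)"
    unfolding D_def D'_def d_def a_def by (rule root_derivative[OF assms(1-3) x2])
  have c1: "4 * x1 z ^ 3 = a * x1 z + b" and c2: "4 * x2 z ^ 3 = a * x2 z + b"
    using x1(2)[OF assms(3)] x2(2)[OF assms(3)] by (simp_all add: a_def b_def algebra_simps)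
  have D: "D \<noteq> 0" using assms(1) by (simp add: D_def)
  have mv: "(PF_matrix g2 g3 z *v \<eta> z) $ 1 =
      (D' / 6 * (x1 z - x2 z) - 3 * d * ((x1 z)\<^sup>2 - (x2 z)\<^sup>2)) / D"
    "(PF_matrix g2 g3 z *v \<eta> z) $ 2 =
      (- (a * d) / 2 * (x1 z - x2 z) + D' / 3 * ((x1 z)\<^sup>2 - (x2 z)\<^sup>2)) / D"
    by (simp_all add: \<eta>_def matrix_vector_mult_def sum_2 PF_matrix_components
        D_def D'_def d_def a_def diff_divide_distrib add_divide_distrib)
  have e1: "x1' - x2' = (PF_matrix g2 g3 z *v \<eta> z) $ 1"
  proof -
    have "D * (x1' - x2') = D' / 6 * (x1 z - x2 z) - 3 * d * ((x1 z)\<^sup>2 - (x2 z)\<^sup>2)"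
      unfolding right_diff_distrib[of D x1' x2'] r1 r2
      by (simp add: right_diff_distrib diff_divide_distrib)
    then show ?thesis using D unfolding mv by (simp add: eq_divide_eq mult.commute)
  qed
  have sq: "D * (2 * X * X') = - (a * d) / 2 * X + D' / 3 * X\<^sup>2 - 3 * b * d / 2"
    if "D * X' = D' / 6 * X - 3 * d * (X\<^sup>2 - a / 6)" "4 * X ^ 3 = a * X + b" for X X'
  proof -
    have "6 * (D * X') = D' * X - 3 * d * (6 * X\<^sup>2 - a)"
      unfolding that(1) by (simp add: right_diff_distrib)
    with that(2) have "6 * (D * (2 * X * X')) = - 3 * (a * d) * X + 2 * D' * X\<^sup>2 - 9 * b * d"
      by algebra
    then have "D * (2 * X * X') = (- 3 * (a * d) * X + 2 * D' * X\<^sup>2 - 9 * b * d) / 6"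
      by (simp add: eq_divide_eq mult.commute)
    then show ?thesis by (simp add: diff_divide_distrib add_divide_distrib ac_simps)
  qed
  have e2: "2 * x1 z * x1' - 2 * x2 z * x2' = (PF_matrix g2 g3 z *v \<eta> z) $ 2"
  proof -
    have "D * (2 * x1 z * x1' - 2 * x2 z * x2') =
        - (a * d) / 2 * (x1 z - x2 z) + D' / 3 * ((x1 z)\<^sup>2 - (x2 z)\<^sup>2)"
      unfolding right_diff_distrib[of D "2 * x1 z * x1'" "2 * x2 z * x2'"] sq[OF r1 c1] sq[OF r2 c2]
      by (simp add: right_diff_distrib diff_divide_distrib)
    then show ?thesis using D unfolding mv by (simp add: eq_divide_eq mult.commute)
  qed
  show "((\<lambda>w. \<eta> w $ 1) has_field_derivative (PF_matrix g2 g3 z *v \<eta> z) $ 1) (at z)"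
    unfolding e1[symmetric] unfolding \<eta>_def by (auto intro!: derivative_eq_intros x1(1) x2(1))
  show "((\<lambda>w. \<eta> w $ 2) has_field_derivative (PF_matrix g2 g3 z *v \<eta> z) $ 2) (at z)"
    unfolding e2[symmetric] unfolding \<eta>_def by (auto intro!: derivative_eq_intros x1(1) x2(1))
qed


section \<open>Local exponents and Moebius transformations\<close>

text \<open>Points of the Riemann sphere are elements of \<^typ>\<open>complex option\<close>; \<^term>\<open>None\<close> is \<open>\<infinity>\<close>.

  \<open>indicial_poly p q s F\<close>: the point \<open>s\<close> is an at most regular singular point of
  \<open>y'' + p y' + q y = 0\<close>, and \<open>F\<close> is its indicial polynomial, obtained from \<open>y \<sim> (z - s)\<^sup>r\<close>
  for finite \<open>s\<close> and from \<open>y \<sim> (1/z)\<^sup>r\<close> for \<open>s = \<infinity>\<close>.\<close>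

fun indicial_poly ::
  "(complex \<Rightarrow> complex) \<Rightarrow> (complex \<Rightarrow> complex) \<Rightarrow> complex option \<Rightarrow> complex poly \<Rightarrow> bool" where
  "indicial_poly p q (Some s) F \<longleftrightarrow> (\<exists>p0 q0.
     ((\<lambda>z. (z - s) * p z) \<longlongrightarrow> p0) (at s) \<and> ((\<lambda>z. (z - s)\<^sup>2 * q z) \<longlongrightarrow> q0) (at s) \<and>
     F = [:q0, p0 - 1, 1:])"
| "indicial_poly p q None F \<longleftrightarrow> (\<exists>p0 q0.
     ((\<lambda>z. z * p z) \<longlongrightarrow> p0) at_infinity \<and> ((\<lambda>z. z\<^sup>2 * q z) \<longlongrightarrow> q0) at_infinity \<and>
     F = [:q0, 1 - p0, 1:])"

definition exponent_difference ::
  "(complex \<Rightarrow> complex) \<Rightarrow> (complex \<Rightarrow> complex) \<Rightarrow> complex option \<Rightarrow> complex \<Rightarrow> bool" where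
  "exponent_difference p q s \<kappa> \<longleftrightarrow>
     (\<exists>r1 r2. indicial_poly p q s ([:- r1, 1:] * [:- r2, 1:]) \<and> \<kappa> = r1 - r2)"

fun moebius ::
  "complex \<Rightarrow> complex \<Rightarrow> complex \<Rightarrow> complex \<Rightarrow> complex option \<Rightarrow> complex option" where
  "moebius a b c d (Some z) =
     (if c * z + d = 0 then None else Some ((a * z + b) / (c * z + d)))"
| "moebius a b c d None = (if c = 0 then None else Some (a / c))"


section \<open>The algebraic solution coming from a deformation\<close>

definition singular_points :: "complex poly \<Rightarrow> complex poly \<Rightarrow> complex option set" where
  "singular_points g2 g3 = insert None (Some ` {z. poly (disc_poly g2 g3) z = 0})"

definition apparent_points :: "complex poly \<Rightarrow> complex poly \<Rightarrow> complex set" where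
  "apparent_points g2 g3 =
     {z. poly (delta_poly g2 g3) z = 0 \<and> poly (disc_poly g2 g3) z \<noteq> 0}"

text \<open>The situation for a single value of the deformation parameter. The exponent differences at
  \<open>\<infinity>, 0, 1, t\<close> are computed at the preimages of these points in the original coordinate: they do
  not change under Moebius transformations, nor under multiplication of the unknown function
  by products of powers.\<close>

definition normalizes ::
  "complex poly \<Rightarrow> complex poly \<Rightarrow> (complex option \<Rightarrow> complex option)
     \<Rightarrow> complex \<Rightarrow> complex \<Rightarrow> params \<Rightarrow> bool" where
  "normalizes g2 g3 M l t \<alpha> \<longleftrightarrow>
     (let p = elim_p (PF_matrix g2 g3); q = elim_q (PF_matrix g2 g3) in
      t \<noteq> 0 \<and> t \<noteq> 1 \<and>
      M ` singular_points g2 g3 = {None, Some 0, Some 1, Some t} \<and>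
      (\<exists>z. apparent_points g2 g3 = {z} \<and> M (Some z) = Some l) \<and>
      (\<exists>sinf s0 s1 st kinf k0 k1 kt.
         M sinf = None \<and> M s0 = Some 0 \<and> M s1 = Some 1 \<and> M st = Some t \<and>
         exponent_difference p q sinf kinf \<and> exponent_difference p q s0 k0 \<and>
         exponent_difference p q s1 k1 \<and> exponent_difference p q st kt \<and>
         \<alpha> = (kinf\<^sup>2 / 2, k0\<^sup>2 / 2, k1\<^sup>2 / 2, kt\<^sup>2 / 2)))"

text \<open>A polynomial in \<open>\<lambda>\<close> whose coefficients are polynomials in \<open>t\<close>.\<close>

definition eval2 :: "complex poly poly \<Rightarrow> complex \<Rightarrow> complex \<Rightarrow> complex" where
  "eval2 Q l t = poly (poly Q [:l:]) t"

definition zariski_closure :: "(complex \<times> complex) set \<Rightarrow> (complex \<times> complex) set" where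
  "zariski_closure X =
     {(l, t). \<forall>Q. (\<forall>(l', t')\<in>X. eval2 Q l' t' = 0) \<longrightarrow> eval2 Q l t = 0}"

text \<open>For \<open>a\<close> in a region \<open>V\<close> of the parameter space the Moebius transformation depends
  holomorphically on \<open>a\<close>, so the order of the singular points is chosen consistently.
  Eliminating \<open>a\<close> means to take the curve cut out by all algebraic relations between
  \<open>\<lambda>(a)\<close> and \<open>t(a)\<close>; the algebraic function \<open>\<lambda>(t)\<close> is represented by this curve.\<close>

definition comes_from_deformation ::
  "(complex \<Rightarrow> complex poly) \<Rightarrow> (complex \<Rightarrow> complex poly)
     \<Rightarrow> (complex \<times> complex) set \<Rightarrow> params \<Rightarrow> bool" where
  "comes_from_deformation g2 g3 C \<alpha> \<longleftrightarrow> (\<exists>V A B E F l t.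
     open V \<and> connected V \<and> V \<noteq> {} \<and>
     A holomorphic_on V \<and> B holomorphic_on V \<and> E holomorphic_on V \<and> F holomorphic_on V \<and>
     l holomorphic_on V \<and> t holomorphic_on V \<and>
     (\<forall>a\<in>V. A a * F a - B a * E a \<noteq> 0 \<and>
        normalizes (g2 a) (g3 a) (moebius (A a) (B a) (E a) (F a)) (l a) (t a) \<alpha>) \<and>
     C = zariski_closure ((\<lambda>a. (l a, t a)) ` V))"


section \<open>The five deformations\<close>

abbreviation Z :: "complex poly" where "Z \<equiv> [:0, 1:]"

definition deformations :: "((complex \<Rightarrow> complex poly) \<times> (complex \<Rightarrow> complex poly)) set" where
  "deformations =
    {(\<lambda>a. 3 * (Z - 1) * (Z - [:a\<^sup>2:]) ^ 3,
      \<lambda>a. (Z - 1) * (Z - [:a\<^sup>2:]) ^ 4 * (Z + [:a:])),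
     (\<lambda>a. 12 * Z ^ 2 * (Z ^ 2 + [:a:] * Z + 1),
      \<lambda>a. 4 * Z ^ 3 * (2 * Z ^ 3 + 3 * [:a:] * Z ^ 2 + 3 * [:a:] * Z + 2)),
     (\<lambda>a. 12 * Z ^ 2 * (Z ^ 2 + 2 * [:a:] * Z + 1),
      \<lambda>a. 4 * Z ^ 3 * (2 * Z ^ 3 + 3 * [:a\<^sup>2 + 1:] * Z ^ 2 + 6 * [:a:] * Z + 2)),
     (\<lambda>a. 3 * Z ^ 3 * (Z + [:a:]),
      \<lambda>a. Z ^ 5 * (Z + 1)),
     (\<lambda>a. 3 * Z ^ 3 * (Z + 2 * [:a:]),
      \<lambda>a. Z ^ 4 * (Z ^ 2 + 3 * [:a:] * Z + 1))}"


section \<open>The lists of solutions\<close>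

text \<open>The lists \<open>2\<close> to \<open>5\<close> differ in the stabilizers of the curve and of the equation:
  \<open>D\<^sub>4\<close> and \<open>S\<^sub>2 \<times> S\<^sub>2\<close>; \<open>S\<^sub>3\<close> and \<open>S\<^sub>3\<close>; \<open>S\<^sub>3\<close> and \<open>S\<^sub>4\<close>;
  \<open>S\<^sub>2\<close> and \<open>S\<^sub>2\<close>.\<close>

definition solutions_2 :: "((complex \<times> complex) set \<times> params) set" where
  "solutions_2 =
    {curve (\<lambda>l t. l^2 - t)} \<times>
      {(1/8, 1/8, 1/18, 1/18), (1/18, 1/18, 1/8, 1/8), (1/8, 1/8, 1/2, 1/2), (1/2, 1/2, 1/8, 1/8)} \<union>
    {curve (\<lambda>l t. l^2 - 2*l + t)} \<times>
      {(1/18, 1/8, 1/18, 1/8), (1/8, 1/18, 1/8, 1/18), (1/2, 1/8, 1/2, 1/8), (1/8, 1/2, 1/8, 1/2)} \<union>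
    {curve (\<lambda>l t. l^2 - 2*l*t + t)} \<times>
      {(1/18, 1/8, 1/8, 1/18), (1/8, 1/18, 1/18, 1/8), (1/2, 1/8, 1/8, 1/2), (1/8, 1/2, 1/2, 1/8)}"

definition solutions_3 :: "((complex \<times> complex) set \<times> params) set" where
  "solutions_3 =
    {(curve (\<lambda>l t. l^4 - 6*l^2*t + 4*l*t + 4*l*t^2 - 3*t^2), (1/8, 9/8, 1/8, 1/8)),
     (curve (\<lambda>l t. 3*l^4 - 4*l^3 - 4*l^3*t + 6*l^2*t - t^2), (9/8, 1/8, 1/8, 1/8)),
     (curve (\<lambda>l t. l^4 - 4*l^3 + 6*t*l^2 - 4*t^2*l + t^2), (1/8, 1/8, 9/8, 1/8)),
     (curve (\<lambda>l t. l^4 - 4*t*l^3 + 6*t*l^2 - 4*t*l + t^2), (1/8, 1/8, 1/8, 9/8))}"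

definition solutions_4 :: "((complex \<times> complex) set \<times> params) set" where
  "solutions_4 =
    {curve (\<lambda>l t. l^4 - 2*t*l^3 - 2*l^3 + 6*t*l^2 - 2*t^2*l - 2*t*l + t^3 - t^2 + t),
     curve (\<lambda>l t. l^4 - 2*t*l^3 + 2*t^2*l - t^3),
     curve (\<lambda>l t. l^4*(t^2 - t + 1) - 2*l^3*t*(t + 1) + 6*t^2*l^2 - 2*l*t^2*(t + 1) + t^3),
     curve (\<lambda>l t. l^4 - 2*l^3 + 2*t*l - t)} \<times> {(1/8, 1/8, 1/8, 1/8)}"

definition solutions_5 :: "((complex \<times> complex) set \<times> params) set" where
  "solutions_5 =
    {(curve (\<lambda>l t. - 2*l^3 + 3*t*l^2 + 3*l^2 - 6*t*l + t^2 + t), (1/2, 1/18, 1/8, 1/8)),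
     (curve (\<lambda>l t. l^3 - 3*l^2 + 3*t*l - 2*t^2 + t), (1/8, 1/18, 1/2, 1/8)),
     (curve (\<lambda>l t. l^3 - 3*t*l^2 + 3*t*l + t^2 - 2*t), (1/8, 1/18, 1/8, 1/2)),
     (curve (\<lambda>l t. 2*l^3 - 3*t*l^2 + t^2), (1/2, 1/8, 1/18, 1/8)),
     (curve (\<lambda>l t. l^3 - 3*t*l + 2*t^2), (1/8, 1/2, 1/18, 1/8)),
     (curve (\<lambda>l t. l^3 - 3*t*l^2 + 3*t*l - t^2), (1/8, 1/8, 1/18, 1/2)),
     (curve (\<lambda>l t. l^3*(2 - t) - 3*t*l^2 + 3*t^2*l - t^2), (1/18, 1/8, 1/2, 1/8)),
     (curve (\<lambda>l t. l^3*(t + 1) - 6*t*l^2 + 3*t*(t + 1)*l - 2*t^2), (1/18, 1/2, 1/8, 1/8)),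
     (curve (\<lambda>l t. (1 - 2*t)*l^3 + 3*t*l^2 - 3*t*l + t^2), (1/18, 1/8, 1/8, 1/2)),
     (curve (\<lambda>l t. l^3 - 3*l^2 + 3*t*l - t), (1/8, 1/8, 1/2, 1/18)),
     (curve (\<lambda>l t. l^3 - 3*t*l + 2*t), (1/8, 1/2, 1/8, 1/18)),
     (curve (\<lambda>l t. 2*l^3 - 3*l^2 + t), (1/2, 1/8, 1/8, 1/18))}"


section \<open>The action of the symmetric group and stabilizers\<close>

fun x1 :: "complex \<times> complex \<Rightarrow> complex \<times> complex" where
  "x1 (l, t) = (1 - l, 1 - t)"

fun x2 :: "complex \<times> complex \<Rightarrow> complex \<times> complex" where
  "x2 (l, t) = (1 / l, 1 / t)"

fun x3 :: "complex \<times> complex \<Rightarrow> complex \<times> complex" where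
  "x3 (l, t) = ((t - l) / (t - 1), t / (t - 1))"

fun swap12 :: "params \<Rightarrow> params" where
  "swap12 (\<alpha>0, \<alpha>1, \<alpha>2, \<alpha>3) = (\<alpha>0, \<alpha>2, \<alpha>1, \<alpha>3)"

fun swap01 :: "params \<Rightarrow> params" where
  "swap01 (\<alpha>0, \<alpha>1, \<alpha>2, \<alpha>3) = (\<alpha>1, \<alpha>0, \<alpha>2, \<alpha>3)"

fun swap13 :: "params \<Rightarrow> params" where
  "swap13 (\<alpha>0, \<alpha>1, \<alpha>2, \<alpha>3) = (\<alpha>0, \<alpha>3, \<alpha>2, \<alpha>1)"

text \<open>The birational maps \<^const>\<open>x1\<close>, \<^const>\<open>x2\<close>, \<^const>\<open>x3\<close> are honest bijections of
  \<^const>\<open>regular_region\<close>. A group element is kept as a pair: its action on \<open>(\<lambda>, t)\<close> and its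
  action on parameters.\<close>

definition ambient_group ::
  "((complex \<times> complex \<Rightarrow> complex \<times> complex) \<times> (params \<Rightarrow> params)) monoid" where
  "ambient_group = BijGroup regular_region \<times>\<times> BijGroup UNIV"

definition S4_generators ::
  "((complex \<times> complex \<Rightarrow> complex \<times> complex) \<times> (params \<Rightarrow> params)) set" where
  "S4_generators =
     {(restrict x1 regular_region, swap12), (restrict x2 regular_region, swap01),
      (restrict x3 regular_region, swap13)}"

lemma S4_generators_subset: "S4_generators \<subseteq> carrier ambient_group"
proof -
  have "bij_betw x1 regular_region regular_region"
    by (rule bij_betwI[where g = x1]) (auto simp: regular_region_def)
  moreover have "bij_betw x2 regular_region regular_region"
    by (rule bij_betwI[where g = x2]) (auto simp: regular_region_def)
  moreover have "bij_betw x3 regular_region regular_region"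
  proof -
    have inv: "x3 (x3 p) = p \<and> x3 p \<in> regular_region" if "p \<in> regular_region" for p
    proof -
      obtain l t where p: "p = (l, t)" by (cases p)
      define u where "u = t - 1"
      have t: "t = u + 1" and ne: "u + 1 \<noteq> 0" "u \<noteq> 0" "l \<noteq> 0" "l \<noteq> 1" "l \<noteq> u + 1"
        using that by (auto simp: regular_region_def p u_def)
      have "(u + 1) / u - 1 = 1 / u" "(u + 1) / u - (u + 1 - l) / u = l / u"
        using ne by (simp_all add: field_simps)
      with ne show ?thesis
        by (auto simp: p t regular_region_def divide_eq_eq)
    qed
    then show ?thesis by (intro bij_betwI[where g = x3]) auto
  qed
  moreover have "bij swap12" by (rule o_bij[where g = swap12]) auto
  moreover have "bij swap01" by (rule o_bij[where g = swap01]) auto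
  moreover have "bij swap13" by (rule o_bij[where g = swap13]) auto
  ultimately show ?thesis
    by (auto simp: S4_generators_def ambient_group_def BijGroup_def Bij_def)
qed

definition S4_elements ::
  "((complex \<times> complex \<Rightarrow> complex \<times> complex) \<times> (params \<Rightarrow> params)) set" where
  "S4_elements = generate ambient_group S4_generators"

definition solution_stabilizer ::
  "(complex \<times> complex) set
     \<Rightarrow> ((complex \<times> complex \<Rightarrow> complex \<times> complex) \<times> (params \<Rightarrow> params)) monoid" where
  "solution_stabilizer C = ambient_group
     \<lparr>carrier := {(g, \<pi>) \<in> S4_elements. g ` (C \<inter> regular_region) = C \<inter> regular_region}\<rparr>"

definition PVI_stabilizer ::
  "params \<Rightarrow> ((complex \<times> complex \<Rightarrow> complex \<times> complex) \<times> (params \<Rightarrow> params)) monoid" where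
  "PVI_stabilizer \<alpha> = ambient_group \<lparr>carrier := {(g, \<pi>) \<in> S4_elements. \<pi> \<alpha> = \<alpha>}\<rparr>"

text \<open>The dihedral group of order \<open>2n\<close> (for \<open>n \<ge> 3\<close>): the permutations of the vertices \<open>1, \<dots>, n\<close>
  of a regular \<open>n\<close>-gon that preserve its edges.\<close>

definition polygon_edge :: "nat \<Rightarrow> nat \<Rightarrow> nat \<Rightarrow> bool" where
  "polygon_edge n i j \<longleftrightarrow> j mod n = Suc i mod n \<or> i mod n = Suc j mod n"

definition dihedral_group :: "nat \<Rightarrow> (nat \<Rightarrow> nat) monoid" where
  "dihedral_group n = (sym_group n)
     \<lparr>carrier := {p. p permutes {1..n} \<and>
        (\<forall>i\<in>{1..n}. \<forall>j\<in>{1..n}. polygon_edge n (p i) (p j) \<longleftrightarrow> polygon_edge n i j)}\<rparr>"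

end

theory Submission
  imports Defs
begin

text \<open>The four singular points and the apparent point of the Picard--Fuchs equation form a
  configuration of five points on the projective line, and the pair \<open>(\<lambda>, t)\<close> is nothing but its
  class modulo Moebius transformations, expressed by two cross ratios (\<open>normal_form\<close>). Seen this way,
  \<open>S\<^sub>4\<close> acts by renumbering the four singular points, and the three generating birational maps
  are transpositions. This one observation organizes the whole classification: choosing an order of the
  singular points means acting by \<open>S\<^sub>4\<close>, so for every deformation it suffices to
  know one curve, one parameter and how both move under permutations.

  The curves of each list are therefore indexed by labels \<open>(i, j)\<close> of distinct positions among
  \<open>1, 2, 3, 4\<close> (standing for \<open>\<infinity>, 0, 1, t\<close>), and a permutation \<open>p\<close> sends the solution with label
  \<open>(i, j)\<close> to that with label \<open>(p i, p j)\<close> (locale \<open>label_family\<close>). Equivariance of the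
  polynomials is read off from homogeneous expressions in the brackets of the five points. The
  stabilizers become explicit subgroups of \<open>S\<^sub>4\<close> (\<open>stabilizers_2\<close> to \<open>stabilizers_5\<close>).

  That the curves solve the Painleve equation is checked for one label of each list, where the curve has
  a rational parametrization \<open>s \<mapsto> (\<lambda>, t)\<close> and the equation becomes an identity of rational functions
  of \<open>s\<close> (\<open>reference_solution_2\<close> to \<open>reference_solution_5\<close>); the symmetries of the equation carry the
  result to all labels.

  For the deformations, the exponent differences at a singular point follow from the orders of
  \<open>\<triangle>\<close> and \<open>\<delta>\<close> there (\<open>exponent_difference_finite\<close>, \<open>exponent_difference_infinity\<close>). After
  factoring \<open>\<triangle>\<close> and \<open>\<delta>\<close>, one numbering of the singular points yields one point on one of the
  curves. Conversely a holomorphic family of normalizations uses for every \<open>a\<close> some numbering, hence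
  runs on a finite union of curves, and by the identity theorem on a single one. Since \<open>a\<close>
  can be recovered from \<open>(\<lambda>, t)\<close> up to finitely many choices, the family covers uncountably many points of the
  curve; the curve being rational, these are Zariski dense in it
  (\<open>closure_uncountable\<close>, \<open>comes_from_deformation_iff\<close>).\<close>

(* The number 1 occurs as the index of a point and is kept in this form. *)
declare One_nat_def [simp del]

section \<open>Five points on the projective line\<close>

text \<open>Points of the projective line are given by homogeneous coordinates, so that infinity needs no
  special treatment; the bracket vanishes exactly on proportional vectors.\<close>

definition bracket :: "complex \<times> complex \<Rightarrow> complex \<times> complex \<Rightarrow> complex" where
  "bracket v w = fst v * snd w - snd v * fst w"

text \<open>The images of the points \<open>0\<close> (apparent) and \<open>4\<close> under the Moebius transformation that sends
  the points \<open>1, 2, 3\<close> to \<open>\<infinity>, 0, 1\<close>, written as cross ratios.\<close>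

definition normal_form :: "(nat \<Rightarrow> complex \<times> complex) \<Rightarrow> complex \<times> complex" where
  "normal_form v =
    (bracket (v 0) (v 2) * bracket (v 3) (v 1) / (bracket (v 0) (v 1) * bracket (v 3) (v 2)),
     bracket (v 4) (v 2) * bracket (v 3) (v 1) / (bracket (v 4) (v 1) * bracket (v 3) (v 2)))"

definition generic_config :: "(nat \<Rightarrow> complex \<times> complex) \<Rightarrow> bool" where
  "generic_config v \<longleftrightarrow> (\<forall>i\<in>{..4}. \<forall>j\<in>{..4}. i \<noteq> j \<longrightarrow> bracket (v i) (v j) \<noteq> 0)"

definition standard_config :: "complex \<times> complex \<Rightarrow> nat \<Rightarrow> complex \<times> complex" where
  "standard_config x i =
    (if i = 0 then (fst x, 1) else if i = 1 then (1, 0) else if i = 2 then (0, 1)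
     else if i = 3 then (1, 1) else (snd x, 1))"

definition lin :: "complex \<Rightarrow> complex \<Rightarrow> complex \<Rightarrow> complex \<Rightarrow> complex \<times> complex \<Rightarrow> complex \<times> complex" where
  "lin a b c d v = (a * fst v + b * snd v, c * fst v + d * snd v)"

definition scale :: "complex \<Rightarrow> complex \<times> complex \<Rightarrow> complex \<times> complex" where
  "scale m v = (m * fst v, m * snd v)"

lemma atMost_4: "{..4::nat} = {0, 1, 2, 3, 4}"
  by auto

lemma atLeastAtMost_1_4: "{1..4::nat} = {1, 2, 3, 4}"
  by auto

lemma bracket_lin: "bracket (lin a b c d v) (lin a b c d w) = (a * d - b * c) * bracket v w"
  by (simp add: bracket_def lin_def algebra_simps)

lemma bracket_scale: "bracket (scale m v) (scale n w) = m * n * bracket v w"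
  by (simp add: bracket_def scale_def algebra_simps)

lemma lin_bracket:
  fixes v w :: "nat \<Rightarrow> complex \<times> complex"
  assumes "\<And>i. i \<in> {..4} \<Longrightarrow> lin a b c d (v i) = scale (m i) (w i)" "i \<in> {..4}" "j \<in> {..4}"
  shows "(a * d - b * c) * bracket (v i) (v j) = m i * m j * bracket (w i) (w j)"
  using bracket_lin[of a b c d "v i" "v j"] assms bracket_scale by metis

text \<open>A linear map multiplies all brackets by its determinant, and rescaling a vector multiplies
  numerator and denominator of a cross ratio alike.\<close>

lemma normal_form_invariant:
  assumes "a * d - b * c \<noteq> 0"
    and "\<And>i. i \<in> {..4} \<Longrightarrow> m i \<noteq> 0"
    and "\<And>i. i \<in> {..4} \<Longrightarrow> lin a b c d (v i) = scale (m i) (w i)"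
  shows "normal_form v = normal_form w"
proof -
  define D where "D = a * d - b * c"
  have D: "D \<noteq> 0" using assms(1) by (simp add: D_def)
  have br: "bracket (v i) (v j) = m i * m j / D * bracket (w i) (w j)"
    if "i \<in> {..4}" "j \<in> {..4}" for i j
    using lin_bracket[OF assms(3) that] D by (simp add: D_def field_simps)
  have m: "m 0 \<noteq> 0" "m 1 \<noteq> 0" "m 2 \<noteq> 0" "m 3 \<noteq> 0" "m 4 \<noteq> 0"
    by (rule assms(2); simp)+
  show ?thesis
    unfolding normal_form_def using m D by (simp add: br)
qed

text \<open>The coefficients are explicit because they must later depend holomorphically on a parameter.\<close>

lemma normalization_exists:
  assumes "generic_config v"
  obtains a b c d m where "a * d - b * c \<noteq> 0"
    "\<And>i. i \<in> {..4} \<Longrightarrow> m i \<noteq> 0"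
    "\<And>i. i \<in> {..4} \<Longrightarrow> lin a b c d (v i) = scale (m i) (standard_config (normal_form v) i)"
    "a = snd (v 2) * bracket (v 3) (v 1)" "b = - fst (v 2) * bracket (v 3) (v 1)"
    "c = snd (v 1) * bracket (v 3) (v 2)" "d = - fst (v 1) * bracket (v 3) (v 2)"
proof -
  have nz: "bracket (v i) (v j) \<noteq> 0" if "i \<noteq> j" "i \<le> 4" "j \<le> 4" for i j
    using assms that by (auto simp: generic_config_def)
  define K L where "K = bracket (v 3) (v 1)" and "L = bracket (v 3) (v 2)"
  have KL: "K \<noteq> 0" "L \<noteq> 0" by (simp_all add: K_def L_def nz)
  define a b c d where "a = snd (v 2) * K" and "b = - fst (v 2) * K"
    and "c = snd (v 1) * L" and "d = - fst (v 1) * L"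
  define m where "m i = (if i = 1 then bracket (v 1) (v 2) * K else if i = 2 then bracket (v 2) (v 1) * L
    else bracket (v i) (v 1) * L)" for i
  have lin: "lin a b c d z = (bracket z (v 2) * K, bracket z (v 1) * L)" for z
    by (simp add: lin_def a_def b_def c_def d_def bracket_def algebra_simps)
  have det: "a * d - b * c = K * L * bracket (v 2) (v 1)"
    by (simp add: a_def b_def c_def d_def bracket_def algebra_simps)
  have self: "bracket z z = 0" for z by (simp add: bracket_def)
  show ?thesis
  proof (rule that[of a d b c m])
    show "a * d - b * c \<noteq> 0" using KL nz[of 2 1] by (simp add: det)
    show "m i \<noteq> 0" if "i \<in> {..4}" for i
      using that KL nz by (auto simp: m_def)
    show "lin a b c d (v i) = scale (m i) (standard_config (normal_form v) i)" if "i \<in> {..4}" for i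
    proof -
      have "i = 0 \<or> i = 1 \<or> i = 2 \<or> i = 3 \<or> i = 4" using that by auto
      then show ?thesis
        using KL nz[of 0 1] nz[of 4 1]
        by (elim disjE)
          (simp_all add: lin self standard_config_def scale_def m_def normal_form_def
            K_def[symmetric] L_def[symmetric])
    qed
  qed (simp_all add: a_def b_def c_def d_def K_def L_def)
qed

lemma generic_standard_config: "generic_config (standard_config x) \<longleftrightarrow> x \<in> regular_region"
  by (cases x) (auto simp: generic_config_def atMost_4 standard_config_def bracket_def
      regular_region_def)

lemma normal_form_standard: "x \<in> regular_region \<Longrightarrow> normal_form (standard_config x) = x"
  by (cases x) (auto simp: normal_form_def standard_config_def bracket_def)

lemma normal_form_regular:
  assumes "generic_config v"
  shows "normal_form v \<in> regular_region"
proof -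
  from normalization_exists[OF assms] obtain a b c d m where
    *: "a * d - b * c \<noteq> 0"
    "\<And>i. i \<in> {..4} \<Longrightarrow> m i \<noteq> 0"
    "\<And>i. i \<in> {..4} \<Longrightarrow> lin a b c d (v i) = scale (m i) (standard_config (normal_form v) i)"
    by metis
  have "bracket (standard_config (normal_form v) i) (standard_config (normal_form v) j) \<noteq> 0"
    if "i \<in> {..4}" "j \<in> {..4}" "i \<noteq> j" for i j
  proof -
    have "(a * d - b * c) * bracket (v i) (v j) \<noteq> 0"
      using *(1) assms that by (auto simp: generic_config_def)
    then show ?thesis
      using lin_bracket[of a b c d v m "standard_config (normal_form v)", OF *(3) that(1,2)] by auto
  qed
  then have "generic_config (standard_config (normal_form v))"
    by (auto simp: generic_config_def)
  then show ?thesis by (simp add: generic_standard_config)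
qed

lemma permutes_atMost_4:
  assumes "p permutes {1..4::nat}"
  shows "p permutes {..4}"
  using permutes_subset[OF assms] by auto

lemma generic_config_permute:
  assumes "generic_config v" "p permutes {1..4}"
  shows "generic_config (v \<circ> p)"
  using assms permutes_in_image[OF permutes_atMost_4[OF assms(2)]] permutes_inj[OF assms(2)]
  by (auto simp: generic_config_def inj_eq)

lemma normal_form_permute:
  assumes "generic_config v" "p permutes {1..4}"
  shows "normal_form (standard_config (normal_form v) \<circ> p) = normal_form (v \<circ> p)"
proof -
  from normalization_exists[OF assms(1)] obtain a b c d m where
    *: "a * d - b * c \<noteq> 0"
    "\<And>i. i \<in> {..4} \<Longrightarrow> m i \<noteq> 0"
    "\<And>i. i \<in> {..4} \<Longrightarrow> lin a b c d (v i) = scale (m i) (standard_config (normal_form v) i)"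
    by metis
  have p: "p i \<in> {..4}" if "i \<in> {..4}" for i
    using that permutes_in_image[OF permutes_atMost_4[OF assms(2)]] by simp
  show ?thesis
    by (rule normal_form_invariant[OF *(1), where m = "m \<circ> p", symmetric]) (use *(2,3) p in simp_all)
qed

section \<open>The action of the symmetric group\<close>

text \<open>A point \<open>(\<lambda>, t)\<close> is read as the configuration \<open>\<lambda>; \<infinity>, 0, 1, t\<close>, renumbered and normalized again.
  The inverse makes this a left action.\<close>

definition act :: "(nat \<Rightarrow> nat) \<Rightarrow> complex \<times> complex \<Rightarrow> complex \<times> complex" where
  "act p x = normal_form (standard_config x \<circ> inv' p)"

definition param :: "params \<Rightarrow> nat \<Rightarrow> complex" where
  "param \<alpha> k = (case \<alpha> of (\<alpha>0, \<alpha>1, \<alpha>2, \<alpha>3) \<Rightarrow>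
     if k = 1 then \<alpha>0 else if k = 2 then \<alpha>1 else if k = 3 then \<alpha>2 else \<alpha>3)"

definition params_of :: "(nat \<Rightarrow> complex) \<Rightarrow> params" where
  "params_of f = (f 1, f 2, f 3, f 4)"

definition permute_params :: "(nat \<Rightarrow> nat) \<Rightarrow> params \<Rightarrow> params" where
  "permute_params p \<alpha> = params_of (param \<alpha> \<circ> inv' p)"

lemma params_of_param [simp]: "params_of (param \<alpha>) = \<alpha>"
  by (cases \<alpha>) (simp add: params_of_def param_def)

lemma param_params_of: "k \<in> {1..4} \<Longrightarrow> param (params_of f) k = f k"
  unfolding atLeastAtMost_1_4 by (auto simp: params_of_def param_def)

lemma params_of_eq_iff: "params_of f = params_of g \<longleftrightarrow> (\<forall>k\<in>{1..4}. f k = g k)"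
  unfolding atLeastAtMost_1_4 by (auto simp: params_of_def)

lemma permute_params_of:
  assumes "p permutes {1..4}"
  shows "permute_params p (params_of f) = params_of (f \<circ> inv' p)"
  using permutes_in_image[OF permutes_inv[OF assms]]
  by (simp add: permute_params_def params_of_eq_iff param_params_of)

text \<open>Normalizing before or after a renumbering gives the same result; this turns statements about
  arbitrary configurations into statements about the action.\<close>

lemma act_normal_form:
  assumes "generic_config v" "p permutes {1..4}"
  shows "act p (normal_form v) = normal_form (v \<circ> inv' p)"
  unfolding act_def using assms by (intro normal_form_permute permutes_inv)

lemma act_regular:
  assumes "x \<in> regular_region" "p permutes {1..4}"
  shows "act p x \<in> regular_region"
  unfolding act_def using assms
  by (intro normal_form_regular generic_config_permute permutes_inv) (simp_all add: generic_standard_config)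

lemma act_id: "x \<in> regular_region \<Longrightarrow> act id x = x"
  by (simp add: act_def normal_form_standard)

lemma act_comp:
  assumes "x \<in> regular_region" "p permutes {1..4}" "q permutes {1..4}"
  shows "act (p \<circ> q) x = act p (act q x)"
proof -
  have "act p (act q x) = normal_form (standard_config x \<circ> inv' q \<circ> inv' p)"
    unfolding act_def[of q] using assms
    by (intro act_normal_form generic_config_permute permutes_inv) (simp_all add: generic_standard_config)
  moreover have "inv' (p \<circ> q) = inv' q \<circ> inv' p"
    by (rule o_inv_distrib) (use assms permutes_bij in blast)+
  ultimately show ?thesis by (simp add: act_def comp_assoc)
qed

lemma permute_params_id: "permute_params id \<alpha> = \<alpha>"
  by (simp add: permute_params_def)

lemma permute_params_comp:
  assumes "p permutes {1..4}" "q permutes {1..4}"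
  shows "permute_params (p \<circ> q) \<alpha> = permute_params p (permute_params q \<alpha>)"
proof -
  have "inv' (p \<circ> q) = inv' q \<circ> inv' p"
    by (rule o_inv_distrib) (use assms permutes_bij in blast)+
  then show ?thesis
    using permute_params_of[OF assms(1), of "param \<alpha> \<circ> inv' q"]
    by (simp add: permute_params_def[of q] permute_params_def[of "p \<circ> q"] comp_assoc)
qed

abbreviation swap :: "nat \<Rightarrow> nat \<Rightarrow> nat \<Rightarrow> nat" where
  "swap \<equiv> Transposition.transpose"

lemma act_generators:
  assumes "x \<in> regular_region"
  shows "act (swap 2 3) x = x1 x" "act (swap 1 2) x = x2 x" "act (swap 2 4) x = x3 x"
  using assms
  by (cases x; force simp: act_def normal_form_def standard_config_def bracket_def Transposition.transpose_def
      regular_region_def field_simps)+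

lemma permute_params_generators:
  "permute_params (swap 2 3) = swap12" "permute_params (swap 1 2) = swap01"
  "permute_params (swap 2 4) = swap13"
  by (auto simp: fun_eq_iff permute_params_def params_of_def param_def Transposition.transpose_def)

lemma generators_permute:
  "swap 2 3 permutes {1..4::nat}" "swap 1 2 permutes {1..4::nat}"
  "swap 2 4 permutes {1..4::nat}"
  by (intro permutes_swap_id; simp)+

text \<open>The transpositions generate the symmetric group, in the form of an induction principle.\<close>

lemma permutes_4_induct [consumes 1, case_names id swap12 swap01 swap13]:
  assumes "p permutes {1..4::nat}" "P id"
    and 1: "\<And>p. p permutes {1..4} \<Longrightarrow> P p \<Longrightarrow> P (swap 2 3 \<circ> p)"
    and 2: "\<And>p. p permutes {1..4} \<Longrightarrow> P p \<Longrightarrow> P (swap 1 2 \<circ> p)"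
    and 3: "\<And>p. p permutes {1..4} \<Longrightarrow> P p \<Longrightarrow> P (swap 2 4 \<circ> p)"
  shows "P p"
proof (rule permutes_induct[of p "{1..4}" P, OF assms(1) finite_atLeastAtMost assms(2)])
  fix a b p assume ab: "a \<in> {1..4::nat}" "b \<in> {1..4}" "a \<noteq> b" and p: "P p" "p permutes {1..4}"
  define Q where "Q \<sigma> \<longleftrightarrow> \<sigma> permutes {1..4::nat} \<and> (\<forall>p. p permutes {1..4} \<longrightarrow> P p \<longrightarrow> P (\<sigma> \<circ> p))" for \<sigma>
  have gen: "Q (swap 2 3)" "Q (swap 1 2)" "Q (swap 2 4)"
    using 1 2 3 generators_permute by (auto simp: Q_def)
  have comp: "Q (\<sigma> \<circ> \<tau>)" if "Q \<sigma>" "Q \<tau>" for \<sigma> \<tau>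
    unfolding Q_def
  proof (intro conjI allI impI)
    show "\<sigma> \<circ> \<tau> permutes {1..4}" using that by (auto simp: Q_def intro: permutes_compose)
    fix p assume p: "p permutes {1..4}" "P p"
    then have "\<tau> \<circ> p permutes {1..4}" "P (\<tau> \<circ> p)"
      using that by (auto simp: Q_def intro: permutes_compose)
    then show "P (\<sigma> \<circ> \<tau> \<circ> p)" using that by (simp add: Q_def comp_assoc)
  qed
  have t: "swap 1 3 = swap 1 2 \<circ> swap 2 3 \<circ> swap 1 2"
    "swap 1 4 = swap 1 2 \<circ> swap 2 4 \<circ> swap 1 2"
    "swap 3 4 = swap 2 3 \<circ> swap 2 4 \<circ> swap 2 3"
    by (auto simp: fun_eq_iff Transposition.transpose_def)
  have "Q (swap 1 3)" "Q (swap 1 4)" "Q (swap 3 4)"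
    unfolding t by (intro comp gen)+
  then have "Q (swap a b)"
    using ab gen unfolding atLeastAtMost_1_4
    by (elim insertE emptyE) (simp_all add: transpose_commute)
  then show "P (swap a b \<circ> p)" using p by (auto simp: Q_def)
qed

definition S4_map ::
  "(nat \<Rightarrow> nat) \<Rightarrow> (complex \<times> complex \<Rightarrow> complex \<times> complex) \<times> (params \<Rightarrow> params)" where
  "S4_map p = (restrict (act p) regular_region, permute_params p)"

lemma group_ambient: "group ambient_group"
  unfolding ambient_group_def by (intro DirProd_group group_BijGroup)

lemma act_inverse:
  assumes "x \<in> regular_region" "p permutes {1..4}"
  shows "act p (act (inv' p) x) = x" "act (inv' p) (act p x) = x"
  using assms act_comp[OF assms(1) assms(2) permutes_inv[OF assms(2)]]
    act_comp[OF assms(1) permutes_inv[OF assms(2)] assms(2)]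
  by (simp_all add: act_id permutes_inv_o)

lemma act_bij:
  assumes "p permutes {1..4}"
  shows "bij_betw (act p) regular_region regular_region"
  by (rule bij_betwI[where g = "act (inv' p)"])
    (auto intro: act_inverse act_regular assms permutes_inv)

lemma permute_params_bij:
  assumes "p permutes {1..4}"
  shows "bij (permute_params p)"
proof (rule o_bij[where g = "permute_params (inv' p)"])
  note q = permutes_inv[OF assms]
  show "permute_params (inv' p) \<circ> permute_params p = id"
    using permute_params_comp[OF q assms] permutes_inv_o[OF assms]
    by (auto simp: fun_eq_iff permute_params_id)
  show "permute_params p \<circ> permute_params (inv' p) = id"
    using permute_params_comp[OF assms q] permutes_inv_o[OF assms]
    by (auto simp: fun_eq_iff permute_params_id)
qed

lemma S4_map_carrier: "p permutes {1..4} \<Longrightarrow> S4_map p \<in> carrier ambient_group"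
  using act_bij[of p] permute_params_bij[of p]
  by (auto simp: S4_map_def ambient_group_def BijGroup_def Bij_def cong: bij_betw_cong)

lemma S4_map_mult:
  assumes "p permutes {1..4}" "q permutes {1..4}"
  shows "S4_map (p \<circ> q) = S4_map p \<otimes>\<^bsub>ambient_group\<^esub> S4_map q"
proof -
  have "S4_map p \<otimes>\<^bsub>ambient_group\<^esub> S4_map q =
    (compose regular_region (restrict (act p) regular_region) (restrict (act q) regular_region),
     compose UNIV (permute_params p) (permute_params q))"
    using S4_map_carrier[OF assms(1)] S4_map_carrier[OF assms(2)]
    by (auto simp: S4_map_def ambient_group_def BijGroup_def)
  then show ?thesis
    using assms act_regular
    by (auto simp: S4_map_def compose_def fun_eq_iff act_comp permute_params_comp)
qed

lemma S4_map_one: "S4_map id = \<one>\<^bsub>ambient_group\<^esub>"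
  by (auto simp: S4_map_def ambient_group_def BijGroup_def fun_eq_iff act_id permute_params_id)

lemma S4_map_generators:
  "S4_generators = S4_map ` {swap 2 3, swap 1 2, swap 2 4}"
proof -
  have "restrict (act (swap 2 3)) regular_region = restrict x1 regular_region"
    "restrict (act (swap 1 2)) regular_region = restrict x2 regular_region"
    "restrict (act (swap 2 4)) regular_region = restrict x3 regular_region"
    by (auto simp: fun_eq_iff act_generators)
  then show ?thesis
    by (simp add: S4_generators_def S4_map_def permute_params_generators)
qed

lemma S4_map_inj: "inj_on S4_map {p. p permutes {1..4}}"
proof (rule inj_onI)
  fix p q assume pq: "p \<in> {p. p permutes {1..4}}" "q \<in> {p. p permutes {1..4}}" "S4_map p = S4_map q"
  then have "permute_params p (params_of of_nat) = permute_params q (params_of of_nat)"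
    by (simp add: S4_map_def)
  then have "\<forall>k\<in>{1..4}. inv' p k = inv' q k"
    using pq by (simp add: permute_params_of params_of_eq_iff)
  moreover have "inv' p k = k" "inv' q k = k" if "k \<notin> {1..4}" for k
    using that pq(1,2) by (simp_all add: permutes_not_in[OF permutes_inv])
  ultimately have "inv' p k = inv' q k" for k by (cases "k \<in> {1..4}") simp_all
  then have "inv' p = inv' q" by (rule ext)
  then have "inv' (inv' p) = inv' (inv' q)" by (rule arg_cong)
  then show "p = q" using pq(1,2) by (simp add: permutes_inv_inv)
qed

text \<open>The abstractly generated group is an isomorphic copy of the permutations of \<open>{1..4}\<close>; the second component, the
  action on parameters, already separates them.\<close>

lemma S4_elements_eq: "S4_elements = S4_map ` {p. p permutes {1..4}}"
proof
  interpret group ambient_group by (rule group_ambient)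
  have one: "S4_map id = \<one>\<^bsub>ambient_group\<^esub>" by (rule S4_map_one)
  have "subgroup (S4_map ` {p. p permutes {1..4}}) ambient_group"
  proof (rule subgroupI)
    show "S4_map ` {p. p permutes {1..4}} \<subseteq> carrier ambient_group" using S4_map_carrier by auto
    show "S4_map ` {p. p permutes {1..4}} \<noteq> {}" using permutes_id by blast
    fix a assume "a \<in> S4_map ` {p. p permutes {1..4}}"
    then obtain p where p: "a = S4_map p" "p permutes {1..4}" by auto
    have "S4_map (inv' p) \<otimes>\<^bsub>ambient_group\<^esub> a = \<one>\<^bsub>ambient_group\<^esub>"
      using p by (simp add: S4_map_mult[symmetric] permutes_inv permutes_inv_o one)
    then have "inv\<^bsub>ambient_group\<^esub> a = S4_map (inv' p)"
      using p by (intro inv_equality) (auto intro!: S4_map_carrier permutes_inv)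
    then show "inv\<^bsub>ambient_group\<^esub> a \<in> S4_map ` {p. p permutes {1..4}}"
      using p permutes_inv by auto
  next
    fix a b assume "a \<in> S4_map ` {p. p permutes {1..4}}" "b \<in> S4_map ` {p. p permutes {1..4}}"
    then obtain p q where "a = S4_map p" "b = S4_map q" "p permutes {1..4}" "q permutes {1..4}" by auto
    then show "a \<otimes>\<^bsub>ambient_group\<^esub> b \<in> S4_map ` {p. p permutes {1..4}}"
      using permutes_compose[of q "{1..4}" p] by (auto simp: S4_map_mult[symmetric])
  qed
  then show "S4_elements \<subseteq> S4_map ` {p. p permutes {1..4}}"
    unfolding S4_elements_def
    by (rule generate_subgroup_incl[rotated]) (use generators_permute in \<open>auto simp: S4_map_generators\<close>)
  have "S4_map p \<in> S4_elements" if "p permutes {1..4}" for p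
    using that
  proof (induction p rule: permutes_4_induct)
    case id
    show ?case unfolding S4_elements_def one by (rule generate.one)
  next
    case (swap12 p)
    then show ?case
      unfolding S4_elements_def S4_map_mult[OF generators_permute(1) swap12(1)]
      by (intro generate.eng[OF generate.incl]) (auto simp: S4_map_generators)
  next
    case (swap01 p)
    then show ?case
      unfolding S4_elements_def S4_map_mult[OF generators_permute(2) swap01(1)]
      by (intro generate.eng[OF generate.incl]) (auto simp: S4_map_generators)
  next
    case (swap13 p)
    then show ?case
      unfolding S4_elements_def S4_map_mult[OF generators_permute(3) swap13(1)]
      by (intro generate.eng[OF generate.incl]) (auto simp: S4_map_generators)
  qed
  then show "S4_map ` {p. p permutes {1..4}} \<subseteq> S4_elements" by auto
qed

text \<open>Stabilizers are compared as subsets of \<open>S\<^sub>4\<close>, where they can be described by conditions on permutations.\<close>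

lemma subgroup_iso:
  assumes img: "S4_map ` {p. p permutes {1..4} \<and> Q p} = K"
  shows "(sym_group 4)\<lparr>carrier := {p. p permutes {1..4} \<and> Q p}\<rparr> \<cong> ambient_group\<lparr>carrier := K\<rparr>"
proof (rule is_isoI)
  let ?G = "(sym_group 4)\<lparr>carrier := {p. p permutes {1..4} \<and> Q p}\<rparr>"
  let ?H = "ambient_group\<lparr>carrier := K\<rparr>"
  have "S4_map \<in> hom ?G ?H"
  proof (rule homI)
    fix p assume "p \<in> carrier ?G"
    then show "S4_map p \<in> carrier ?H" using img by auto
  next
    fix p q assume "p \<in> carrier ?G" "q \<in> carrier ?G"
    then show "S4_map (p \<otimes>\<^bsub>?G\<^esub> q) = S4_map p \<otimes>\<^bsub>?H\<^esub> S4_map q"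
      by (simp add: sym_group_mult S4_map_mult)
  qed
  moreover have "bij_betw S4_map {p. p permutes {1..4} \<and> Q p} K"
    unfolding bij_betw_def using img by (auto intro: inj_on_subset[OF S4_map_inj])
  ultimately show "S4_map \<in> iso ?G ?H"
    by (simp add: iso_def)
qed

section \<open>The curves and their labels\<close>

text \<open>The indices record where the distinguished parameters sit among \<open>\<infinity>, 0, 1, t\<close>. Below, \<open>i\<close> and \<open>j\<close> are the
  positions of the two entries \<open>1/8\<close>.\<close>

definition poly2 :: "nat \<Rightarrow> nat \<Rightarrow> complex \<Rightarrow> complex \<Rightarrow> complex" where
  "poly2 i j =
    (let A = (\<lambda>l t. l^2 - t); B = (\<lambda>l t. l^2 - 2*l + t); C = (\<lambda>l t. l^2 - 2*l*t + t)
     in [[\<lambda>l t. 0, A, B, C], [A, \<lambda>l t. 0, C, B], [B, C, \<lambda>l t. 0, A], [C, B, A, \<lambda>l t. 0]] ! (i - 1) ! (j - 1))"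

text \<open>Here \<open>j\<close> is the position of the parameter \<open>9/8\<close>.\<close>

definition poly3 :: "nat \<Rightarrow> complex \<Rightarrow> complex \<Rightarrow> complex" where
  "poly3 j =
    [\<lambda>l t. 3*l^4 - 4*l^3 - 4*l^3*t + 6*l^2*t - t^2,
     \<lambda>l t. l^4 - 6*l^2*t + 4*l*t + 4*l*t^2 - 3*t^2,
     \<lambda>l t. l^4 - 4*l^3 + 6*t*l^2 - 4*t^2*l + t^2,
     \<lambda>l t. l^4 - 4*t*l^3 + 6*t*l^2 - 4*t*l + t^2] ! (j - 1)"

text \<open>All parameters are equal; \<open>j\<close> is the position whose point stabilizer fixes the curve.\<close>

definition poly4 :: "nat \<Rightarrow> complex \<Rightarrow> complex \<Rightarrow> complex" where
  "poly4 j =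
    [\<lambda>l t. l^4*(t^2 - t + 1) - 2*l^3*t*(t + 1) + 6*t^2*l^2 - 2*l*t^2*(t + 1) + t^3,
     \<lambda>l t. l^4 - 2*t*l^3 - 2*l^3 + 6*t*l^2 - 2*t^2*l - 2*t*l + t^3 - t^2 + t,
     \<lambda>l t. l^4 - 2*t*l^3 + 2*t^2*l - t^3,
     \<lambda>l t. l^4 - 2*l^3 + 2*t*l - t] ! (j - 1)"

text \<open>Here \<open>i\<close> is the position of the parameter \<open>1/2\<close> and \<open>j\<close> that of \<open>1/18\<close>.\<close>

definition poly5 :: "nat \<Rightarrow> nat \<Rightarrow> complex \<Rightarrow> complex \<Rightarrow> complex" where
  "poly5 i j =
    [[\<lambda>l t. 0,
      \<lambda>l t. - 2*l^3 + 3*t*l^2 + 3*l^2 - 6*t*l + t^2 + t,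
      \<lambda>l t. 2*l^3 - 3*t*l^2 + t^2,
      \<lambda>l t. 2*l^3 - 3*l^2 + t],
     [\<lambda>l t. l^3*(t + 1) - 6*t*l^2 + 3*t*(t + 1)*l - 2*t^2,
      \<lambda>l t. 0,
      \<lambda>l t. l^3 - 3*t*l + 2*t^2,
      \<lambda>l t. l^3 - 3*t*l + 2*t],
     [\<lambda>l t. l^3*(2 - t) - 3*t*l^2 + 3*t^2*l - t^2,
      \<lambda>l t. l^3 - 3*l^2 + 3*t*l - 2*t^2 + t,
      \<lambda>l t. 0,
      \<lambda>l t. l^3 - 3*l^2 + 3*t*l - t],
     [\<lambda>l t. (1 - 2*t)*l^3 + 3*t*l^2 - 3*t*l + t^2,
      \<lambda>l t. l^3 - 3*t*l^2 + 3*t*l + t^2 - 2*t,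
      \<lambda>l t. l^3 - 3*t*l^2 + 3*t*l - t^2,
      \<lambda>l t. 0]] ! (i - 1) ! (j - 1)"

lemma eq_up_to_sign: "x = y \<or> x = - y \<Longrightarrow> x = 0 \<longleftrightarrow> y = (0::complex)"
  by auto

text \<open>The equation of a curve in terms of the brackets of the five points: every point occurs in each monomial
  with the same multiplicity, so the vanishing is independent of the choice of coordinates.\<close>

definition E2 :: "complex \<Rightarrow> complex \<Rightarrow> complex \<Rightarrow> complex \<Rightarrow> complex \<Rightarrow> complex \<Rightarrow> complex" where
  "E2 a b c d e f = a^2*c*f - 2*a*b*e*c + e*b^2*d"
definition E3 :: "complex \<Rightarrow> complex \<Rightarrow> complex \<Rightarrow> complex \<Rightarrow> complex \<Rightarrow> complex \<Rightarrow> complex" where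
  "E3 a b c d e f = a^4*c^2*f^2 - 4*e*a^3*c^2*b*f + 6*e*a^2*c*b^2*d*f - 4*e*a*b^3*d^2*f + e^2*b^4*d^2"
definition E4 :: "complex \<Rightarrow> complex \<Rightarrow> complex \<Rightarrow> complex \<Rightarrow> complex \<Rightarrow> complex \<Rightarrow> complex" where
  "E4 a b c d e f = a^4*c^3*f - 2*a^3*c^2*b*d*f + 2*e*a*c*b^3*d^2 - e*b^4*d^3"
definition E5 :: "complex \<Rightarrow> complex \<Rightarrow> complex \<Rightarrow> complex \<Rightarrow> complex \<Rightarrow> complex \<Rightarrow> complex" where
  "E5 a b c d e f = 2*a^3*c^2*f - 3*a^2*c*b*d*f + e*b^3*d^2"


text \<open>One bracket expression produces all curves of a list: a label selects which of the five points plays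
  which role, and the signs come from the antisymmetry of the bracket.\<close>

lemma E_poly2:
  fixes i j k m :: nat and l t :: complex
  assumes "i \<in> {1..4}" "j \<in> {1..4}" "k \<in> {1..4}" "m \<in> {1..4}"
    "i \<noteq> j" "i \<noteq> k" "i \<noteq> m" "j \<noteq> k" "j \<noteq> m" "k \<noteq> m"
  defines "br \<equiv> \<lambda>i j. bracket (standard_config (l, t) i) (standard_config (l, t) j)"
  shows "E2 (br 0 k) (br 0 i) (br m i) (br m k) (br j k) (br j i) = br k i * poly2 i j l t \<or>
         E2 (br 0 k) (br 0 i) (br m i) (br m k) (br j k) (br j i) = - (br k i * poly2 i j l t)"
  using assms(1-10) unfolding atLeastAtMost_1_4
  apply (elim insertE emptyE)
  apply simp_all
  apply ((hypsubst_thin,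
    ((rule disjI2; (simp add: br_def bracket_def standard_config_def E2_def poly2_def Let_def); (simp add: algebra_simps power2_eq_square power3_eq_cube power4_eq_xxxx); fail) |
     (rule disjI1; (simp add: br_def bracket_def standard_config_def E2_def poly2_def Let_def); (simp add: algebra_simps power2_eq_square power3_eq_cube power4_eq_xxxx); fail)))+)
  done

lemma E_poly3:
  fixes i j k m :: nat and l t :: complex
  assumes "i \<in> {1..4}" "j \<in> {1..4}" "k \<in> {1..4}" "m \<in> {1..4}"
    "i \<noteq> j" "i \<noteq> k" "i \<noteq> m" "j \<noteq> k" "j \<noteq> m" "k \<noteq> m"
  defines "br \<equiv> \<lambda>i j. bracket (standard_config (l, t) i) (standard_config (l, t) j)"
  shows "E3 (br 0 k) (br 0 i) (br m i) (br m k) (br j k) (br j i) = br k i^2 * poly3 j l t \<or>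
         E3 (br 0 k) (br 0 i) (br m i) (br m k) (br j k) (br j i) = - (br k i^2 * poly3 j l t)"
  using assms(1-10) unfolding atLeastAtMost_1_4
  apply (elim insertE emptyE)
  apply simp_all
  apply ((hypsubst_thin,
    ((rule disjI2; (simp add: br_def bracket_def standard_config_def E3_def poly3_def); (simp add: algebra_simps power2_eq_square power3_eq_cube power4_eq_xxxx); fail) |
     (rule disjI1; (simp add: br_def bracket_def standard_config_def E3_def poly3_def); (simp add: algebra_simps power2_eq_square power3_eq_cube power4_eq_xxxx); fail)))+)
  done

lemma E_poly4:
  fixes i j k m :: nat and l t :: complex
  assumes "i \<in> {1..4}" "j \<in> {1..4}" "k \<in> {1..4}" "m \<in> {1..4}"
    "i \<noteq> j" "i \<noteq> k" "i \<noteq> m" "j \<noteq> k" "j \<noteq> m" "k \<noteq> m"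
  defines "br \<equiv> \<lambda>i j. bracket (standard_config (l, t) i) (standard_config (l, t) j)"
  shows "E4 (br 0 k) (br 0 i) (br m i) (br m k) (br j k) (br j i) = br k i * poly4 j l t \<or>
         E4 (br 0 k) (br 0 i) (br m i) (br m k) (br j k) (br j i) = - (br k i * poly4 j l t)"
  using assms(1-10) unfolding atLeastAtMost_1_4
  apply (elim insertE emptyE)
  apply simp_all
  apply ((hypsubst_thin,
    ((rule disjI2; (simp add: br_def bracket_def standard_config_def E4_def poly4_def); (simp add: algebra_simps power2_eq_square power3_eq_cube power4_eq_xxxx); fail) |
     (rule disjI1; (simp add: br_def bracket_def standard_config_def E4_def poly4_def); (simp add: algebra_simps power2_eq_square power3_eq_cube power4_eq_xxxx); fail)))+)
  done

lemma E_poly5: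
  fixes i j k m :: nat and l t :: complex
  assumes "i \<in> {1..4}" "j \<in> {1..4}" "k \<in> {1..4}" "m \<in> {1..4}"
    "i \<noteq> j" "i \<noteq> k" "i \<noteq> m" "j \<noteq> k" "j \<noteq> m" "k \<noteq> m"
  defines "br \<equiv> \<lambda>i j. bracket (standard_config (l, t) i) (standard_config (l, t) j)"
  shows "E5 (br 0 k) (br 0 i) (br m i) (br m k) (br j k) (br j i) = br k i * poly5 i j l t \<or>
         E5 (br 0 k) (br 0 i) (br m i) (br m k) (br j k) (br j i) = - (br k i * poly5 i j l t)"
  using assms(1-10) unfolding atLeastAtMost_1_4
  apply (elim insertE emptyE)
  apply simp_all
  apply ((hypsubst_thin,
    ((rule disjI2; (simp add: br_def bracket_def standard_config_def E5_def poly5_def); (simp add: algebra_simps power2_eq_square power3_eq_cube power4_eq_xxxx); fail) |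
     (rule disjI1; (simp add: br_def bracket_def standard_config_def E5_def poly5_def); (simp add: algebra_simps power2_eq_square power3_eq_cube power4_eq_xxxx); fail)))+)
  done

text \<open>Any label can be reached from the reference label \<open>(1, 4)\<close>.\<close>

lemma permutes_4_transitive:
  assumes "i \<in> {1..4::nat}" "j \<in> {1..4}" "i \<noteq> j"
  obtains p where "p permutes {1..4}" "p 1 = i" "p 4 = j"
proof -
  define r where "r = swap 1 i"
  define p where "p = swap (r 4) j \<circ> r"
  have r: "r permutes {1..4}" using assms by (auto simp: r_def intro!: permutes_swap_id)
  then have "r 4 \<in> {1..4}" using permutes_in_image by fastforce
  then have "p permutes {1..4}"
    unfolding p_def using assms by (intro permutes_compose[OF r] permutes_swap_id)
  moreover have "r 4 \<noteq> i" using assms by (auto simp: r_def Transposition.transpose_def)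
  then have "p 1 = i" using assms by (simp add: p_def r_def)
  moreover have "p 4 = j" by (simp add: p_def)
  ultimately show ?thesis by (rule that)
qed

lemma permutes_label:
  assumes "p permutes {1..4::nat}" "i \<in> {1..4}" "j \<in> {1..4}" "i \<noteq> j"
  shows "p i \<in> {1..4}" "p j \<in> {1..4}" "p i \<noteq> p j"
  using assms permutes_in_image[OF assms(1)] permutes_inj[OF assms(1)] by (auto simp: inj_eq)

text \<open>Covariance is required for the reference label \<open>(1, 4)\<close> only; since labels are permuted transitively this
  determines the behaviour of all of them.\<close>

locale label_family =
  fixes P :: "nat \<Rightarrow> nat \<Rightarrow> complex \<Rightarrow> complex \<Rightarrow> complex"
    and \<beta> :: "nat \<Rightarrow> nat \<Rightarrow> nat \<Rightarrow> complex"
  assumes covariant: "\<lbrakk>p permutes {1..4}; x \<in> regular_region\<rbrakk> \<Longrightarrow>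
      x \<in> curve (P (p 1) (p 4)) \<longleftrightarrow> normal_form (standard_config x \<circ> p) \<in> curve (P 1 4)"
    and equivariant_params: "p permutes {1..4} \<Longrightarrow> \<beta> (p i) (p j) (p k) = \<beta> i j k"
begin

lemma on_curve_act:
  assumes "p permutes {1..4}" "x \<in> regular_region" "i \<in> {1..4}" "j \<in> {1..4}" "i \<noteq> j"
  shows "act p x \<in> curve (P (p i) (p j)) \<longleftrightarrow> x \<in> curve (P i j)"
proof -
  have ref: "act q x \<in> curve (P (q 1) (q 4)) \<longleftrightarrow> x \<in> curve (P 1 4)"
    if "q permutes {1..4}" "x \<in> regular_region" for q x
  proof -
    have "normal_form (standard_config (act q x) \<circ> q) = act (inv' q) (act q x)"
      using that by (simp add: act_def permutes_inv_inv)
    then show ?thesis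
      using covariant[OF that(1) act_regular[OF that(2,1)]] act_inverse(2)[OF that(2,1)] by simp
  qed
  obtain q where q: "q permutes {1..4}" "q 1 = i" "q 4 = j"
    by (rule permutes_4_transitive[OF assms(3-5)])
  define y where "y = act (inv' q) x"
  have y: "y \<in> regular_region" "act q y = x"
    using assms q by (simp_all add: y_def act_inverse act_regular permutes_inv)
  have "act (p \<circ> q) y \<in> curve (P ((p \<circ> q) 1) ((p \<circ> q) 4)) \<longleftrightarrow> y \<in> curve (P 1 4)"
    by (rule ref[OF permutes_compose[OF q(1) assms(1)] y(1)])
  moreover have "act q y \<in> curve (P (q 1) (q 4)) \<longleftrightarrow> y \<in> curve (P 1 4)"
    by (rule ref[OF q(1) y(1)])
  ultimately show ?thesis
    using q y by (simp add: act_comp[OF y(1) assms(1) q(1)])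
qed

lemma curve_image:
  assumes "p permutes {1..4}" "i \<in> {1..4}" "j \<in> {1..4}" "i \<noteq> j"
  shows "act p ` (curve (P i j) \<inter> regular_region) = curve (P (p i) (p j)) \<inter> regular_region"
proof
  show "act p ` (curve (P i j) \<inter> regular_region) \<subseteq> curve (P (p i) (p j)) \<inter> regular_region"
    using assms on_curve_act act_regular by auto
  show "curve (P (p i) (p j)) \<inter> regular_region \<subseteq> act p ` (curve (P i j) \<inter> regular_region)"
  proof
    fix x assume x: "x \<in> curve (P (p i) (p j)) \<inter> regular_region"
    let ?y = "act (inv' p) x"
    have y: "?y \<in> regular_region" "act p ?y = x"
      using x assms(1) by (simp_all add: act_inverse act_regular permutes_inv)
    moreover have "?y \<in> curve (P i j)"
      using on_curve_act[OF assms(1) y(1) assms(2-4)] x y by simp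
    ultimately show "x \<in> act p ` (curve (P i j) \<inter> regular_region)" by force
  qed
qed

lemma permute_params_family:
  assumes "p permutes {1..4}"
  shows "permute_params p (params_of (\<beta> i j)) = params_of (\<beta> (p i) (p j))"
proof -
  have "\<beta> i j (inv' p k) = \<beta> (p i) (p j) k" for k
    using equivariant_params[OF assms, of i j "inv' p k"] permutes_inverses[OF assms] by simp
  then show ?thesis by (simp add: permute_params_of[OF assms] params_of_eq_iff)
qed

definition solutions :: "((complex \<times> complex) set \<times> params) set" where
  "solutions = {(curve (P i j), params_of (\<beta> i j)) |i j. i \<in> {1..4} \<and> j \<in> {1..4} \<and> i \<noteq> j}"

lemma solutions_cases:
  assumes "(C, \<alpha>) \<in> solutions"
  obtains i j where "i \<in> {1..4}" "j \<in> {1..4}" "i \<noteq> j" "C = curve (P i j)" "\<alpha> = params_of (\<beta> i j)"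
  using assms by (auto simp: solutions_def)

end

lemma normal_form_brackets:
  fixes v :: "nat \<Rightarrow> complex \<times> complex"
  assumes "p permutes {1..4}"
  defines "br \<equiv> \<lambda>i j. bracket (v i) (v j)"
  shows "normal_form (v \<circ> p) =
    (br 0 (p 2) * br (p 3) (p 1) / (br 0 (p 1) * br (p 3) (p 2)),
     br (p 4) (p 2) * br (p 3) (p 1) / (br (p 4) (p 1) * br (p 3) (p 2)))"
proof -
  have "p 0 = 0" using assms(1) by (simp add: permutes_def)
  then show ?thesis by (simp add: normal_form_def br_def)
qed

lemma E_poly_reference:
  assumes "b \<noteq> 0" "c \<noteq> 0" "d \<noteq> 0" "f \<noteq> 0"
  shows "poly2 1 4 (a * c / (b * d)) (e * c / (f * d)) = E2 a b c d e f * (c / (b^2 * d^2 * f))"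
    "poly3 4 (a * c / (b * d)) (e * c / (f * d)) = E3 a b c d e f * (c^2 / (b^4 * d^4 * f^2))"
    "poly4 4 (a * c / (b * d)) (e * c / (f * d)) = E4 a b c d e f * (c / (b^4 * d^4 * f))"
    "poly5 1 4 (a * c / (b * d)) (e * c / (f * d)) = E5 a b c d e f * (c / (b^3 * d^3 * f))"
  using assms
  by (simp add: poly2_def poly3_def poly4_def poly5_def E2_def E3_def E4_def E5_def;
      simp add: field_simps power2_eq_square power3_eq_cube power4_eq_xxxx)+

text \<open>Both sides are the same bracket expression, evaluated at a renumbered configuration.\<close>

lemma covariant_polys:
  assumes p: "p permutes {1..4}" and x: "x \<in> regular_region"
  shows "x \<in> curve (poly2 (p 1) (p 4)) \<longleftrightarrow> normal_form (standard_config x \<circ> p) \<in> curve (poly2 1 4)"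
    "x \<in> curve (poly3 (p 4)) \<longleftrightarrow> normal_form (standard_config x \<circ> p) \<in> curve (poly3 4)"
    "x \<in> curve (poly4 (p 4)) \<longleftrightarrow> normal_form (standard_config x \<circ> p) \<in> curve (poly4 4)"
    "x \<in> curve (poly5 (p 1) (p 4)) \<longleftrightarrow> normal_form (standard_config x \<circ> p) \<in> curve (poly5 1 4)"
proof -
  obtain l t where lt: "x = (l, t)" by (cases x)
  define br where "br i j = bracket (standard_config (l, t) i) (standard_config (l, t) j)" for i j
  have p4: "p i \<in> {1..4}" if "i \<in> {1..4}" for i
    using permutes_in_image[OF p] that by simp
  have pd: "p i \<noteq> p j" if "i \<noteq> j" for i j
    using permutes_inj[OF p] that by (simp add: inj_eq)
  have nz: "br i j \<noteq> 0" if "i \<in> {..4}" "j \<in> {..4}" "i \<noteq> j" for i j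
    using generic_standard_config[of x] x that by (auto simp: br_def lt generic_config_def)
  have p0: "p i \<noteq> 0" "p i \<le> 4" if "1 \<le> i" "i \<le> 4" for i
    using p4[of i] that by auto
  have nz': "br (p 3) (p 1) \<noteq> 0" "br (p 3) (p 2) \<noteq> 0" "br (p 4) (p 1) \<noteq> 0" "br (p 2) (p 1) \<noteq> 0"
    "br 0 (p 1) \<noteq> 0"
    by (rule nz; simp add: p0 p0(1)[symmetric] pd)+
  note nf = normal_form_brackets[OF p, of "standard_config (l, t)", folded br_def]
  note labels = p4[of 1, simplified] p4[of 4, simplified] p4[of 2, simplified] p4[of 3, simplified]
  show "x \<in> curve (poly2 (p 1) (p 4)) \<longleftrightarrow> normal_form (standard_config x \<circ> p) \<in> curve (poly2 1 4)"
    using eq_up_to_sign[OF E_poly2[of "p 1" "p 4" "p 2" "p 3" l t, folded br_def]] labels pd nz'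
    by (simp add: lt curve_def nf E_poly_reference)
  show "x \<in> curve (poly3 (p 4)) \<longleftrightarrow> normal_form (standard_config x \<circ> p) \<in> curve (poly3 4)"
    using eq_up_to_sign[OF E_poly3[of "p 1" "p 4" "p 2" "p 3" l t, folded br_def]] labels pd nz'
    by (simp add: lt curve_def nf E_poly_reference)
  show "x \<in> curve (poly4 (p 4)) \<longleftrightarrow> normal_form (standard_config x \<circ> p) \<in> curve (poly4 4)"
    using eq_up_to_sign[OF E_poly4[of "p 1" "p 4" "p 2" "p 3" l t, folded br_def]] labels pd nz'
    by (simp add: lt curve_def nf E_poly_reference)
  show "x \<in> curve (poly5 (p 1) (p 4)) \<longleftrightarrow> normal_form (standard_config x \<circ> p) \<in> curve (poly5 1 4)"
    using eq_up_to_sign[OF E_poly5[of "p 1" "p 4" "p 2" "p 3" l t, folded br_def]] labels pd nz'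
    by (simp add: lt curve_def nf E_poly_reference)
qed

definition params2 :: "complex \<Rightarrow> nat \<Rightarrow> nat \<Rightarrow> nat \<Rightarrow> complex" where
  "params2 c i j k = (if k = i \<or> k = j then 1/8 else c)"

definition params3 :: "nat \<Rightarrow> nat \<Rightarrow> nat \<Rightarrow> complex" where
  "params3 i j k = (if k = j then 9/8 else 1/8)"

definition params4 :: "nat \<Rightarrow> nat \<Rightarrow> nat \<Rightarrow> complex" where
  "params4 i j k = 1/8"

definition params5 :: "nat \<Rightarrow> nat \<Rightarrow> nat \<Rightarrow> complex" where
  "params5 i j k = (if k = i then 1/2 else if k = j then 1/18 else 1/8)"

interpretation fam2: label_family poly2 "params2 c" for c
  by unfold_locales (auto simp: covariant_polys params2_def inj_eq[OF permutes_inj])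

interpretation fam3: label_family "\<lambda>i. poly3" params3
  by unfold_locales (auto simp: covariant_polys params3_def inj_eq[OF permutes_inj])

interpretation fam4: label_family "\<lambda>i. poly4" params4
  by unfold_locales (auto simp: covariant_polys params4_def)

interpretation fam5: label_family poly5 params5
  by unfold_locales (auto simp: covariant_polys params5_def inj_eq[OF permutes_inj])

lemma labels_Un:
  "{F i j |i j. i \<in> {1..4::nat} \<and> j \<in> {1..4::nat} \<and> i \<noteq> j} =
    {F 1 2, F 1 3, F 1 4, F 2 1, F 2 3, F 2 4, F 3 1, F 3 2, F 3 4, F 4 1, F 4 2, F 4 3}"
proof -
  have "{(i, j). i \<in> {1..4::nat} \<and> j \<in> {1..4::nat} \<and> i \<noteq> j} =
      {(1, 2), (1, 3), (1, 4), (2, 1), (2, 3), (2, 4), (3, 1), (3, 2), (3, 4), (4, 1), (4, 2), (4, 3)}"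
    unfolding atLeastAtMost_1_4 by auto
  moreover have "{F i j |i j. i \<in> {1..4::nat} \<and> j \<in> {1..4::nat} \<and> i \<noteq> j} =
      (\<lambda>(i, j). F i j) ` {(i, j). i \<in> {1..4::nat} \<and> j \<in> {1..4::nat} \<and> i \<noteq> j}"
    by auto
  ultimately show ?thesis by simp
qed

text \<open>The label families are the four lists of the classification.\<close>

lemma solutions_lists:
  "solutions_2 = fam2.solutions (1/18) \<union> fam2.solutions (1/2)"
  "solutions_3 = fam3.solutions"
  "solutions_4 = fam4.solutions"
  "solutions_5 = fam5.solutions"
proof -
  show "solutions_2 = fam2.solutions (1/18) \<union> fam2.solutions (1/2)"
    unfolding solutions_2_def fam2.solutions_def labels_Un
    by (intro subset_antisym; simp add: poly2_def params2_def params_of_def Let_def)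
  show "solutions_3 = fam3.solutions"
    unfolding solutions_3_def fam3.solutions_def labels_Un
    by (intro subset_antisym; simp add: poly3_def params3_def params_of_def)
  show "solutions_4 = fam4.solutions"
    unfolding solutions_4_def fam4.solutions_def labels_Un
    by (intro subset_antisym; simp add: poly4_def params4_def params_of_def)
  show "solutions_5 = fam5.solutions"
    unfolding solutions_5_def fam5.solutions_def labels_Un
    by (intro subset_antisym; simp add: poly5_def params5_def params_of_def)
qed

section \<open>Stabilizers\<close>

lemma iso_sym_closed:
  assumes "G \<cong> H" "\<And>x y. x \<in> carrier G \<Longrightarrow> y \<in> carrier G \<Longrightarrow> x \<otimes>\<^bsub>G\<^esub> y \<in> carrier G"
  shows "H \<cong> G"
proof -
  obtain h where h: "h \<in> hom G H" "bij_betw h (carrier G) (carrier H)"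
    using assms(1) by (auto simp: is_iso_def iso_def)
  define k where "k = inv_into (carrier G) h"
  have k: "k y \<in> carrier G" "h (k y) = y" if "y \<in> carrier H" for y
    using h(2) that unfolding k_def by (auto simp: bij_betw_def inv_into_into f_inv_into_f)
  have kh: "k (h x) = x" if "x \<in> carrier G" for x
    using h(2) that unfolding k_def by (auto simp: bij_betw_def)
  have "k \<in> hom H G"
  proof (rule homI)
    fix x y assume xy: "x \<in> carrier H" "y \<in> carrier H"
    have "x \<otimes>\<^bsub>H\<^esub> y = h (k x \<otimes>\<^bsub>G\<^esub> k y)"
      using hom_mult[OF h(1) k(1)[OF xy(1)] k(1)[OF xy(2)]] k(2) xy by simp
    then show "k (x \<otimes>\<^bsub>H\<^esub> y) = k x \<otimes>\<^bsub>G\<^esub> k y"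
      using kh assms(2) k xy by simp
  qed (use k in auto)
  moreover have "bij_betw k (carrier H) (carrier G)"
    unfolding k_def by (rule bij_betw_inv_into[OF h(2)])
  ultimately show ?thesis by (auto simp: is_iso_def iso_def)
qed

abbreviation sub_sym4 :: "((nat \<Rightarrow> nat) \<Rightarrow> bool) \<Rightarrow> (nat \<Rightarrow> nat) monoid" where
  "sub_sym4 Q \<equiv> (sym_group 4)\<lparr>carrier := {p. p permutes {1..4} \<and> Q p}\<rparr>"

text \<open>Solutions with different labels have conjugate stabilizers, so it is enough to treat the reference label.\<close>

lemma conjugate_iso:
  assumes "q permutes {1..4}" "\<And>p. p permutes {1..4} \<Longrightarrow> Q' p \<longleftrightarrow> Q (q \<circ> p \<circ> inv' q)"
  shows "sub_sym4 Q' \<cong> sub_sym4 Q"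
proof (rule is_isoI)
  let ?h = "\<lambda>p. q \<circ> p \<circ> inv' q"
  note q' = permutes_inv[OF assms(1)]
  have qq: "q \<circ> inv' q = id" "inv' q \<circ> q = id" by (rule permutes_inv_o[OF assms(1)])+
  have perm: "?h p permutes {1..4}" if "p permutes {1..4}" for p
    by (intro permutes_compose that assms(1) q')
  have cancel: "inv' q \<circ> ?h p \<circ> q = p" "?h (inv' q \<circ> p \<circ> q) = p" for p
    using permutes_inverses[OF assms(1)] by (simp_all add: fun_eq_iff)
  have "?h \<in> hom (sub_sym4 Q') (sub_sym4 Q)"
  proof (rule homI)
    fix p assume "p \<in> carrier (sub_sym4 Q')"
    then show "?h p \<in> carrier (sub_sym4 Q)" using perm assms(2)[of p] by simp
  next
    fix p r
    have "?h (p \<circ> r) = ?h p \<circ> ?h r"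
      using permutes_inverses[OF assms(1)] by (simp add: fun_eq_iff)
    then show "?h (p \<otimes>\<^bsub>sub_sym4 Q'\<^esub> r) = ?h p \<otimes>\<^bsub>sub_sym4 Q\<^esub> ?h r"
      by (simp add: sym_group_mult)
  qed
  moreover have "bij_betw ?h {p. p permutes {1..4} \<and> Q' p} {p. p permutes {1..4} \<and> Q p}"
  proof (rule bij_betwI[where g = "\<lambda>p. inv' q \<circ> p \<circ> q"])
    have "inv' q \<circ> p \<circ> q permutes {1..4}" if "p permutes {1..4}" for p
      by (intro permutes_compose that assms(1) q')
    then show "(\<lambda>p. inv' q \<circ> p \<circ> q) \<in> {p. p permutes {1..4} \<and> Q p} \<rightarrow> {p. p permutes {1..4} \<and> Q' p}"
      using assms(2) cancel(2) by (simp add: Pi_iff del: comp_apply)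
    show "?h \<in> {p. p permutes {1..4} \<and> Q' p} \<rightarrow> {p. p permutes {1..4} \<and> Q p}"
      using perm assms(2) by blast
  qed (simp_all only: cancel)
  ultimately show "?h \<in> iso (sub_sym4 Q') (sub_sym4 Q)" by (simp add: iso_def)
qed

context label_family
begin

lemma solution_stabilizer_iso:
  assumes ij: "i \<in> {1..4}" "j \<in> {1..4}" "i \<noteq> j"
    and sep: "\<And>i j. i \<in> {1..4} \<Longrightarrow> j \<in> {1..4} \<Longrightarrow> i \<noteq> j \<Longrightarrow>
      curve (P i j) \<inter> regular_region = curve (P 1 4) \<inter> regular_region \<longleftrightarrow> L i j"
  shows "sub_sym4 (\<lambda>p. L (p 1) (p 4)) \<cong> solution_stabilizer (curve (P i j))"
proof -
  obtain q where q: "q permutes {1..4}" "q 1 = i" "q 4 = j"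
    by (rule permutes_4_transitive[OF ij])
  let ?R = "regular_region"
  let ?Q = "\<lambda>p. curve (P (p i) (p j)) \<inter> ?R = curve (P i j) \<inter> ?R"
  have "L (p 1) (p 4) \<longleftrightarrow> ?Q (q \<circ> p \<circ> inv' q)" if p: "p permutes {1..4}" for p
  proof -
    have lab: "p 1 \<in> {1..4}" "p 4 \<in> {1..4}" "p 1 \<noteq> p 4"
      using permutes_label[OF p, of 1 4] by simp_all
    have "act q ` (curve (P (p 1) (p 4)) \<inter> ?R) = curve (P (q (p 1)) (q (p 4))) \<inter> ?R"
      by (rule curve_image[OF q(1) lab])
    moreover have "act q ` (curve (P 1 4) \<inter> ?R) = curve (P i j) \<inter> ?R"
      using curve_image[OF q(1), of 1 4] q by simp
    ultimately have "curve (P (q (p 1)) (q (p 4))) \<inter> ?R = curve (P i j) \<inter> ?R \<longleftrightarrow>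
        curve (P (p 1) (p 4)) \<inter> ?R = curve (P 1 4) \<inter> ?R"
      using inj_on_image_eq_iff[OF bij_betw_imp_inj_on[OF act_bij[OF q(1)]], of "curve (P (p 1) (p 4)) \<inter> ?R" "curve (P 1 4) \<inter> ?R"]
      by simp
    moreover have "inv' q i = 1" "inv' q j = 4"
      using q by (auto simp: permutes_inv_eq)
    ultimately show ?thesis using sep[OF lab] by simp
  qed
  then have "sub_sym4 (\<lambda>p. L (p 1) (p 4)) \<cong> sub_sym4 ?Q"
    by (rule conjugate_iso[OF q(1)])
  also have "sub_sym4 ?Q \<cong> solution_stabilizer (curve (P i j))"
    unfolding solution_stabilizer_def
  proof (rule subgroup_iso)
    let ?A = "curve (P i j) \<inter> ?R"
    have img: "fst (S4_map p) ` ?A = curve (P (p i) (p j)) \<inter> ?R" if "p permutes {1..4}" for p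
      unfolding curve_image[OF that ij, symmetric] S4_map_def by (auto simp: image_iff)
    have "{(g, \<pi>). (g, \<pi>) \<in> S4_elements \<and> g ` ?A = ?A} = {x \<in> S4_elements. fst x ` ?A = ?A}"
      by auto
    also have "\<dots> = S4_map ` {p. p permutes {1..4} \<and> fst (S4_map p) ` ?A = ?A}"
      unfolding S4_elements_eq by blast
    also have "\<dots> = S4_map ` {p. p permutes {1..4} \<and> ?Q p}"
      using img by (intro arg_cong[where f = "image S4_map"] Collect_cong conj_cong) auto
    finally show "S4_map ` {p. p permutes {1..4} \<and> ?Q p} =
        {(g, \<pi>). (g, \<pi>) \<in> S4_elements \<and> g ` ?A = ?A}" ..
  qed
  finally (iso_trans) show ?thesis .
qed

lemma PVI_stabilizer_iso:
  assumes ij: "i \<in> {1..4}" "j \<in> {1..4}" "i \<noteq> j"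
    and sep: "\<And>i j. i \<in> {1..4} \<Longrightarrow> j \<in> {1..4} \<Longrightarrow> i \<noteq> j \<Longrightarrow>
      params_of (\<beta> i j) = params_of (\<beta> 1 4) \<longleftrightarrow> L i j"
  shows "sub_sym4 (\<lambda>p. L (p 1) (p 4)) \<cong> PVI_stabilizer (params_of (\<beta> i j))"
proof -
  obtain q where q: "q permutes {1..4}" "q 1 = i" "q 4 = j"
    by (rule permutes_4_transitive[OF ij])
  let ?Q = "\<lambda>p. params_of (\<beta> (p i) (p j)) = params_of (\<beta> i j)"
  have "L (p 1) (p 4) \<longleftrightarrow> ?Q (q \<circ> p \<circ> inv' q)" if p: "p permutes {1..4}" for p
  proof -
    have lab: "p 1 \<in> {1..4}" "p 4 \<in> {1..4}" "p 1 \<noteq> p 4"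
      using permutes_label[OF p, of 1 4] by simp_all
    have "permute_params q (params_of (\<beta> (p 1) (p 4))) = params_of (\<beta> (q (p 1)) (q (p 4)))"
      "permute_params q (params_of (\<beta> 1 4)) = params_of (\<beta> i j)"
      using q by (simp_all add: permute_params_family)
    then have "params_of (\<beta> (q (p 1)) (q (p 4))) = params_of (\<beta> i j) \<longleftrightarrow>
        params_of (\<beta> (p 1) (p 4)) = params_of (\<beta> 1 4)"
      using inj_eq[OF bij_is_inj[OF permute_params_bij[OF q(1)]], of "params_of (\<beta> (p 1) (p 4))" "params_of (\<beta> 1 4)"]
      by simp
    moreover have "inv' q i = 1" "inv' q j = 4"
      using q by (auto simp: permutes_inv_eq)
    ultimately show ?thesis using sep[OF lab] by simp
  qed
  then have "sub_sym4 (\<lambda>p. L (p 1) (p 4)) \<cong> sub_sym4 ?Q"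
    by (rule conjugate_iso[OF q(1)])
  also have "sub_sym4 ?Q \<cong> PVI_stabilizer (params_of (\<beta> i j))"
    unfolding PVI_stabilizer_def
  proof (rule subgroup_iso)
    show "S4_map ` {p. p permutes {1..4} \<and> ?Q p} =
        {(g, \<pi>). (g, \<pi>) \<in> S4_elements \<and> \<pi> (params_of (\<beta> i j)) = params_of (\<beta> i j)}"
      unfolding S4_elements_eq by (auto simp: S4_map_def permute_params_family)
  qed
  finally (iso_trans) show ?thesis .
qed

end

lemma sym_group_closed:
  "p \<in> carrier (sym_group n) \<Longrightarrow> q \<in> carrier (sym_group n) \<Longrightarrow>
    p \<otimes>\<^bsub>sym_group n\<^esub> q \<in> carrier (sym_group n)"
  by (simp add: sym_group_def permutes_compose)

lemma sub_sym4_True: "(sym_group 4)\<lparr>carrier := {p. p permutes {1..4}}\<rparr> = sym_group 4"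
  by (simp add: sym_group_def)

lemma permutes_smaller:
  assumes "n \<le> 4"
  shows "p permutes {1..4::nat} \<and> (\<forall>i\<in>{n<..4}. p i = i) \<longleftrightarrow> p permutes {1..n}"
proof
  assume p: "p permutes {1..4} \<and> (\<forall>i\<in>{n<..4}. p i = i)"
  have "p x = x" if "x \<in> {1..4} - {1..n}" for x
    using p that by auto
  then show "p permutes {1..n}" using p permutes_superset by blast
next
  assume p: "p permutes {1..n}"
  then have "p permutes {1..4}" using assms by (intro permutes_subset[OF p]) auto
  moreover have "p i = i" if "i \<in> {n<..4}" for i
    using permutes_not_in[OF p, of i] that by auto
  ultimately show "p permutes {1..4} \<and> (\<forall>i\<in>{n<..4}. p i = i)" by blast
qed

lemma sub_sym4_sym3: "sub_sym4 (\<lambda>p. p 4 = 4) = sym_group 3"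
proof -
  have "{3<..4::nat} = {4}" by auto
  then show ?thesis using permutes_smaller[of 3] by (simp add: sym_group_def)
qed

lemma sub_sym4_sym2: "sub_sym4 (\<lambda>p. p 1 = 1 \<and> p 4 = 4) \<cong> sym_group 2"
proof -
  have "{2<..4::nat} = {3, 4}" by auto
  then have "sub_sym4 (\<lambda>p. p 3 = 3 \<and> p 4 = 4) = sym_group 2"
    using permutes_smaller[of 2] by (simp add: sym_group_def)
  moreover have "sub_sym4 (\<lambda>p. p 1 = 1 \<and> p 4 = 4) \<cong> sub_sym4 (\<lambda>p. p 3 = 3 \<and> p 4 = 4)"
  proof (rule conjugate_iso)
    show "swap 1 3 permutes {1..4}" by (intro permutes_swap_id) simp_all
  qed (auto simp: Transposition.transpose_def)
  ultimately show ?thesis by simp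
qed

lemma permutes_4_cases:
  assumes "p permutes {1..4::nat}"
  shows "p 1 \<in> {1,2,3,4}" "p 2 \<in> {1,2,3,4}" "p 3 \<in> {1,2,3,4}" "p 4 \<in> {1,2,3,4}"
    "p 1 \<noteq> p 2" "p 1 \<noteq> p 3" "p 1 \<noteq> p 4" "p 2 \<noteq> p 3" "p 2 \<noteq> p 4" "p 3 \<noteq> p 4"
  using permutes_in_image[OF assms] permutes_inj[OF assms]
  unfolding atLeastAtMost_1_4 by (simp_all add: inj_eq)

lemma polygon_edge_4:
  assumes "i \<in> {1..4}" "j \<in> {1..4}"
  shows "polygon_edge 4 i j \<longleftrightarrow> odd (i + j)"
  using assms unfolding atLeastAtMost_1_4 by (elim insertE emptyE) (simp_all add: polygon_edge_def)

text \<open>The permutations respecting the partition \<open>{1, 4}, {2, 3}\<close> preserve the pairs of opposite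
  vertices of a square after a renumbering of its vertices.\<close>

lemma sub_sym4_dihedral:
  "sub_sym4 (\<lambda>p. {p 1, p 4} = {1, 4} \<or> {p 1, p 4} = {2, 3}) \<cong> dihedral_group 4"
proof -
  let ?D = "\<lambda>p. \<forall>i\<in>{1..4}. \<forall>j\<in>{1..4}. polygon_edge 4 (p i) (p j) \<longleftrightarrow> polygon_edge 4 i j"
  let ?s = "swap 3 4"
  have s: "?s permutes {1..4}" by (intro permutes_swap_id) simp_all
  have "{p 1, p 4} = {1, 4} \<or> {p 1, p 4} = {2, 3} \<longleftrightarrow> ?D (?s \<circ> p \<circ> inv' ?s)"
    if p: "p permutes {1..4}" for p
  proof -
    define r where "r = ?s \<circ> p \<circ> ?s"
    have r: "r permutes {1..4}" unfolding r_def by (intro permutes_compose p s)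
    have "?D r \<longleftrightarrow> (\<forall>i\<in>{1..4}. \<forall>j\<in>{1..4}. odd (r i + r j) \<longleftrightarrow> odd (i + j))"
      using permutes_in_image[OF r] by (simp add: polygon_edge_4)
    also have "\<dots> \<longleftrightarrow> (odd (r 1 + r 3) \<longleftrightarrow> False)"
      using permutes_4_cases[OF r] unfolding atLeastAtMost_1_4
      by (elim insertE emptyE) simp_all
    also have "\<dots> \<longleftrightarrow> even (?s (p 1) + ?s (p 4))"
      by (simp add: r_def Transposition.transpose_def)
    also have "\<dots> \<longleftrightarrow> {p 1, p 4} = {1, 4} \<or> {p 1, p 4} = {2, 3}"
      using permutes_4_cases[OF p]
      by (elim insertE emptyE) (simp_all add: Transposition.transpose_def doubleton_eq_iff)
    finally show ?thesis by (simp add: r_def)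
  qed
  then have "sub_sym4 (\<lambda>p. {p 1, p 4} = {1, 4} \<or> {p 1, p 4} = {2, 3}) \<cong> sub_sym4 ?D"
    by (rule conjugate_iso[OF s])
  then show ?thesis by (simp add: dihedral_group_def)
qed

lemma permutes_2: "p permutes {1..2::nat} \<longleftrightarrow> p = id \<or> p = swap 1 2"
proof -
  have "{1..2::nat} = {1, 2}" by auto
  then show ?thesis by (simp add: permutes_doubleton_iff)
qed

lemma sub_sym4_Klein:
  "sym_group 2 \<times>\<times> sym_group 2 \<cong> sub_sym4 (\<lambda>p. {p 1, p 4} = {1, 4})"
proof (rule is_isoI)
  define \<phi> where "\<phi> = (\<lambda>q :: nat \<Rightarrow> nat. if q = id then id else swap 1 4)"
  define \<psi> where "\<psi> = (\<lambda>q :: nat \<Rightarrow> nat. if q = id then id else swap 2 3)"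
  define h where "h = (\<lambda>(p::nat\<Rightarrow>nat, q::nat\<Rightarrow>nat). \<phi> p \<circ> \<psi> q)"
  let ?K = "sub_sym4 (\<lambda>p. {p 1, p 4} = {1, 4})"
  have "swap 1 2 1 \<noteq> id 1" by simp
  then have ne: "swap 1 2 \<noteq> id" by metis
  have swaps: "swap 1 4 permutes {1..4}" "swap 2 3 permutes {1..4}" "id permutes {1..4::nat}"
    by (auto intro!: permutes_swap_id permutes_id)
  have carrier: "carrier (sym_group 2 \<times>\<times> sym_group 2) = {(id, id), (id, swap 1 2), (swap 1 2, id), (swap 1 2, swap 1 2)}"
    by (auto simp: sym_group_carrier permutes_2 DirProd_def)
  have carrier_K: "carrier ?K = h ` carrier (sym_group 2 \<times>\<times> sym_group 2)"
  proof
    show "h ` carrier (sym_group 2 \<times>\<times> sym_group 2) \<subseteq> carrier ?K"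
      unfolding carrier using swaps ne
      by (auto simp: h_def \<phi>_def \<psi>_def Transposition.transpose_def intro!: permutes_compose)
    show "carrier ?K \<subseteq> h ` carrier (sym_group 2 \<times>\<times> sym_group 2)"
    proof
      fix p assume "p \<in> carrier ?K"
      then have p: "p permutes {1..4}" "{p 1, p 4} = {1, 4}" by auto
      have out: "p k = k" if "k \<noteq> 1" "k \<noteq> 2" "k \<noteq> 3" "k \<noteq> 4" for k
        using permutes_not_in[OF p(1), of k] that unfolding atLeastAtMost_1_4 by auto
      have a: "p 1 = 1 \<and> p 4 = 4 \<or> p 1 = 4 \<and> p 4 = 1" using p(2) by (auto simp: doubleton_eq_iff)
      have "p 2 = 2 \<and> p 3 = 3 \<or> p 2 = 3 \<and> p 3 = 2"
        using a permutes_4_cases(2,3,5-10)[OF p(1)] by (elim disjE conjE insertE emptyE) simp_all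
      note ab = a this
      have "p k = ((if p 1 = 1 then id else swap 1 4) \<circ> (if p 2 = 2 then id else swap 2 3)) k" for k
      proof (cases "k \<in> {1, 2, 3, 4}")
        case True
        with ab show ?thesis
          by (elim disjE insertE emptyE conjE; hypsubst) (simp_all add: Transposition.transpose_def)
      qed (simp add: out Transposition.transpose_def)
      then have "p = (if p 1 = 1 then id else swap 1 4) \<circ> (if p 2 = 2 then id else swap 2 3)"
        by (rule ext)
      also have "\<dots> = h (if p 1 = 1 then id else swap 1 2, if p 2 = 2 then id else swap 1 2)"
        using ne by (simp add: h_def \<phi>_def \<psi>_def)
      finally show "p \<in> h ` carrier (sym_group 2 \<times>\<times> sym_group 2)"
        by (rule image_eqI) (simp add: sym_group_carrier permutes_2)
    qed
  qed
  have comm: "swap 1 4 \<circ> swap 2 3 = swap 2 3 \<circ> swap 1 4"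
    by (auto simp: fun_eq_iff Transposition.transpose_def)
  have hom: "\<phi> (p \<circ> q) = \<phi> p \<circ> \<phi> q" "\<psi> (p \<circ> q) = \<psi> p \<circ> \<psi> q" "\<psi> p \<circ> \<phi> q = \<phi> q \<circ> \<psi> p"
    if "p permutes {1..2}" "q permutes {1..2}" for p q
    using that ne by (auto simp: permutes_2 \<phi>_def \<psi>_def comm)
  have "h \<in> hom (sym_group 2 \<times>\<times> sym_group 2) ?K"
  proof (rule homI)
    fix x y assume xy: "x \<in> carrier (sym_group 2 \<times>\<times> sym_group 2)" "y \<in> carrier (sym_group 2 \<times>\<times> sym_group 2)"
    obtain p q p' q' where e: "x = (p, q)" "y = (p', q')" by (cases x, cases y)
    with xy have "p permutes {1..2}" "q permutes {1..2}" "p' permutes {1..2}" "q' permutes {1..2}"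
      by (auto simp: DirProd_def sym_group_carrier)
    then have "\<phi> (p \<circ> p') \<circ> \<psi> (q \<circ> q') = (\<phi> p \<circ> \<psi> q) \<circ> (\<phi> p' \<circ> \<psi> q')"
      using hom(1)[of p p'] hom(2)[of q q'] hom(3)[of q p'] by (metis comp_assoc)
    then show "h (x \<otimes>\<^bsub>sym_group 2 \<times>\<times> sym_group 2\<^esub> y) = h x \<otimes>\<^bsub>?K\<^esub> h y"
      by (simp add: e h_def sym_group_mult)
  qed (use carrier_K in auto)
  moreover have "inj_on h (carrier (sym_group 2 \<times>\<times> sym_group 2))"
  proof (rule inj_onI)
    fix x y assume xy: "x \<in> carrier (sym_group 2 \<times>\<times> sym_group 2)"
      "y \<in> carrier (sym_group 2 \<times>\<times> sym_group 2)" "h x = h y"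
    then have "h x 1 = h y 1" "h x 2 = h y 2" by simp_all
    with xy(1,2) show "x = y"
      unfolding carrier using ne
      by (auto simp: h_def \<phi>_def \<psi>_def Transposition.transpose_def)
  qed
  ultimately show "h \<in> iso (sym_group 2 \<times>\<times> sym_group 2) ?K"
    using carrier_K by (simp add: iso_def bij_betw_def)
qed


text \<open>A single point \<open>x\<close> of the reference curve, lying on no other curve of the list, is enough to tell the
  curves apart; \<open>L\<close> and \<open>M\<close> describe the labels with the same curve and with the same parameter.\<close>

lemma (in label_family) stabilizers:
  assumes ij: "i \<in> {1..4}" "j \<in> {1..4}" "i \<noteq> j"
    and x: "x \<in> curve (P 1 4) \<inter> regular_region"
    and sep: "\<And>i j. i \<in> {1..4} \<Longrightarrow> j \<in> {1..4} \<Longrightarrow> i \<noteq> j \<Longrightarrow> x \<in> curve (P i j) \<Longrightarrow> L i j"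
    and eq: "\<And>i j. L i j \<Longrightarrow> P i j = P 1 4"
    and psep: "\<And>i j. i \<in> {1..4} \<Longrightarrow> j \<in> {1..4} \<Longrightarrow> i \<noteq> j \<Longrightarrow>
      params_of (\<beta> i j) = params_of (\<beta> 1 4) \<longleftrightarrow> M i j"
    and G: "sub_sym4 (\<lambda>p. L (p 1) (p 4)) \<cong> G" and H: "sub_sym4 (\<lambda>p. M (p 1) (p 4)) \<cong> H"
    and L: "\<And>p q. p permutes {1..4} \<Longrightarrow> q permutes {1..4} \<Longrightarrow> L (p 1) (p 4) \<Longrightarrow> L (q 1) (q 4) \<Longrightarrow> L (p (q 1)) (p (q 4))"
    and M: "\<And>p q. p permutes {1..4} \<Longrightarrow> q permutes {1..4} \<Longrightarrow> M (p 1) (p 4) \<Longrightarrow> M (q 1) (q 4) \<Longrightarrow> M (p (q 1)) (p (q 4))"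
  shows "solution_stabilizer (curve (P i j)) \<cong> G \<and> PVI_stabilizer (params_of (\<beta> i j)) \<cong> H"
proof
  have "sub_sym4 (\<lambda>p. L (p 1) (p 4)) \<cong> solution_stabilizer (curve (P i j))"
  proof (rule solution_stabilizer_iso[OF ij])
    fix i j assume ij: "i \<in> {1..4::nat}" "j \<in> {1..4::nat}" "i \<noteq> j"
    show "curve (P i j) \<inter> regular_region = curve (P 1 4) \<inter> regular_region \<longleftrightarrow> L i j"
    proof
      assume "curve (P i j) \<inter> regular_region = curve (P 1 4) \<inter> regular_region"
      with x have "x \<in> curve (P i j)" by auto
      then show "L i j" by (rule sep[OF ij])
    next
      assume "L i j"
      then show "curve (P i j) \<inter> regular_region = curve (P 1 4) \<inter> regular_region" by (simp add: eq)
    qed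
  qed
  then have "solution_stabilizer (curve (P i j)) \<cong> sub_sym4 (\<lambda>p. L (p 1) (p 4))"
    by (rule iso_sym_closed) (use L in \<open>auto simp: sym_group_mult intro: permutes_compose\<close>)
  then show "solution_stabilizer (curve (P i j)) \<cong> G" using G by (rule iso_trans)
  have "sub_sym4 (\<lambda>p. M (p 1) (p 4)) \<cong> PVI_stabilizer (params_of (\<beta> i j))"
    by (rule PVI_stabilizer_iso[OF ij psep])
  then have "PVI_stabilizer (params_of (\<beta> i j)) \<cong> sub_sym4 (\<lambda>p. M (p 1) (p 4))"
    by (rule iso_sym_closed) (use M in \<open>auto simp: sym_group_mult intro: permutes_compose\<close>)
  then show "PVI_stabilizer (params_of (\<beta> i j)) \<cong> H" using H by (rule iso_trans)
qed

lemma sub_sym4_Klein': "sub_sym4 (\<lambda>p. {p 1, p 4} = {1, 4}) \<cong> sym_group 2 \<times>\<times> sym_group 2"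
  using sub_sym4_Klein by (rule iso_sym_closed) (auto simp: sym_group_closed[unfolded sym_group_carrier] DirProd_def sym_group_closed)

lemma stabilizers_2:
  assumes "i \<in> {1..4}" "j \<in> {1..4}" "i \<noteq> j" "c \<noteq> 1/8"
  shows "solution_stabilizer (curve (poly2 i j)) \<cong> dihedral_group 4 \<and>
    PVI_stabilizer (params_of (params2 c i j)) \<cong> sym_group 2 \<times>\<times> sym_group 2"
proof (rule fam2.stabilizers[where x = "(2, 4/3)", OF assms(1-3) _ _ _ _ sub_sym4_dihedral sub_sym4_Klein'])
  show "(2, 4/3) \<in> curve (poly2 1 4) \<inter> regular_region"
    by (simp add: curve_def regular_region_def poly2_def Let_def power2_eq_square)
  show "{i, j} = {1, 4} \<or> {i, j} = {2, 3}"
    if "i \<in> {1..4}" "j \<in> {1..4}" "i \<noteq> j" "(2, 4/3) \<in> curve (poly2 i j)" for i j :: nat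
    using that unfolding atLeastAtMost_1_4
    by (elim insertE emptyE; hypsubst) (simp_all add: curve_def poly2_def Let_def power2_eq_square insert_commute)
  show "poly2 i j = poly2 1 4" if "{i, j} = {1, 4} \<or> {i, j} = {2, 3}" for i j
    using that unfolding doubleton_eq_iff by (elim disjE conjE; hypsubst) (simp_all add: poly2_def Let_def)
  show "params_of (params2 c i j) = params_of (params2 c 1 4) \<longleftrightarrow> {i, j} = {1, 4}"
    if "i \<in> {1..4}" "j \<in> {1..4}" "i \<noteq> j" for i j :: nat
    using that assms(4) unfolding atLeastAtMost_1_4
    by (elim insertE emptyE; hypsubst) (simp_all add: params_of_def params2_def doubleton_eq_iff)
next
  fix p q :: "nat \<Rightarrow> nat" assume pq: "p permutes {1..4}" "q permutes {1..4}"
  show "{p (q 1), p (q 4)} = {1, 4}" if "{p 1, p 4} = {1, 4}" "{q 1, q 4} = {1, 4}"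
    using that by (auto simp: doubleton_eq_iff)
  show "{p (q 1), p (q 4)} = {1, 4} \<or> {p (q 1), p (q 4)} = {2, 3}"
    if "{p 1, p 4} = {1, 4} \<or> {p 1, p 4} = {2, 3}" "{q 1, q 4} = {1, 4} \<or> {q 1, q 4} = {2, 3}"
  proof -
    have "{p 2, p 3} = {1, 4} \<or> {p 2, p 3} = {2, 3}"
      using that(1) permutes_4_cases(2,3,5-10)[OF pq(1)] unfolding doubleton_eq_iff
      by (elim disjE conjE insertE emptyE) simp_all
    with that show ?thesis unfolding doubleton_eq_iff by (elim disjE conjE) simp_all
  qed
qed

lemma stabilizers_3:
  assumes "i \<in> {1..4}" "j \<in> {1..4}" "i \<noteq> j"
  shows "solution_stabilizer (curve (poly3 j)) \<cong> sym_group 3 \<and>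
    PVI_stabilizer (params_of (params3 i j)) \<cong> sym_group 3"
proof (rule fam3.stabilizers[where x = "(8/5, 128/125)" and L = "\<lambda>i j. j = 4" and M = "\<lambda>i j. j = 4",
      OF assms(1-3)])
  show "(8/5, 128/125) \<in> curve (poly3 4) \<inter> regular_region"
    by (simp add: curve_def regular_region_def poly3_def power2_eq_square power3_eq_cube power4_eq_xxxx)
  show "j = 4" if "j \<in> {1..4}" "(8/5, 128/125) \<in> curve (poly3 j)" for j :: nat
    using that unfolding atLeastAtMost_1_4
    by (elim insertE emptyE; hypsubst)
      (simp_all add: curve_def poly3_def power2_eq_square power3_eq_cube power4_eq_xxxx)
  show "params_of (params3 i j) = params_of (params3 1 4) \<longleftrightarrow> j = 4" if "j \<in> {1..4}" for i j :: nat
    using that unfolding atLeastAtMost_1_4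
    by (elim insertE emptyE; hypsubst) (simp_all add: params_of_def params3_def)
qed (simp_all add: sub_sym4_sym3 iso_refl)

lemma stabilizers_4:
  assumes "i \<in> {1..4}" "j \<in> {1..4}" "i \<noteq> j"
  shows "solution_stabilizer (curve (poly4 j)) \<cong> sym_group 3 \<and>
    PVI_stabilizer (params_of (params4 i j)) \<cong> sym_group 4"
proof (rule fam4.stabilizers[where x = "(3/2, 27/32)" and L = "\<lambda>i j. j = 4" and M = "\<lambda>i j. True",
      OF assms(1-3)])
  show "(3/2, 27/32) \<in> curve (poly4 4) \<inter> regular_region"
    by (simp add: curve_def regular_region_def poly4_def power2_eq_square power3_eq_cube power4_eq_xxxx)
  show "j = 4" if "j \<in> {1..4}" "(3/2, 27/32) \<in> curve (poly4 j)" for j :: nat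
    using that unfolding atLeastAtMost_1_4
    by (elim insertE emptyE; hypsubst)
      (simp_all add: curve_def poly4_def power2_eq_square power3_eq_cube power4_eq_xxxx)
  show "params_of (params4 i j) = params_of (params4 1 4) \<longleftrightarrow> True" for i j :: nat
    by (simp add: params_of_def params4_def)
qed (simp_all add: sub_sym4_sym3 sub_sym4_True iso_refl)

lemma stabilizers_5:
  assumes "i \<in> {1..4}" "j \<in> {1..4}" "i \<noteq> j"
  shows "solution_stabilizer (curve (poly5 i j)) \<cong> sym_group 2 \<and>
    PVI_stabilizer (params_of (params5 i j)) \<cong> sym_group 2"
proof (rule fam5.stabilizers[where x = "(2, - 4)", OF assms(1-3) _ _ _ _ sub_sym4_sym2 sub_sym4_sym2])
  show "(2, - 4) \<in> curve (poly5 1 4) \<inter> regular_region"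
    by (simp add: curve_def regular_region_def poly5_def)
  show "i = 1 \<and> j = 4" if "i \<in> {1..4}" "j \<in> {1..4}" "i \<noteq> j" "(2, - 4) \<in> curve (poly5 i j)" for i j :: nat
    using that unfolding atLeastAtMost_1_4
    by (elim insertE emptyE; hypsubst) (simp_all add: curve_def poly5_def)
  show "params_of (params5 i j) = params_of (params5 1 4) \<longleftrightarrow> i = 1 \<and> j = 4"
    if "i \<in> {1..4}" "j \<in> {1..4}" "i \<noteq> j" for i j :: nat
    using that unfolding atLeastAtMost_1_4
    by (elim insertE emptyE; hypsubst) (simp_all add: params_of_def params5_def)
qed simp_all

section \<open>Symmetries of the Painleve equation\<close>

text \<open>Under each of the three generating substitutions the right-hand side transforms in the same way as a second
  derivative; this is the invariance of the equation, as an identity of rational functions.\<close>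

lemma PVI_rhs_1:
  "PVI_rhs (swap12 \<alpha>) (1 - t) (1 - l) l' = - PVI_rhs \<alpha> t l l'"
proof -
  obtain a0 a1 a2 a3 where \<alpha>: "\<alpha> = (a0, a1, a2, a3)" by (cases \<alpha>)
  have "1 / (1 - l) = - (1 / (l - 1))" "1 / (- l) = - (1 / l)" "1 / (t - l) = - (1 / (l - t))"
    "1 / (1 - t) = - (1 / (t - 1))" "1 / (- t) = - (1 / t)"
    by (metis minus_divide_right minus_diff_eq)+
  moreover have "(1 - l)^2 = (l - 1)^2" "(1 - t)^2 = (t - 1)^2" "(t - l)^2 = (l - t)^2"
    by (simp_all add: power2_commute)
  ultimately show ?thesis
    by (simp add: \<alpha> PVI_rhs_def) (simp add: algebra_simps add_divide_distrib diff_divide_distrib)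
qed

lemma PVI_rhs_2:
  assumes "(l, t) \<in> regular_region"
  shows "PVI_rhs (swap01 \<alpha>) (1 / t) (1 / l) (t^2 * l' / l^2) =
    - (t^2) * (2 * t * l' / l^2 + t^2 * PVI_rhs \<alpha> t l l' / l^2 - 2 * t^2 * l'^2 / l^3)"
proof -
  obtain a0 a1 a2 a3 where \<alpha>: "\<alpha> = (a0, a1, a2, a3)" by (cases \<alpha>)
  define A where "A = 1/2 * (1 / l + 1 / (l - 1) + 1 / (l - t))"
  define B where "B = 1 / t + 1 / (t - 1) + 1 / (l - t)"
  define K where "K = l * (l - 1) * (l - t) / (t^2 * (t - 1)^2)"
  define L where "L = a0 - a1 * (t / l^2) + a2 * ((t - 1) / (l - 1)^2) + (1/2 - a3) * (t * (t - 1) / (l - t)^2)"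
  have nz: "t \<noteq> 0" "t - 1 \<noteq> 0" "l \<noteq> 0" "l - 1 \<noteq> 0" "l - t \<noteq> 0"
    using assms by (auto simp: regular_region_def)
  have i: "1 / (1 / l) = l" "1 / (1 / l - 1) = - l / (l - 1)" "1 / (1 / l - 1 / t) = - l * t / (l - t)"
    "1 / (1 / t) = t" "1 / (1 / t - 1) = - t / (t - 1)"
    using nz by (simp_all add: divide_simps; simp add: algebra_simps)+
  have A: "1/2 * (1 / (1 / l) + 1 / (1 / l - 1) + 1 / (1 / l - 1 / t)) = 2 * l - l^2 * A"
    unfolding i A_def using nz by (simp add: divide_simps; algebra)
  have B: "1 / (1 / t) + 1 / (1 / t - 1) + 1 / (1 / l - 1 / t) = 2 * t + t^2 * (- B)"
    unfolding i B_def using nz by (simp add: divide_simps; algebra)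
  have K: "1 / l * (1 / l - 1) * (1 / l - 1 / t) / ((1 / t)^2 * (1 / t - 1)^2) = K * (t^5 / l^4)"
    unfolding K_def using nz by (simp add: divide_simps; algebra)
  have "1 / t / (1 / l)^2 = l^2 / t" "(1 / t - 1) / (1 / l - 1)^2 = - (l^2 / t) * ((t - 1) / (l - 1)^2)"
    "1 / t * (1 / t - 1) / (1 / l - 1 / t)^2 = - (l^2 / t) * (t * (t - 1) / (l - t)^2)"
    using nz by (simp_all add: divide_simps; algebra)+
  note terms = this
  have r: "l^2 / t * (t / l^2) = 1" using nz by simp
  have "b - a * r + c * (- r * x) + d * (- r * y) = - r * (a - b * q + c * x + d * y)"
    if "r * q = 1" for a b c d r x y q :: complex
    using that by algebra
  note this[OF r]
  then have L: "a1 - a0 * (1 / t / (1 / l)^2) + a2 * ((1 / t - 1) / (1 / l - 1)^2)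
      + (1/2 - a3) * (1 / t * (1 / t - 1) / (1 / l - 1 / t)^2) = - (l^2 / t) * L"
    unfolding L_def terms .
  have 1: "PVI_rhs (swap01 \<alpha>) (1 / t) (1 / l) (t^2 * l' / l^2) =
      (2 * l - l^2 * A) * (t^2 * l' / l^2)^2 - (2 * t + t^2 * (- B)) * (t^2 * l' / l^2)
      + K * (t^5 / l^4) * (- (l^2 / t) * L)"
    unfolding PVI_rhs_def \<alpha> swap01.simps prod.case A B K L ..
  have 2: "PVI_rhs \<alpha> t l l' = A * l'^2 - B * l' + K * L"
    by (simp add: PVI_rhs_def \<alpha> A_def B_def K_def L_def)
  show ?thesis
    unfolding 1 2 using nz by (simp add: divide_simps; algebra)
qed

lemma PVI_rhs_3:
  assumes "(l, t) \<in> regular_region"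
  shows "PVI_rhs (swap13 \<alpha>) (t / (t - 1)) ((t - l) / (t - 1)) (1 - l + (t - 1) * l') =
    - ((t - 1)^3) * PVI_rhs \<alpha> t l l'"
proof -
  obtain a0 a1 a2 a3 where \<alpha>: "\<alpha> = (a0, a1, a2, a3)" by (cases \<alpha>)
  define A where "A = 1/2 * (1 / l + 1 / (l - 1) + 1 / (l - t))"
  define B where "B = 1 / t + 1 / (t - 1) + 1 / (l - t)"
  define K where "K = l * (l - 1) * (l - t) / (t^2 * (t - 1)^2)"
  define L where "L = a0 - a1 * (t / l^2) + a2 * ((t - 1) / (l - 1)^2) + (1/2 - a3) * (t * (t - 1) / (l - t)^2)"
  have nz: "t \<noteq> 0" "t - 1 \<noteq> 0" "l \<noteq> 0" "l - 1 \<noteq> 0" "l - t \<noteq> 0" "t - l \<noteq> 0"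
    using assms by (auto simp: regular_region_def)
  define u where "u = t - 1"
  have u: "u \<noteq> 0" using nz by (simp add: u_def)
  have d: "(t - l) / u = - (l - t) / u" "- (l - t) / u - 1 = - (l - 1) / u"
    "- (l - t) / u - t / u = - l / u" "t / u - 1 = 1 / u"
    using nz by (simp_all add: u_def divide_simps)
  have r: "1 / (- v / u) = - u * (1 / v)" "t / u / (- v / u)^2 = t * u / v^2"
    "1 / u / (- v / u)^2 = u / v^2" "t / u * (1 / u) / (- v / u)^2 = t / v^2" for v :: complex
    using u by (simp_all add: power2_eq_square)
  have A: "1/2 * (1 / (- (l - t) / u) + 1 / (- (l - 1) / u) + 1 / (- l / u)) = - u * A"
    unfolding A_def r by (simp add: algebra_simps)
  have "(- x / u) * (- w / u) * (- v / u) / ((t / u)^2 * (1 / u)^2) = - (u^3) * (v * w * x / (t^2 * u^2))"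
    for v w x :: complex
    using u nz by (simp add: field_simps power2_eq_square power3_eq_cube)
  then have K: "(- (l - t) / u) * (- (l - 1) / u) * (- l / u) / ((t / u)^2 * (1 / u)^2) = - (u^3) * K"
    unfolding K_def u_def .
  have regroup: "b - d * y + c * z + (1/2 - a) * x = b - a * x + c * z + (1/2 - d) * y + 1/2 * (x - y)"
    for a b c d x y z :: complex
    by (simp add: field_simps)
  have L: "a0 - a3 * (t / u / (- (l - t) / u)^2) + a2 * (1 / u / (- (l - 1) / u)^2)
      + (1/2 - a1) * (t / u * (1 / u) / (- l / u)^2)
      = L + 1/2 * (t / l^2 - t * u / (l - t)^2)"
    unfolding r unfolding L_def u_def by (rule regroup)
  have 1: "PVI_rhs (swap13 \<alpha>) (t / (t - 1)) ((t - l) / (t - 1)) (1 - l + (t - 1) * l') =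
      - u * A * (1 - l + u * l')^2
      - (1 / (t / u) + 1 / (1 / u) + 1 / (- l / u)) * (1 - l + u * l')
      + - (u^3) * K * (L + 1/2 * (t / l^2 - t * u / (l - t)^2))"
    unfolding PVI_rhs_def \<alpha> swap13.simps prod.case d A K L u_def[symmetric] ..
  have 2: "PVI_rhs \<alpha> t l l' = A * l'^2 - B * l' + K * L"
    by (simp add: PVI_rhs_def \<alpha> A_def B_def K_def L_def)
  have B: "1 / (t / u) + 1 / (1 / u) + 1 / (- l / u) = - 2 * u * A * (1 - l) - u^2 * B"
    unfolding A_def B_def u_def using nz by (simp add: divide_simps; algebra)
  have C: "u * A * (1 - l)^2 + u^2 * B * (1 - l) = u^3 * K * (1/2 * (t / l^2 - t * u / (l - t)^2))"
  proof -
    have "A * (1 - l) = 1/2 * ((1 - l) / l - 1 + (1 - l) / (l - t))"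
      unfolding A_def using nz by (simp add: divide_simps; algebra)
    moreover have "u * B = u / t + 1 + u / (l - t)"
      unfolding B_def using u by (simp add: distrib_left flip: u_def)
    ultimately have "A * (1 - l) + u * B = - (1/2 * (1 / t - 1 / l - u * l / (t * (l - t))))"
      unfolding u_def using nz by (simp add: divide_simps; algebra)
    moreover have "u^3 * K * (1/2 * (t / l^2 - t * u / (l - t)^2)) =
        u * (1 - l) * - (1/2 * (1 / t - 1 / l - u * l / (t * (l - t))))"
    proof -
      define d where "d = l - t"
      have nz': "l \<noteq> 0" "t \<noteq> 0" "d \<noteq> 0" using nz by (simp_all add: d_def)
      have "u^3 * K = u * (l * (l - 1) * d / t^2)"
        using u nz' by (simp add: K_def power2_eq_square power3_eq_cube flip: u_def d_def)
      then have "u^3 * K * X = u * (l * (l - 1) * d / t^2 * X)" for X by simp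
      moreover have "l * (l - 1) * d / t^2 * (1/2 * (t / l^2 - t * u / d^2)) =
          1/2 * ((l - 1) / t) * (d / l - u * l / d)"
        using nz' by (simp add: divide_simps power2_eq_square; algebra)
      moreover have "1 / t - 1 / l - u * l / (t * d) = 1 / t * (d / l - u * l / d)"
        using nz' by (simp add: d_def right_diff_distrib diff_divide_distrib)
      moreover have "u * (1/2 * ((l - 1) / t) * X) = u * (1 - l) * - (1/2 * (1 / t * X))" for X
        by (simp add: algebra_simps diff_divide_distrib)
      ultimately show ?thesis unfolding d_def[symmetric] by (simp only:)
    qed
    moreover have "u * A * (1 - l)^2 + u^2 * B * (1 - l) = u * (1 - l) * (A * (1 - l) + u * B)"
      by (simp add: algebra_simps power2_eq_square)
    ultimately show ?thesis by simp
  qed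
  have "- u * A * (1 - l + u * l')^2 - (- 2 * u * A * (1 - l) - u^2 * B) * (1 - l + u * l')
      + - (u^3) * K * (L + H) = - (u^3) * (A * l'^2 - B * l' + K * L)"
    if "u * A * (1 - l)^2 + u^2 * B * (1 - l) = u^3 * K * H" for H
  proof -
    have "- (u^3) * K * (L + H) = - (u^3) * K * L - (u * A * (1 - l)^2 + u^2 * B * (1 - l))"
      unfolding that by (simp add: algebra_simps)
    then show ?thesis by (simp add: algebra_simps power2_eq_square power3_eq_cube)
  qed
  from this[OF C] show ?thesis
    unfolding 1 2 B unfolding u_def[symmetric] .
qed

lemma deriv_deriv_eq:
  assumes "open S" "\<And>s. s \<in> S \<Longrightarrow> (h has_field_derivative e s) (at s)" "s \<in> S"
    and "(e has_field_derivative e2) (at s)"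
  shows "deriv h s = e s" "deriv (deriv h) s = e2"
proof -
  show "deriv h s = e s" using assms by (intro DERIV_imp_deriv) auto
  have "(deriv h has_field_derivative e2) (at s)"
    by (rule has_field_derivative_transform_within_open[OF assms(4,1,3)])
      (use assms(2) DERIV_imp_deriv in fastforce)
  then show "deriv (deriv h) s = e2" by (rule DERIV_imp_deriv)
qed

lemma holomorphic_DERIV:
  assumes "f holomorphic_on U" "open U" "t \<in> U"
  shows "(f has_field_derivative deriv f t) (at t)" "(deriv f has_field_derivative deriv (deriv f) t) (at t)"
  using assms holomorphic_derivI holomorphic_deriv by blast+

text \<open>The remaining part is the chain rule: a branch \<open>f\<close> over \<open>U\<close> becomes a branch over the image of \<open>U\<close>.\<close>

lemma satisfies_PVI_x1:
  assumes "open U" "f holomorphic_on U" "satisfies_PVI \<alpha> U f"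
    and "open S" "\<And>s. s \<in> S \<Longrightarrow> 1 - s \<in> U"
  shows "satisfies_PVI (swap12 \<alpha>) S (\<lambda>s. 1 - f (1 - s))"
  unfolding satisfies_PVI_def
proof
  fix s assume s: "s \<in> S"
  note D = holomorphic_DERIV[OF assms(2,1)]
  have e: "((\<lambda>s. 1 - f (1 - s)) has_field_derivative deriv f (1 - s)) (at s)" if "s \<in> S" for s
    by (auto intro!: derivative_eq_intros DERIV_chain2[OF D(1)] assms(5) that)
  have e2: "((\<lambda>s. deriv f (1 - s)) has_field_derivative - deriv (deriv f) (1 - s)) (at s)"
  proof -
    have "((\<lambda>s. 1 - s) has_field_derivative - 1) (at s)" by (auto intro!: derivative_eq_intros)
    from DERIV_chain2[OF D(2)[OF assms(5)[OF s]] this] show ?thesis by simp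
  qed
  show "deriv (deriv (\<lambda>s. 1 - f (1 - s))) s =
      PVI_rhs (swap12 \<alpha>) s (1 - f (1 - s)) (deriv (\<lambda>s. 1 - f (1 - s)) s)"
    using PVI_rhs_1[of \<alpha> "1 - s" "f (1 - s)" "deriv f (1 - s)"] assms(3,5) s
    by (simp add: satisfies_PVI_def deriv_deriv_eq(1)[OF assms(4) e s e2] deriv_deriv_eq(2)[OF assms(4) e s e2])
qed

lemma satisfies_PVI_x2:
  assumes "open U" "f holomorphic_on U" "satisfies_PVI \<alpha> U f" "\<And>t. t \<in> U \<Longrightarrow> (f t, t) \<in> regular_region"
    and "open S" "\<And>s. s \<in> S \<Longrightarrow> s \<noteq> 0 \<and> 1 / s \<in> U"
  shows "satisfies_PVI (swap01 \<alpha>) S (\<lambda>s. 1 / f (1 / s))"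
  unfolding satisfies_PVI_def
proof
  fix s assume s: "s \<in> S"
  note D = holomorphic_DERIV[OF assms(2,1)]
  define e where "e s = (1 / s)^2 * deriv f (1 / s) / (f (1 / s))^2" for s
  have nz: "s \<noteq> 0" "f (1 / s) \<noteq> 0" if "s \<in> S" for s
    using assms(4,6) that by (auto simp: regular_region_def)
  have e: "((\<lambda>s. 1 / f (1 / s)) has_field_derivative e s) (at s)" if "s \<in> S" for s
    using nz[OF that] assms(6)[OF that]
    by (auto intro!: derivative_eq_intros DERIV_chain2[OF D(1)] simp: e_def power2_eq_square)
  define t l l' l'' where "t = 1 / s" and "l = f t" and "l' = deriv f t" and "l'' = deriv (deriv f) t"
  have tnz: "t \<noteq> 0" "l \<noteq> 0" "s = 1 / t" using nz[OF s] by (auto simp: t_def l_def)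
  have tU: "t \<in> U" using assms(6)[OF s] by (simp add: t_def)
  have "((\<lambda>t. t^2 * deriv f t / (f t)^2) has_field_derivative
      2 * t * l' / l^2 + t^2 * l'' / l^2 - 2 * t^2 * l'^2 / l^3) (at t)"
    unfolding l_def l'_def l''_def using D[OF tU] tnz(2)[unfolded l_def]
    by (auto intro!: derivative_eq_intros simp: field_simps power2_eq_square power3_eq_cube)
  moreover have "((\<lambda>s. 1 / s) has_field_derivative - (t^2)) (at s)"
    using nz[OF s] by (auto intro!: derivative_eq_intros simp: t_def power2_eq_square)
  ultimately have e2: "(e has_field_derivative
      (2 * t * l' / l^2 + t^2 * l'' / l^2 - 2 * t^2 * l'^2 / l^3) * - (t^2)) (at s)"
    unfolding e_def t_def by (rule DERIV_chain2)
  have "l'' = PVI_rhs \<alpha> t l l'" "(l, t) \<in> regular_region"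
    using assms(3,4,6) s by (simp_all add: satisfies_PVI_def t_def l_def l'_def l''_def)
  moreover have "deriv (\<lambda>s. 1 / f (1 / s)) s = e s"
    by (rule deriv_deriv_eq(1)[OF assms(5) e s e2])
  moreover have "deriv (deriv (\<lambda>s. 1 / f (1 / s))) s =
      (2 * t * l' / l^2 + t^2 * l'' / l^2 - 2 * t^2 * l'^2 / l^3) * - (t^2)"
    by (rule deriv_deriv_eq(2)[OF assms(5) e s e2])
  moreover have "e s = t^2 * l' / l^2" "f (1 / s) = l"
    by (simp_all add: e_def t_def l_def l'_def)
  ultimately show "deriv (deriv (\<lambda>s. 1 / f (1 / s))) s =
      PVI_rhs (swap01 \<alpha>) s (1 / f (1 / s)) (deriv (\<lambda>s. 1 / f (1 / s)) s)"
    using PVI_rhs_2[of l t \<alpha> l'] tnz(3) by (simp add: mult.commute)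
qed

lemma satisfies_PVI_x3:
  assumes "open U" "f holomorphic_on U" "satisfies_PVI \<alpha> U f" "\<And>t. t \<in> U \<Longrightarrow> (f t, t) \<in> regular_region"
    and "open S" "\<And>s. s \<in> S \<Longrightarrow> s \<noteq> 1 \<and> s / (s - 1) \<in> U"
  defines "h \<equiv> \<lambda>s. (s / (s - 1) - f (s / (s - 1))) / (s / (s - 1) - 1)"
  shows "satisfies_PVI (swap13 \<alpha>) S h"
  unfolding satisfies_PVI_def
proof
  fix s assume s: "s \<in> S"
  note D = holomorphic_DERIV[OF assms(2,1)]
  define \<tau> where "\<tau> = (\<lambda>s :: complex. s / (s - 1))"
  have \<tau>: "(\<tau> has_field_derivative - (1 / (s - 1)^2)) (at s)" if "s \<in> S" for s
    unfolding \<tau>_def using assms(6)[OF that]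
    by (auto intro!: derivative_eq_intros simp: power2_eq_square divide_simps)
  have ne: "s - 1 \<noteq> 0" "\<tau> s \<in> U" "\<tau> s - 1 = 1 / (s - 1)" if "s \<in> S" for s
    using assms(6)[OF that] by (auto simp: \<tau>_def divide_simps)
  have h: "h s = s - (s - 1) * f (\<tau> s)" if "s \<in> S" for s
  proof -
    have "h s = (\<tau> s - f (\<tau> s)) / (\<tau> s - 1)" by (simp add: h_def \<tau>_def)
    also have "\<dots> = \<tau> s * (s - 1) - (s - 1) * f (\<tau> s)"
      unfolding ne(3)[OF that] by (simp add: algebra_simps)
    finally show ?thesis using ne[OF that] by (simp add: \<tau>_def)
  qed
  define e where "e s = 1 - f (\<tau> s) + deriv f (\<tau> s) / (s - 1)" for s
  have e: "(h has_field_derivative e s) (at s)" if "s \<in> S" for s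
  proof (rule has_field_derivative_transform_within_open[OF _ assms(5) that h[symmetric]])
    show "((\<lambda>s. s - (s - 1) * f (\<tau> s)) has_field_derivative e s) (at s)"
      using ne[OF that]
      by (auto intro!: derivative_eq_intros DERIV_chain2[OF D(1) \<tau>[OF that]]
          simp: e_def power2_eq_square divide_simps) (simp add: algebra_simps)
  qed
  have e2: "(e has_field_derivative - (deriv (deriv f) (\<tau> s) / (s - 1)^3)) (at s)"
    unfolding e_def using ne[OF s]
    by (auto intro!: derivative_eq_intros DERIV_chain2[OF D(1) \<tau>[OF s]] DERIV_chain2[OF D(2) \<tau>[OF s]])
      (simp add: divide_simps power2_eq_square power3_eq_cube)
  define t where "t = \<tau> s"
  have t: "t \<in> U" "t - 1 \<noteq> 0" "s = t / (t - 1)" "1 / (s - 1) = t - 1"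
    using ne[OF s] by (simp_all add: t_def) (simp add: \<tau>_def)
  have "h s = (t - f t) / (t - 1)"
    by (simp add: h_def t_def \<tau>_def)
  moreover have "e s = 1 - f t + (t - 1) * deriv f t"
    unfolding e_def t(4)[symmetric] by (simp add: t_def)
  moreover have "- (deriv (deriv f) (\<tau> s) / (s - 1)^3) = - ((t - 1)^3) * deriv (deriv f) t"
    unfolding t(4)[symmetric] by (simp add: t_def power_divide)
  moreover have "deriv (deriv f) t = PVI_rhs \<alpha> t (f t) (deriv f t)" "(f t, t) \<in> regular_region"
    using assms(3,4) t by (simp_all add: satisfies_PVI_def)
  moreover have "deriv h s = e s" by (rule deriv_deriv_eq(1)[OF assms(5) e s e2])
  moreover have "deriv (deriv h) s = - (deriv (deriv f) (\<tau> s) / (s - 1)^3)"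
    by (rule deriv_deriv_eq(2)[OF assms(5) e s e2])
  ultimately show "deriv (deriv h) s = PVI_rhs (swap13 \<alpha>) s (h s) (deriv h s)"
    using PVI_rhs_3[of "f t" t \<alpha> "deriv f t"] t(3) by simp
qed

text \<open>The symmetry \<open>x\<close> carries branches of the one curve to branches of the other; its inverse is of the same
  kind, so that all branches are reached.\<close>

lemma algebraic_PVI_solution_transport:
  fixes G :: "complex \<times> complex \<Rightarrow> complex \<times> complex" and \<tau> :: "complex \<Rightarrow> complex"
  defines "T \<equiv> UNIV - {0, 1 :: complex}"
  assumes G: "\<And>x. x \<in> regular_region \<Longrightarrow> G (G x) = x \<and> G x \<in> regular_region \<and> snd (G x) = \<tau> (snd x)"
    and \<tau>: "\<tau> holomorphic_on T" "\<And>t. t \<in> T \<Longrightarrow> \<tau> t \<in> T \<and> \<tau> (\<tau> t) = t"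
    and hol: "\<And>S f. f holomorphic_on S \<Longrightarrow> (\<And>s. s \<in> S \<Longrightarrow> (f s, \<tau> s) \<in> regular_region) \<Longrightarrow> S \<subseteq> T \<Longrightarrow>
      (\<lambda>s. fst (G (f s, \<tau> s))) holomorphic_on S"
    and PVI: "\<And>U S f. open U \<Longrightarrow> f holomorphic_on U \<Longrightarrow> satisfies_PVI \<alpha> U f \<Longrightarrow>
      (\<And>t. t \<in> U \<Longrightarrow> (f t, t) \<in> regular_region) \<Longrightarrow> open S \<Longrightarrow> (\<And>s. s \<in> S \<Longrightarrow> s \<in> T \<and> \<tau> s \<in> U) \<Longrightarrow>
      satisfies_PVI \<alpha>' S (\<lambda>s. fst (G (f (\<tau> s), \<tau> s)))"
    and img: "G ` (C \<inter> regular_region) = C' \<inter> regular_region"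
    and sol: "algebraic_PVI_solution C \<alpha>"
  shows "algebraic_PVI_solution C' \<alpha>'"
proof -
  define pull where "pull U = {s \<in> T. \<tau> s \<in> U}" for U
  define tr where "tr f s = fst (G (f (\<tau> s), \<tau> s))" for f :: "complex \<Rightarrow> complex" and s
  have T: "open T" by (simp add: T_def open_Diff)
  have reg_T: "t \<in> T" if "(l, t) \<in> regular_region" for l t
    using that by (auto simp: T_def regular_region_def)
  have branch: "branch_of D' (pull U) (tr f)"
    if b: "branch_of D U f" and GD: "\<And>x. x \<in> D \<inter> regular_region \<Longrightarrow> G x \<in> D'" for D D' U f
  proof -
    have U: "open U" "U \<noteq> {}" "f holomorphic_on U" "\<And>t. t \<in> U \<Longrightarrow> (f t, t) \<in> D \<inter> regular_region"
      using b by (auto simp: branch_of_def)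
    have "open (pull U)"
    proof -
      have "pull U = T \<inter> \<tau> -` U" by (auto simp: pull_def)
      then show ?thesis
        using continuous_open_preimage[OF holomorphic_on_imp_continuous_on[OF \<tau>(1)] T U(1)] by simp
    qed
    moreover obtain t where t: "t \<in> U" using U(2) by auto
    then have "t \<in> T" using U(4) reg_T by blast
    then have "\<tau> t \<in> pull U" using \<tau>(2) t by (simp add: pull_def)
    then have "pull U \<noteq> {}" by auto
    moreover have "tr f holomorphic_on pull U"
      unfolding tr_def
    proof (rule hol)
      show "(\<lambda>s. f (\<tau> s)) holomorphic_on pull U"
        by (rule holomorphic_on_compose_gen[OF holomorphic_on_subset[OF \<tau>(1)] U(3), unfolded o_def])
          (auto simp: pull_def)
    qed (use U(4) in \<open>auto simp: pull_def\<close>)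
    moreover have "(tr f s, s) \<in> D' \<inter> regular_region" if "s \<in> pull U" for s
    proof -
      have s: "s \<in> T" "\<tau> s \<in> U" using that by (auto simp: pull_def)
      let ?x = "(f (\<tau> s), \<tau> s)"
      have "?x \<in> D \<inter> regular_region" using U(4) s by blast
      then have "G ?x \<in> D' \<inter> regular_region" "snd (G ?x) = s"
        using GD G \<tau>(2) s(1) by auto
      then show ?thesis unfolding tr_def by (metis prod.collapse)
    qed
    ultimately show ?thesis by (auto simp: branch_of_def)
  qed
  have CC': "G x \<in> C'" if "x \<in> C \<inter> regular_region" for x
    using img that by blast
  have C'C: "G x \<in> C" if "x \<in> C' \<inter> regular_region" for x
  proof -
    from that img obtain y where "y \<in> C \<inter> regular_region" "x = G y" by blast
    then show ?thesis using G by auto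
  qed
  obtain U f where "branch_of C U f" using sol by (auto simp: algebraic_PVI_solution_def)
  then have "branch_of C' (pull U) (tr f)" using branch CC' by blast
  moreover have "satisfies_PVI \<alpha>' U' h" if b: "branch_of C' U' h" for U' h
  proof -
    have b': "branch_of C (pull U') (tr h)" by (rule branch[OF b C'C])
    then have "satisfies_PVI \<alpha> (pull U') (tr h)" using sol by (simp add: algebraic_PVI_solution_def)
    moreover have U': "s \<in> T \<and> \<tau> s \<in> pull U'" if "s \<in> U'" for s
      using b that reg_T \<tau>(2) by (auto simp: branch_of_def pull_def)
    ultimately have 1: "satisfies_PVI \<alpha>' U' (\<lambda>s. fst (G (tr h (\<tau> s), \<tau> s)))"
      using b' b by (intro PVI[of "pull U'"]) (auto simp: branch_of_def)
    have eq: "fst (G (tr h (\<tau> s), \<tau> s)) = h s" if "s \<in> U'" for s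
    proof -
      have s: "(h s, s) \<in> regular_region" using b that by (auto simp: branch_of_def)
      have "\<tau> (\<tau> s) = s" using \<tau>(2) reg_T[OF s] by blast
      then have "(tr h (\<tau> s), \<tau> s) = G (h s, s)"
        using G[OF s] by (simp add: tr_def prod_eq_iff)
      then show ?thesis using G[OF s] by simp
    qed
    have op: "open U'" using b by (simp add: branch_of_def)
    have d1: "deriv (\<lambda>s. fst (G (tr h (\<tau> s), \<tau> s))) s = deriv h s" if "s \<in> U'" for s
      by (rule deriv_cong_ev[OF _ refl]) (use eq op that in \<open>auto simp: eventually_nhds\<close>)
    have d2: "deriv (deriv (\<lambda>s. fst (G (tr h (\<tau> s), \<tau> s)))) s = deriv (deriv h) s" if "s \<in> U'" for s
      by (rule deriv_cong_ev[OF _ refl]) (use d1 op that in \<open>auto simp: eventually_nhds\<close>)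
    show ?thesis using 1 by (simp add: satisfies_PVI_def eq d1 d2)
  qed
  ultimately show ?thesis by (auto simp: algebraic_PVI_solution_def)
qed

lemma x_involutions:
  assumes "x \<in> regular_region"
  shows "x1 (x1 x) = x \<and> x1 x \<in> regular_region \<and> snd (x1 x) = 1 - snd x"
    "x2 (x2 x) = x \<and> x2 x \<in> regular_region \<and> snd (x2 x) = 1 / snd x"
    "x3 (x3 x) = x \<and> x3 x \<in> regular_region \<and> snd (x3 x) = snd x / (snd x - 1)"
proof -
  obtain l t where x: "x = (l, t)" by (cases x)
  have "act (swap 2 4 \<circ> swap 2 4) x = act (swap 2 4) (act (swap 2 4) x)"
    using assms by (intro act_comp generators_permute)
  then have "x3 (x3 x) = x" "x3 x \<in> regular_region"
    using act_regular[OF assms generators_permute(3)] assms by (simp_all add: act_generators act_id)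
  then show "x3 (x3 x) = x \<and> x3 x \<in> regular_region \<and> snd (x3 x) = snd x / (snd x - 1)"
    by (simp add: x)
  show "x1 (x1 x) = x \<and> x1 x \<in> regular_region \<and> snd (x1 x) = 1 - snd x"
    "x2 (x2 x) = x \<and> x2 x \<in> regular_region \<and> snd (x2 x) = 1 / snd x"
    using assms by (auto simp: x regular_region_def)
qed

lemma algebraic_PVI_solution_generators:
  assumes "algebraic_PVI_solution C \<alpha>"
  shows "x1 ` (C \<inter> regular_region) = C' \<inter> regular_region \<Longrightarrow> algebraic_PVI_solution C' (swap12 \<alpha>)"
    "x2 ` (C \<inter> regular_region) = C' \<inter> regular_region \<Longrightarrow> algebraic_PVI_solution C' (swap01 \<alpha>)"
    "x3 ` (C \<inter> regular_region) = C' \<inter> regular_region \<Longrightarrow> algebraic_PVI_solution C' (swap13 \<alpha>)"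
proof -
  assume img: "x1 ` (C \<inter> regular_region) = C' \<inter> regular_region"
  show "algebraic_PVI_solution C' (swap12 \<alpha>)"
    by (rule algebraic_PVI_solution_transport[where \<tau> = "\<lambda>t. 1 - t", OF x_involutions(1) _ _ _ _ img assms])
      (auto intro!: holomorphic_intros satisfies_PVI_x1)
next
  assume img: "x2 ` (C \<inter> regular_region) = C' \<inter> regular_region"
  show "algebraic_PVI_solution C' (swap01 \<alpha>)"
    by (rule algebraic_PVI_solution_transport[where \<tau> = "\<lambda>t. 1 / t", OF x_involutions(2) _ _ _ _ img assms])
      (auto intro!: holomorphic_intros satisfies_PVI_x2 simp: regular_region_def)
next
  let ?T = "UNIV - {0, 1 :: complex}" and ?\<tau> = "\<lambda>t :: complex. t / (t - 1)"
  assume img: "x3 ` (C \<inter> regular_region) = C' \<inter> regular_region"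
  show "algebraic_PVI_solution C' (swap13 \<alpha>)"
  proof (rule algebraic_PVI_solution_transport[where \<tau> = ?\<tau>, OF x_involutions(3) _ _ _ _ img assms])
    show "?\<tau> holomorphic_on ?T" by (auto intro!: holomorphic_intros)
    show "?\<tau> t \<in> ?T \<and> ?\<tau> (?\<tau> t) = t" if "t \<in> ?T" for t
    proof -
      have "t - 1 \<noteq> 0" "t \<noteq> 0" using that by auto
      moreover from this have "?\<tau> t - 1 = 1 / (t - 1)" by (simp add: divide_simps)
      ultimately show ?thesis by auto
    qed
  next
    fix S and f :: "complex \<Rightarrow> complex"
    assume f: "f holomorphic_on S" "\<And>s. s \<in> S \<Longrightarrow> (f s, ?\<tau> s) \<in> regular_region" "S \<subseteq> ?T"
    have "s - 1 \<noteq> 0" "?\<tau> s - 1 \<noteq> 0" if "s \<in> S" for s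
      using f(2)[OF that] f(3) that by (auto simp: regular_region_def)
    then show "(\<lambda>s. fst (x3 (f s, ?\<tau> s))) holomorphic_on S"
      using f(1) unfolding x3.simps fst_conv by (intro holomorphic_intros) auto
  next
    fix U S and f :: "complex \<Rightarrow> complex"
    assume "open U" "f holomorphic_on U" "satisfies_PVI \<alpha> U f"
      "\<And>t. t \<in> U \<Longrightarrow> (f t, t) \<in> regular_region" "open S" "\<And>s. s \<in> S \<Longrightarrow> s \<in> ?T \<and> ?\<tau> s \<in> U"
    then show "satisfies_PVI (swap13 \<alpha>) S (\<lambda>s. fst (x3 (f (?\<tau> s), ?\<tau> s)))"
      unfolding x3.simps fst_conv by (intro satisfies_PVI_x3) auto
  qed
qed

text \<open>A permutation taking the reference label to \<open>(i, j)\<close> is a product of generators, each of which is a symmetry of the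
  equation.\<close>

lemma (in label_family) algebraic_PVI_solution_labels:
  assumes sol: "algebraic_PVI_solution (curve (P 1 4)) (params_of (\<beta> 1 4))"
    and ij: "i \<in> {1..4}" "j \<in> {1..4}" "i \<noteq> j"
  shows "algebraic_PVI_solution (curve (P i j)) (params_of (\<beta> i j))"
proof -
  obtain p where p: "p permutes {1..4}" "p 1 = i" "p 4 = j"
    by (rule permutes_4_transitive[OF ij])
  have step: "x ` (curve (P (p 1) (p 4)) \<inter> regular_region) = curve (P (\<sigma> (p 1)) (\<sigma> (p 4))) \<inter> regular_region"
    if "p permutes {1..4}" "\<sigma> permutes {1..4}" "\<And>y. y \<in> regular_region \<Longrightarrow> act \<sigma> y = x y" for x \<sigma> p
  proof -
    have "x ` (curve (P (p 1) (p 4)) \<inter> regular_region) = act \<sigma> ` (curve (P (p 1) (p 4)) \<inter> regular_region)"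
      using that(3) by (intro image_cong) auto
    also have "\<dots> = curve (P (\<sigma> (p 1)) (\<sigma> (p 4))) \<inter> regular_region"
      using permutes_label[OF that(1), of 1 4] by (intro curve_image that) simp_all
    finally show ?thesis .
  qed
  have "algebraic_PVI_solution (curve (P (p 1) (p 4))) (params_of (\<beta> (p 1) (p 4)))"
    using p(1)
  proof (induction p rule: permutes_4_induct)
    case id
    then show ?case using sol by simp
  next
    case (swap12 p)
    have "algebraic_PVI_solution (curve (P (swap 2 3 (p 1)) (swap 2 3 (p 4))))
        (swap12 (params_of (\<beta> (p 1) (p 4))))"
      by (rule algebraic_PVI_solution_generators(1)[OF swap12(2) step[OF swap12(1) generators_permute(1) act_generators(1)]])
    then show ?case
      using permute_params_family[OF generators_permute(1), of "p 1" "p 4"]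
      by (simp add: permute_params_generators)
  next
    case (swap01 p)
    have "algebraic_PVI_solution (curve (P (swap 1 2 (p 1)) (swap 1 2 (p 4))))
        (swap01 (params_of (\<beta> (p 1) (p 4))))"
      by (rule algebraic_PVI_solution_generators(2)[OF swap01(2) step[OF swap01(1) generators_permute(2) act_generators(2)]])
    then show ?case
      using permute_params_family[OF generators_permute(2), of "p 1" "p 4"]
      by (simp add: permute_params_generators)
  next
    case (swap13 p)
    have "algebraic_PVI_solution (curve (P (swap 2 4 (p 1)) (swap 2 4 (p 4))))
        (swap13 (params_of (\<beta> (p 1) (p 4))))"
      by (rule algebraic_PVI_solution_generators(3)[OF swap13(2) step[OF swap13(1) generators_permute(3) act_generators(3)]])
    then show ?case
      using permute_params_family[OF generators_permute(3), of "p 1" "p 4"]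
      by (simp add: permute_params_generators)
  qed
  then show ?thesis using p by simp
qed

section \<open>Solutions with a rational parametrization\<close>

text \<open>A parametrization of the regular part by a connected domain is all that is needed: it serves both to verify the
  differential equation and to prove density of subsets.\<close>

definition rational_curve :: "(complex \<times> complex) set \<Rightarrow> bool" where
  "rational_curve C \<longleftrightarrow> (\<exists>S u v. open S \<and> connected S \<and> u holomorphic_on S \<and> v holomorphic_on S \<and>
     C \<inter> regular_region = (\<lambda>s. (u s, v s)) ` S)"

text \<open>If \<open>w = d\<lambda>/dt\<close> is known as a function of the parameter \<open>s\<close>, then the equation only involves the derivative of
  \<open>w\<close> with respect to \<open>s\<close>. The map \<open>\<sigma>\<close> recovers \<open>s\<close> from \<open>(\<lambda>, t)\<close>, so every branch
  of the curve factors through the parametrization; the point \<open>pt\<close>, where \<open>t\<close> is locally invertible,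
  provides a branch.\<close>

lemma algebraic_PVI_solution_parametrized:
  fixes u v w :: "complex \<Rightarrow> complex" and \<sigma> :: "complex \<times> complex \<Rightarrow> complex"
  assumes S: "open S" "pt \<in> S" "dv pt \<noteq> 0" and "finite (- S)"
    and u: "\<And>s. s \<in> S \<Longrightarrow> (u has_field_derivative w s * dv s) (at s)"
    and v: "\<And>s. s \<in> S \<Longrightarrow> (v has_field_derivative dv s) (at s)"
    and w: "\<And>s. s \<in> S \<Longrightarrow> dv s \<noteq> 0 \<Longrightarrow>
      (w has_field_derivative dv s * PVI_rhs \<alpha> (v s) (u s) (w s)) (at s)"
    and on: "\<And>s. s \<in> S \<Longrightarrow> (u s, v s) \<in> C \<inter> regular_region"
    and \<sigma>: "\<And>l t. (l, t) \<in> C \<inter> regular_region \<Longrightarrow> \<sigma> (l, t) \<in> S \<and> u (\<sigma> (l, t)) = l \<and> v (\<sigma> (l, t)) = t"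
    and hol: "\<And>U f. f holomorphic_on U \<Longrightarrow> (\<And>t. t \<in> U \<Longrightarrow> (f t, t) \<in> C \<inter> regular_region) \<Longrightarrow>
      (\<lambda>t. \<sigma> (f t, t)) holomorphic_on U"
  shows "algebraic_PVI_solution C \<alpha> \<and> rational_curve C"
proof -
  have hv: "v holomorphic_on S" and hu: "u holomorphic_on S"
    using u v by (auto simp: holomorphic_on_def field_differentiable_def intro: has_field_derivative_at_within)
  have "deriv v pt \<noteq> 0" using v[OF S(2)] S(3) by (simp add: DERIV_imp_deriv)
  then obtain r where r: "r > 0" "ball pt r \<subseteq> S" "open (v ` ball pt r)" "inj_on v (ball pt r)"
    using has_complex_derivative_locally_invertible[OF hv S(2,1)] by metis
  obtain g where g: "g holomorphic_on v ` ball pt r" "\<And>z. z \<in> ball pt r \<Longrightarrow> g (v z) = z"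
    using holomorphic_has_inverse[OF holomorphic_on_subset[OF hv r(2)] open_ball r(4)] by metis
  have "branch_of C (v ` ball pt r) (u \<circ> g)"
    unfolding branch_of_def
  proof (intro conjI ballI)
    show "u \<circ> g holomorphic_on v ` ball pt r"
      by (rule holomorphic_on_compose_gen[OF g(1) holomorphic_on_subset[OF hu r(2)]]) (use g in auto)
    show "((u \<circ> g) t, t) \<in> C \<inter> regular_region" if "t \<in> v ` ball pt r" for t
      using that g on r(2) by auto
  qed (use r in auto)
  moreover have "satisfies_PVI \<alpha> U f" if b: "branch_of C U f" for U f
    unfolding satisfies_PVI_def
  proof
    fix t assume t: "t \<in> U"
    have U: "open U" "f holomorphic_on U" "\<And>t. t \<in> U \<Longrightarrow> (f t, t) \<in> C \<inter> regular_region"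
      using b by (auto simp: branch_of_def)
    define m where "m t = \<sigma> (f t, t)" for t
    have m: "m holomorphic_on U" unfolding m_def by (rule hol[OF U(2,3)])
    have mS: "m t \<in> S" "u (m t) = f t" "v (m t) = t" if "t \<in> U" for t
      using \<sigma>[OF U(3)[OF that]] by (simp_all add: m_def)
    have dm: "dv (m t) * deriv m t = 1" if t: "t \<in> U" for t
    proof -
      have "((\<lambda>t. v (m t)) has_field_derivative dv (m t) * deriv m t) (at t)"
        by (rule DERIV_chain2[OF v[OF mS(1)[OF t]] holomorphic_derivI[OF m U(1) t]])
      moreover have "((\<lambda>t. v (m t)) has_field_derivative 1) (at t)"
        by (rule has_field_derivative_transform_within_open[OF DERIV_ident U(1) t]) (simp add: mS)
      ultimately show ?thesis by (rule DERIV_unique)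
    qed
    have df: "deriv f t = w (m t)" if t: "t \<in> U" for t
    proof -
      have "((\<lambda>t. u (m t)) has_field_derivative w (m t) * dv (m t) * deriv m t) (at t)"
        by (rule DERIV_chain2[OF u[OF mS(1)[OF t]] holomorphic_derivI[OF m U(1) t]])
      then have "(f has_field_derivative w (m t) * dv (m t) * deriv m t) (at t)"
        by (rule has_field_derivative_transform_within_open[OF _ U(1) t]) (simp add: mS)
      then show ?thesis using dm[OF t] by (simp add: DERIV_imp_deriv mult.assoc)
    qed
    have "dv (m t) \<noteq> 0" using dm[OF t] by auto
    then have "((\<lambda>t. w (m t)) has_field_derivative
        dv (m t) * PVI_rhs \<alpha> (v (m t)) (u (m t)) (w (m t)) * deriv m t) (at t)"
      by (intro DERIV_chain2[OF w[OF mS(1)[OF t]] holomorphic_derivI[OF m U(1) t]])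
    then have "(deriv f has_field_derivative
        dv (m t) * PVI_rhs \<alpha> (v (m t)) (u (m t)) (w (m t)) * deriv m t) (at t)"
      by (rule has_field_derivative_transform_within_open[OF _ U(1) t]) (simp add: df)
    moreover have "dv (m t) * PVI_rhs \<alpha> (v (m t)) (u (m t)) (w (m t)) * deriv m t =
        (dv (m t) * deriv m t) * PVI_rhs \<alpha> (v (m t)) (u (m t)) (w (m t))"
      by (simp add: ac_simps)
    ultimately show "deriv (deriv f) t = PVI_rhs \<alpha> t (f t) (deriv f t)"
      using dm[OF t] mS[OF t] df[OF t] by (simp add: DERIV_imp_deriv)
  qed
  ultimately have "algebraic_PVI_solution C \<alpha>" unfolding algebraic_PVI_solution_def by blast
  moreover have "rational_curve C"
    unfolding rational_curve_def
  proof (intro exI conjI)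
    have "countable (- S)" using \<open>finite (- S)\<close> by (rule countable_finite)
    from path_connected_complement_countable[OF _ this] show "connected S"
      by (simp add: path_connected_imp_connected)
    show "C \<inter> regular_region = (\<lambda>s. (u s, v s)) ` S"
    proof (intro subset_antisym subrelI)
      fix l t assume "(l, t) \<in> C \<inter> regular_region"
      from \<sigma>[OF this] show "(l, t) \<in> (\<lambda>s. (u s, v s)) ` S" by (intro image_eqI[of _ _ "\<sigma> (l, t)"]) simp_all
    qed (use on in auto)
  qed (fact S(1) hu hv)+
  ultimately show ?thesis ..
qed

lemma PVI_rhs_eq:
  assumes "1/2 * (1 / l + 1 / (l - 1) + 1 / (l - t)) = A" "1 / t + 1 / (t - 1) + 1 / (l - t) = B"
    and "l * (l - 1) * (l - t) / (t^2 * (t - 1)^2) = K"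
    and "a0 - a1 * (t / l^2) + a2 * ((t - 1) / (l - 1)^2) + (1/2 - a3) * (t * (t - 1) / (l - t)^2) = L"
  shows "PVI_rhs (a0, a1, a2, a3) t l w = A * w^2 - B * w + K * L"
  unfolding PVI_rhs_def prod.case assms ..

lemma recip_add:
  fixes a b :: complex
  assumes "a \<noteq> 0" "b \<noteq> 0"
  shows "1 / a + 1 / b = (b + a) / (a * b)"
  using assms by (simp add: field_simps)

text \<open>In this and the next three lemmas the right-hand side is evaluated on a parametrized curve, with all
  differences \<open>\<lambda>, \<lambda> - 1, \<lambda> - t\<close> in factored form.\<close>

lemma PVI_rhs_parametrization_2:
  fixes s :: complex
  assumes "s \<noteq> 0" "s - 1 \<noteq> 0" "2 * s - 1 \<noteq> 0"
  defines "p \<equiv> s * (s - 1)" and "d \<equiv> 2 * s - 1"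
  shows "PVI_rhs (1/8, c, c, 1/8) (s^2 / d) s (d^2 / (2 * p)) = - (d^3) / (4 * p^3)"
proof -
  have nz: "p \<noteq> 0" "d \<noteq> 0" using assms by auto
  have f: "s^2 / d - 1 = (s - 1)^2 / d" "s - s^2 / d = p / d"
    using nz unfolding d_def p_def by (simp add: divide_simps; algebra)+
  have A: "1/2 * (1 / s + 1 / (s - 1) + 1 / (p / d)) = d / p"
    unfolding d_def p_def using assms(1-3) by (simp add: divide_simps; algebra)
  have B: "1 / (s^2 / d) + 1 / ((s - 1)^2 / d) + 1 / (p / d) = d * (3 * p + 1) / p^2"
    unfolding d_def p_def using assms(1-3) by (simp add: divide_simps; algebra)
  have *: "(s^2 / d)^2 * ((s - 1)^2 / d)^2 = p^4 / d^4" unfolding p_def by (simp add: power_mult_distrib power_divide)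
  have K: "s * (s - 1) * (p / d) / ((s^2 / d)^2 * ((s - 1)^2 / d)^2) = d^3 / p^2"
    unfolding * p_def[symmetric] using nz by (simp add: divide_simps power2_eq_square power3_eq_cube power4_eq_xxxx)
  have "s^2 / d * ((s - 1)^2 / d) = (p / d)^2" by (simp add: p_def power_mult_distrib power2_eq_square)
  then have L: "1/8 - c * (s^2 / d / s^2) + c * ((s - 1)^2 / d / (s - 1)^2) +
      (1/2 - 1/8) * (s^2 / d * ((s - 1)^2 / d) / (p / d)^2) = 1/2"
    using nz assms(1-3) by simp
  have d2: "d^2 = 1 + 4 * p" unfolding d_def p_def by algebra
  have "PVI_rhs (1/8, c, c, 1/8) (s^2 / d) s (d^2 / (2 * p)) =
      d / p * (d^2 / (2 * p))^2 - d * (3 * p + 1) / p^2 * (d^2 / (2 * p)) + d^3 / p^2 * (1/2)"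
    by (rule PVI_rhs_eq, unfold f) (rule A, rule B, rule K, rule L)
  also have "\<dots> = d^3 * (d^2 - 2 * (3 * p + 1) + 2 * p) / (4 * p^3)"
    using nz by (simp add: divide_simps; algebra)
  finally show ?thesis by (simp add: d2)
qed

lemma PVI_rhs_parametrization_5:
  fixes s :: complex
  assumes "s \<noteq> 0" "s - 1 \<noteq> 0" "2 * s - 1 \<noteq> 0" "3 - 2 * s \<noteq> 0" "2 * s + 1 \<noteq> 0"
  defines "p \<equiv> s * (s - 1)" and "d \<equiv> 2 * s - 1"
  shows "PVI_rhs (1/2, 1/8, 1/8, 1/18) (s^2 * (3 - 2 * s)) s (- 1 / (6 * p)) = - d / (36 * p^3)"
proof -
  have q: "(3 - 2 * s) * (2 * s + 1) = 3 - 4 * p" unfolding p_def by algebra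
  have nz: "p \<noteq> 0" "d \<noteq> 0" "3 - 4 * p \<noteq> 0" using assms(1-5) unfolding q[symmetric] by (auto simp: p_def d_def)
  let ?t = "s^2 * (3 - 2 * s)" and ?t1 = "- ((s - 1)^2 * (2 * s + 1))"
  have f: "?t - 1 = ?t1" "s - ?t = p * d"
    unfolding d_def p_def by algebra+
  have A: "1/2 * (1 / s + 1 / (s - 1) + 1 / (p * d)) = (2 * p + 1) / (p * d)"
    unfolding d_def p_def using assms(1-5) by (simp add: divide_simps; algebra)
  have tt: "?t * ?t1 = - (p^2 * (3 - 4 * p))" unfolding q[symmetric] p_def by algebra
  have "?t1 + ?t = - (d * (2 * p - 1))" unfolding d_def p_def by algebra
  moreover have "1 / ?t + 1 / ?t1 = (?t1 + ?t) / (?t * ?t1)"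
    using assms(1-5) by (intro recip_add) auto
  ultimately have B: "1 / ?t + 1 / ?t1 + 1 / (p * d) = d * (2 * p - 1) / (p^2 * (3 - 4 * p)) + 1 / (p * d)"
    unfolding tt by simp
  have *: "?t^2 * ?t1^2 = (p^2 * (3 - 4 * p))^2" unfolding power_mult_distrib[symmetric] tt by simp
  have K: "s * (s - 1) * (p * d) / (?t^2 * ?t1^2) = d / (p^2 * (3 - 4 * p)^2)"
    unfolding * p_def[symmetric] using nz by (simp add: power2_eq_square)
  have L: "1/2 - 1/8 * (?t / s^2) + 1/8 * (?t1 / (s - 1)^2) + (1/2 - 1/18) * (?t * ?t1 / (p * d)^2) =
      - 4 * (3 - 4 * p) / (9 * d^2)"
  proof -
    have "?t / s^2 = 3 - 2 * s" "?t1 / (s - 1)^2 = - (2 * s + 1)" using assms(1-2) by simp_all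
    then have 1: "1/2 - 1/8 * (?t / s^2) + 1/8 * (?t1 / (s - 1)^2) = 0"
      by (simp only:) (simp add: field_simps)
    have 2: "- (p^2 * (3 - 4 * p)) / (p * d)^2 = - ((3 - 4 * p) / d^2)" using nz by (simp add: power_mult_distrib)
    show ?thesis unfolding 1 tt 2 by (simp add: minus_divide_left)
  qed
  have d2: "d^2 = 1 + 4 * p" unfolding d_def p_def by algebra
  have "PVI_rhs (1/2, 1/8, 1/8, 1/18) ?t s (- 1 / (6 * p)) =
      (2 * p + 1) / (p * d) * (- 1 / (6 * p))^2 - (d * (2 * p - 1) / (p^2 * (3 - 4 * p)) + 1 / (p * d)) * (- 1 / (6 * p))
      + d / (p^2 * (3 - 4 * p)^2) * (- 4 * (3 - 4 * p) / (9 * d^2))"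
    by (rule PVI_rhs_eq, unfold f) (rule A, rule B, rule K, rule L)
  also have "\<dots> = ((2 * p + 1) * (3 - 4 * p) + 6 * (d^2 * (2 * p - 1) + p * (3 - 4 * p)) - 16 * p)
      / (36 * p^3 * d * (3 - 4 * p))"
    using nz by (simp add: divide_simps; algebra)
  also have "(2 * p + 1) * (3 - 4 * p) + 6 * (d^2 * (2 * p - 1) + p * (3 - 4 * p)) - 16 * p = - (d^2 * (3 - 4 * p))"
    unfolding d2 by algebra
  also have "- (d^2 * (3 - 4 * p)) / (36 * p^3 * d * (3 - 4 * p)) = - d / (36 * p^3)"
    using nz by (simp add: power2_eq_square)
  finally show ?thesis .
qed

lemma PVI_rhs_parametrization_4:
  fixes s :: complex
  assumes "s \<noteq> 0" "s - 1 \<noteq> 0" "1 - 2 * s \<noteq> 0" "s - 2 \<noteq> 0" "s + 1 \<noteq> 0" "s * (s - 1) + 1 \<noteq> 0"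
  defines "p \<equiv> s * (s - 1)" and "e \<equiv> 1 - 2 * s"
  shows "PVI_rhs (1/8, 1/8, 1/8, 1/8) (s^3 * (s - 2) / e) s (- (e^2) / (6 * p^2)) = e^3 * (1 + 2 * p) / (18 * p^5)"
proof -
  have q: "(s - 2) * (s + 1) = p - 2" unfolding p_def by algebra
  have nz: "p \<noteq> 0" "e \<noteq> 0" "p - 2 \<noteq> 0" "p + 1 \<noteq> 0" using assms(1-6) unfolding q[symmetric] by (auto simp: p_def e_def)
  let ?t = "s^3 * (s - 2) / e" and ?t1 = "(s - 1)^3 * (s + 1) / e"
  have "s^3 * (s - 2) - e = (s - 1)^3 * (s + 1)" "s * e - s^3 * (s - 2) = - (p * (p + 1))"
    unfolding e_def p_def by algebra+
  then have f: "?t - 1 = ?t1" "s - ?t = - (p * (p + 1)) / e"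
    using nz by (simp_all add: divide_simps)
  have A: "1/2 * (1 / s + 1 / (s - 1) + 1 / (- (p * (p + 1)) / e)) = - e * (p + 2) / (2 * p * (p + 1))"
  proof -
    have "1 / s + 1 / (s - 1) = - e / p" using assms(1-2) unfolding e_def p_def by (simp add: divide_simps; algebra)
    moreover have "1/2 * (- e / p + 1 / (- (p * (p + 1)) / e)) = - e * (p + 2) / (2 * p * (p + 1))"
      using nz by (simp add: divide_simps; algebra)
    ultimately show ?thesis by (simp only:)
  qed
  have tt: "?t * ?t1 = p^3 * (p - 2) / e^2"
    unfolding q[symmetric] p_def by (simp add: power_mult_distrib power2_eq_square) (simp add: algebra_simps)
  have "?t1 + ?t = (2 * p^2 - 2 * p - 1) / e"
    unfolding add_divide_distrib[symmetric] by (rule arg_cong[where f = "\<lambda>x. x / e"]) (unfold p_def, algebra)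
  moreover have "1 / ?t + 1 / ?t1 = (?t1 + ?t) / (?t * ?t1)"
    using assms(1-6) nz by (intro recip_add) auto
  ultimately have B: "1 / ?t + 1 / ?t1 + 1 / (- (p * (p + 1)) / e) =
      e * (2 * p^2 - 2 * p - 1) / (p^3 * (p - 2)) - e / (p * (p + 1))"
    unfolding tt using nz by (simp add: power2_eq_square)
  have *: "?t^2 * ?t1^2 = (p^3 * (p - 2) / e^2)^2" unfolding power_mult_distrib[symmetric] tt by simp
  have K: "s * (s - 1) * (- (p * (p + 1)) / e) / (?t^2 * ?t1^2) = - (p + 1) * e^3 / (p^4 * (p - 2)^2)"
    unfolding * p_def[symmetric] using nz by (simp add: divide_simps; algebra)
  have "?t / s^2 = s * (s - 2) / e" "?t1 / (s - 1)^2 = (s - 1) * (s + 1) / e"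
    using assms(1-2) by (simp_all add: power2_eq_square power3_eq_cube)
  moreover have "1/8 - 1/8 * (s * (s - 2) / e) + 1/8 * ((s - 1) * (s + 1) / e) = 0"
    using nz(2) by (simp add: divide_simps) (simp add: e_def algebra_simps)
  ultimately have *: "1/8 - 1/8 * (?t / s^2) + 1/8 * (?t1 / (s - 1)^2) = 0" by (simp only:)
  have L: "1/8 - 1/8 * (?t / s^2) + 1/8 * (?t1 / (s - 1)^2) + (1/2 - 1/8) * (?t * ?t1 / (- (p * (p + 1)) / e)^2) =
      3/8 * (p * (p - 2) / (p + 1)^2)"
  proof -
    have "p^3 * (p - 2) / e^2 / (- (p * (p + 1)) / e)^2 = p * (p - 2) / (p + 1)^2"
      using nz by (simp add: divide_simps; algebra)
    then show ?thesis using * unfolding tt by simp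
  qed
  have e2: "e^2 = 1 + 4 * p" unfolding e_def p_def by algebra
  have "PVI_rhs (1/8, 1/8, 1/8, 1/8) ?t s (- (e^2) / (6 * p^2)) =
      - e * (p + 2) / (2 * p * (p + 1)) * (- (e^2) / (6 * p^2))^2
      - (e * (2 * p^2 - 2 * p - 1) / (p^3 * (p - 2)) - e / (p * (p + 1))) * (- (e^2) / (6 * p^2))
      + - (p + 1) * e^3 / (p^4 * (p - 2)^2) * (3/8 * (p * (p - 2) / (p + 1)^2))"
    by (rule PVI_rhs_eq, unfold f) (rule A, rule B, rule K, rule L)
  also have "\<dots> = e^3 * (- (e^2 * (p + 2) * (p - 2)) + 12 * ((2 * p^2 - 2 * p - 1) * (p + 1) - p^2 * (p - 2)) - 27 * p^2)
      / (72 * p^5 * (p + 1) * (p - 2))"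
    using nz by (simp add: divide_simps; algebra)
  also have "- (e^2 * (p + 2) * (p - 2)) + 12 * ((2 * p^2 - 2 * p - 1) * (p + 1) - p^2 * (p - 2)) - 27 * p^2 =
      4 * (1 + 2 * p) * (p + 1) * (p - 2)"
    unfolding e2 by algebra
  also have "e^3 * (4 * (1 + 2 * p) * (p + 1) * (p - 2)) / (72 * p^5 * (p + 1) * (p - 2)) = e^3 * (1 + 2 * p) / (18 * p^5)"
    using nz by (simp add: divide_simps; algebra)
  finally show ?thesis .
qed

lemma PVI_rhs_parametrization_3:
  fixes m :: complex
  assumes "m \<noteq> 0" "m + 1 \<noteq> 0" "1 - m \<noteq> 0" "m + 2 \<noteq> 0" "1 + 2 * m \<noteq> 0"
  defines "p \<equiv> m * (m + 1)" and "d \<equiv> 1 + 2 * m"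
  shows "PVI_rhs (1/8, 1/8, 1/8, 9/8) ((1 + m) * (1 - m)^3 / d^3) ((1 - m^2) / d) ((1 + p) * d^2 / (2 - p)^2) =
    - 3 * d^5 * (4 + 7 * p) / (2 * (2 - p)^5)"
proof -
  define r where "r = 2 - p"
  have r: "(1 - m) * (m + 2) = r" unfolding p_def r_def by algebra
  have nz: "p \<noteq> 0" "d \<noteq> 0" "r \<noteq> 0" using assms(1-5) unfolding r[symmetric] by (auto simp: p_def d_def)
  let ?l = "(1 - m^2) / d" and ?l1 = "- (m * (m + 2)) / d" and ?t = "(1 + m) * (1 - m)^3 / d^3"
    and ?t1 = "- (m * (m + 2)^3) / d^3" and ?lt = "3 * p * r / d^3"
  have m2: "1 - m^2 = (1 - m) * (1 + m)" by algebra
  have "1 - m^2 - d = - (m * (m + 2))" "(1 + m) * (1 - m)^3 - d^3 = - (m * (m + 2)^3)"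
    "(1 - m^2) * d^2 - (1 + m) * (1 - m)^3 = 3 * p * r"
    unfolding d_def p_def r_def by algebra+
  note poly = this
  have f: "?l - 1 = ?l1" "?t - 1 = ?t1"
    using nz by (simp_all add: divide_simps flip: poly(1,2))
  have "?l = (1 - m^2) * d^2 / d^3" using nz by (simp add: power2_eq_square power3_eq_cube)
  then have "?l - ?t = ((1 - m^2) * d^2 - (1 + m) * (1 - m)^3) / d^3"
    by (simp only: diff_divide_distrib)
  then have f': "?l - ?t = ?lt" by (simp only: poly)
  have ll: "(1 - m^2) * (m * (m + 2)) = p * r"
    unfolding r[symmetric] p_def by algebra
  have A: "1/2 * (1 / ?l + 1 / ?l1 + 1 / ?lt) = d * (5 * p - 1) / (3 * p * r)"
  proof -
    have "1 / ?l + 1 / ?l1 = d * (m * (m + 2) - (1 - m^2)) / ((1 - m^2) * (m * (m + 2)))"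
      using assms(1-5) unfolding m2 by (simp add: divide_simps; algebra)
    also have "\<dots> = d * (2 * p - 1) / (p * r)"
      unfolding ll by (simp add: p_def algebra_simps power2_eq_square)
    finally have 1: "1 / ?l + 1 / ?l1 = d * (2 * p - 1) / (p * r)" .
    have "d^2 = 1 + 4 * p" unfolding d_def p_def by algebra
    then have "1 / ?lt = d * (1 + 4 * p) / (3 * p * r)" by (simp add: power2_eq_square power3_eq_cube)
    moreover have "1/2 * (d * (2 * p - 1) / (p * r) + d * (1 + 4 * p) / (3 * p * r)) = d * (5 * p - 1) / (3 * p * r)"
      using nz by (simp add: divide_simps; algebra)
    ultimately show ?thesis using 1 by (simp only:)
  qed
  have tt: "?t * ?t1 = - (p * r^3) / d^6"
    unfolding r[symmetric] p_def by (simp add: power_mult_distrib flip: power_add)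
  have sum: "?t1 + ?t = - (2 * p^2 + 10 * p - 1) / d^3"
    unfolding add_divide_distrib[symmetric] by (rule arg_cong[where f = "\<lambda>x. x / d^3"]) (unfold p_def, algebra)
  have sum_recip: "1 / ?t + 1 / ?t1 = (?t1 + ?t) / (?t * ?t1)"
    using assms(1-5) nz by (intro recip_add) (auto simp: add.commute)
  have B: "1 / ?t + 1 / ?t1 + 1 / ?lt = d^3 * (2 * p^2 + 10 * p - 1) / (p * r^3) + d^3 / (3 * p * r)"
  proof -
    have "- (2 * p^2 + 10 * p - 1) / d^3 / (- (p * r^3) / d^6) = d^3 * (2 * p^2 + 10 * p - 1) / (p * r^3)"
      using nz by (simp add: divide_simps; algebra)
    moreover have "1 / ?lt = d^3 / (3 * p * r)" by simp
    moreover have "1 / ?t + 1 / ?t1 = - (2 * p^2 + 10 * p - 1) / d^3 / (- (p * r^3) / d^6)"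
      by (simp only: sum_recip sum tt)
    ultimately show ?thesis by (simp only:)
  qed
  have "?t^2 * ?t1^2 = (p * r^3 / d^6)^2" unfolding power_mult_distrib[symmetric] tt by simp
  moreover have "?l * ?l1 = - (p * r) / d^2" using ll by (simp add: power2_eq_square)
  ultimately have *: "?t^2 * ?t1^2 = (p * r^3 / d^6)^2" "?l * ?l1 = - (p * r) / d^2" by simp_all
  have K: "?l * ?l1 * ?lt / (?t^2 * ?t1^2) = - 3 * d^7 / r^4"
  proof -
    have "- (p * r) / d^2 * ?lt / (p * r^3 / d^6)^2 = - 3 * d^7 / r^4"
      using nz by (simp add: divide_simps; algebra)
    then show ?thesis using * by (simp only:)
  qed
  have L: "1/8 - 1/8 * (?t / ?l^2) + 1/8 * (?t1 / ?l1^2) + (1/2 - 9/8) * (?t * ?t1 / ?lt^2) = - r / (18 * p)"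
  proof -
    have c: "b * a^3 / d^3 / (a * b / d)^2 = a / (d * b)" "- (b * a^3) / d^3 / (- (b * a) / d)^2 = - a / (d * b)"
      if "a \<noteq> 0" "b \<noteq> 0" for a b :: complex
      using that nz(2) by (simp_all add: power2_eq_square power3_eq_cube)
    have 1: "?t / ?l^2 = (1 - m) / (d * (1 + m))" "?t1 / ?l1^2 = - (m + 2) / (d * m)"
      unfolding m2 using c(1)[of "1 - m" "1 + m"] c(2)[of "m + 2" m] assms(1-5) by (simp_all add: add.commute)
    have "- (p * r^3) / d^6 / ?lt^2 = - (r / (9 * p))"
      using nz by (simp add: divide_simps; algebra)
    then have 2: "?t * ?t1 / ?lt^2 = - (r / (9 * p))" unfolding tt .
    have "(1 - m) / (d * (1 + m)) - (- (m + 2) / (d * m)) = ((1 - m) * m + (m + 2) * (1 + m)) / (d * p)"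
      using assms(1-2) nz(2) unfolding p_def by (simp add: add.commute[of m 1] divide_simps; algebra)
    also have "(1 - m) * m + (m + 2) * (1 + m) = d * 2" unfolding d_def by algebra
    finally have 3: "(1 - m) / (d * (1 + m)) - (- (m + 2) / (d * m)) = 2 / p" using nz by simp
    have 4: "1/8 - 1/8 * a + 1/8 * b + (1/2 - 9/8) * - (r / (9 * p)) = 1/8 * (1 - (a - b)) + 5/72 * (r / p)"
      for a b :: complex
    proof -
      have "k - k * a + k * b = k * (1 - (a - b))" for k :: complex by (simp add: algebra_simps)
      moreover have "(1/2 - 9/8) * - (r / (9 * p)) = 5/72 * (r / p)" by simp
      ultimately show ?thesis by (simp only:)
    qed
    have "1 - 2 / p = - (r / p)" using nz by (simp add: r_def divide_simps)
    then show ?thesis unfolding 1 2 4 3 by (simp add: field_simps)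
  qed
  have d2: "d^2 = 1 + 4 * p" unfolding d_def p_def by algebra
  have "PVI_rhs (1/8, 1/8, 1/8, 9/8) ?t ?l ((1 + p) * d^2 / r^2) =
      d * (5 * p - 1) / (3 * p * r) * ((1 + p) * d^2 / r^2)^2
      - (d^3 * (2 * p^2 + 10 * p - 1) / (p * r^3) + d^3 / (3 * p * r)) * ((1 + p) * d^2 / r^2)
      + - 3 * d^7 / r^4 * (- r / (18 * p))"
    by (rule PVI_rhs_eq, unfold f f') (rule A, rule B, rule K, rule L)
  also have "\<dots> = d^5 * (2 * (5 * p - 1) * (1 + p)^2 - 6 * (2 * p^2 + 10 * p - 1) * (1 + p) - 2 * r^2 * (1 + p) + d^2 * r^2)
      / (6 * p * r^5)"
    using nz by (simp add: divide_simps; algebra)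
  also have "2 * (5 * p - 1) * (1 + p)^2 - 6 * (2 * p^2 + 10 * p - 1) * (1 + p) - 2 * r^2 * (1 + p) + d^2 * r^2 =
      - 9 * p * (4 + 7 * p)"
    unfolding d2 r_def by algebra
  also have "d^5 * (- 9 * p * (4 + 7 * p)) / (6 * p * r^5) = - 3 * d^5 * (4 + 7 * p) / (2 * r^5)"
    using nz by (simp add: divide_simps; algebra)
  finally show ?thesis unfolding r_def .
qed

lemma DERIV_quotient_squares:
  fixes a b :: "complex \<Rightarrow> complex"
  assumes "(a has_field_derivative a') (at s)" "(b has_field_derivative b') (at s)" "b s \<noteq> 0" "k \<noteq> 0"
  shows "((\<lambda>s. a s / (k * b s)) has_field_derivative (a' * b s - a s * b') / (k * (b s)^2)) (at s)"
    and "((\<lambda>s. a s / (k * (b s)^2)) has_field_derivative (a' * b s - 2 * a s * b') / (k * (b s)^3)) (at s)"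
  using assms by (auto intro!: derivative_eq_intros simp: power2_eq_square power3_eq_cube field_simps)

text \<open>On \<open>\<lambda>\<^sup>2 - 2\<lambda>t + t = 0\<close> the coordinate \<open>s = \<lambda>\<close> itself is a parameter, with \<open>t = s\<^sup>2/(2s - 1)\<close>.\<close>

lemma reference_solution_2:
  "algebraic_PVI_solution (curve (poly2 1 4)) (params_of (params2 c 1 4)) \<and> rational_curve (curve (poly2 1 4))"
proof -
  let ?p = "\<lambda>s :: complex. s * (s - 1)" and ?d = "\<lambda>s :: complex. 2 * s - 1"
  let ?S = "- {0, 1, 1/2 :: complex}"
  have nz: "s \<noteq> 0" "s - 1 \<noteq> 0" "?d s \<noteq> 0" if "s \<in> ?S" for s
    using that by (auto simp: eq_divide_eq mult.commute)
  show ?thesis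
  proof (rule algebraic_PVI_solution_parametrized[where S = ?S and u = "\<lambda>s. s" and v = "\<lambda>s. s^2 / ?d s"
      and dv = "\<lambda>s. 2 * ?p s / (?d s)^2" and w = "\<lambda>s. (?d s)^2 / (2 * ?p s)" and \<sigma> = fst and pt = 2])
    show "open ?S" by (intro open_Compl finite_imp_closed) auto
    show "((\<lambda>s. s) has_field_derivative (?d s)^2 / (2 * ?p s) * (2 * ?p s / (?d s)^2)) (at s)" if "s \<in> ?S" for s
      using nz[OF that] by (auto intro!: derivative_eq_intros)
    show "((\<lambda>s. s^2 / ?d s) has_field_derivative 2 * ?p s / (?d s)^2) (at s)" if "s \<in> ?S" for s
      using nz[OF that] by (auto intro!: derivative_eq_intros simp: power2_eq_square algebra_simps)
    show "((\<lambda>s. (?d s)^2 / (2 * ?p s)) has_field_derivative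
        2 * ?p s / (?d s)^2 * PVI_rhs (params_of (params2 c 1 4)) (s^2 / ?d s) s ((?d s)^2 / (2 * ?p s))) (at s)"
      if "s \<in> ?S" for s
    proof -
      have "PVI_rhs (params_of (params2 c 1 4)) (s^2 / ?d s) s ((?d s)^2 / (2 * ?p s)) = - ((?d s)^3) / (4 * (?p s)^3)"
        using PVI_rhs_parametrization_2[OF nz[OF that], of c] by (simp add: params_of_def params2_def)
      moreover have "((\<lambda>s. (?d s)^2) has_field_derivative 4 * ?d s) (at s)"
        "(?p has_field_derivative ?d s) (at s)"
        by (auto intro!: derivative_eq_intros simp: algebra_simps)
      from DERIV_quotient_squares(1)[OF this, of 2]
      have "((\<lambda>s. (?d s)^2 / (2 * ?p s)) has_field_derivative
          (4 * ?d s * ?p s - (?d s)^2 * ?d s) / (2 * (?p s)^2)) (at s)"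
        using nz[OF that] by simp
      moreover have "4 * ?d s * ?p s - (?d s)^2 * ?d s = - ?d s" by algebra
      moreover have "2 * ?p s / (?d s)^2 * (- ((?d s)^3) / (4 * (?p s)^3)) = - ?d s / (2 * (?p s)^2)"
        using nz[OF that] by (simp add: divide_simps; algebra)
      ultimately show ?thesis by (simp only:)
    qed
    show "(s, s^2 / ?d s) \<in> curve (poly2 1 4) \<inter> regular_region" if "s \<in> ?S" for s
      using nz[OF that] by (auto simp: curve_def poly2_def Let_def regular_region_def divide_simps; algebra)
    show "fst (l, t) \<in> ?S \<and> fst (l, t) = l \<and> (fst (l, t))^2 / ?d (fst (l, t)) = t"
      if lt: "(l, t) \<in> curve (poly2 1 4) \<inter> regular_region" for l t
    proof -
      have e: "l^2 = t * (2 * l - 1)" using lt by (simp add: curve_def poly2_def Let_def algebra_simps)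
      moreover have l: "l \<noteq> 0" "l \<noteq> 1" using lt by (auto simp: regular_region_def)
      ultimately have ne: "2 * l - 1 \<noteq> 0" by auto
      have "l \<noteq> 1/2"
      proof
        assume "l = 1/2"
        have "2 * l - 1 = 0" unfolding \<open>l = 1/2\<close> by simp
        with ne show False by contradiction
      qed
      with l have "l \<in> ?S" by simp
      moreover have "l^2 / (2 * l - 1) = t" unfolding e by (rule nonzero_mult_div_cancel_right[OF ne])
      ultimately show ?thesis unfolding fst_conv by blast
    qed
  qed simp_all
qed

text \<open>Again \<open>s = \<lambda>\<close> is a parameter, now with \<open>t = s\<^sup>2(3 - 2s)\<close>.\<close>

lemma reference_solution_5:
  "algebraic_PVI_solution (curve (poly5 1 4)) (params_of (params5 1 4)) \<and> rational_curve (curve (poly5 1 4))"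
proof -
  let ?p = "\<lambda>s :: complex. s * (s - 1)"
  let ?S = "- {0, 1, 1/2, 3/2, - 1/2 :: complex}"
  have iff: "s = 1/2 \<longleftrightarrow> 2 * s - 1 = 0" "s = 3/2 \<longleftrightarrow> 3 - 2 * s = 0" "s = - 1/2 \<longleftrightarrow> 2 * s + 1 = 0" for s :: complex
  proof -
    have "2 * s - 1 = 2 * (s - 1/2)" "3 - 2 * s = - 2 * (s - 3/2)" "2 * s + 1 = 2 * (s - (- 1/2))"
      by (simp_all add: algebra_simps)
    moreover have "2 \<noteq> (0 :: complex)" "- 2 \<noteq> (0 :: complex)" by simp_all
    ultimately show "s = 1/2 \<longleftrightarrow> 2 * s - 1 = 0" "s = 3/2 \<longleftrightarrow> 3 - 2 * s = 0" "s = - 1/2 \<longleftrightarrow> 2 * s + 1 = 0"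
      by (metis mult_eq_0_iff right_minus_eq)+
  qed
  have nz: "s \<noteq> 0" "s - 1 \<noteq> 0" "2 * s - 1 \<noteq> 0" "3 - 2 * s \<noteq> 0" "2 * s + 1 \<noteq> 0" if "s \<in> ?S" for s
    using that unfolding Compl_iff insert_iff empty_iff iff by simp_all
  have reg: "(s, s^2 * (3 - 2 * s)) \<in> regular_region \<longleftrightarrow> s \<in> ?S" for s
  proof -
    have e: "s^2 * (3 - 2 * s) - 1 = - ((s - 1)^2 * (2 * s + 1))" "s - s^2 * (3 - 2 * s) = s * (s - 1) * (2 * s - 1)"
      by algebra+
    have 1: "s^2 * (3 - 2 * s) = 1 \<longleftrightarrow> s - 1 = 0 \<or> 2 * s + 1 = 0"
      unfolding right_minus_eq[symmetric, of "s^2 * (3 - 2 * s)" 1] e by simp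
    have 2: "s = s^2 * (3 - 2 * s) \<longleftrightarrow> s = 0 \<or> s - 1 = 0 \<or> 2 * s - 1 = 0"
      unfolding right_minus_eq[symmetric, of s "s^2 * (3 - 2 * s)"] e by simp
    have 3: "s^2 * (3 - 2 * s) = 0 \<longleftrightarrow> s = 0 \<or> 3 - 2 * s = 0" by simp
    show ?thesis
      unfolding regular_region_def mem_Collect_eq case_prod_conv 1 2 3 Compl_iff insert_iff empty_iff iff
        right_minus_eq[of s 1] by blast
  qed
  show ?thesis
  proof (rule algebraic_PVI_solution_parametrized[where S = ?S and u = "\<lambda>s. s" and v = "\<lambda>s. s^2 * (3 - 2 * s)"
      and dv = "\<lambda>s. - 6 * ?p s" and w = "\<lambda>s. - 1 / (6 * ?p s)" and \<sigma> = fst and pt = 2])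
    show "open ?S" by (intro open_Compl finite_imp_closed) auto
    show "((\<lambda>s. s) has_field_derivative - 1 / (6 * ?p s) * (- 6 * ?p s)) (at s)" if "s \<in> ?S" for s
      using nz[OF that] by (auto intro!: derivative_eq_intros)
    show "((\<lambda>s. s^2 * (3 - 2 * s)) has_field_derivative - 6 * ?p s) (at s)" if "s \<in> ?S" for s
      by (auto intro!: derivative_eq_intros simp: power2_eq_square algebra_simps)
    show "((\<lambda>s. - 1 / (6 * ?p s)) has_field_derivative
        - 6 * ?p s * PVI_rhs (params_of (params5 1 4)) (s^2 * (3 - 2 * s)) s (- 1 / (6 * ?p s))) (at s)"
      if "s \<in> ?S" for s
    proof -
      have "PVI_rhs (params_of (params5 1 4)) (s^2 * (3 - 2 * s)) s (- 1 / (6 * ?p s)) = - (2 * s - 1) / (36 * (?p s)^3)"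
        using PVI_rhs_parametrization_5[OF nz[OF that]] by (simp add: params_of_def params5_def)
      moreover have "((\<lambda>s. - 1) has_field_derivative 0) (at s)" "(?p has_field_derivative 2 * s - 1) (at s)"
        by (auto intro!: derivative_eq_intros simp: algebra_simps)
      from DERIV_quotient_squares(1)[OF this, of 6]
      have "((\<lambda>s. - 1 / (6 * ?p s)) has_field_derivative (2 * s - 1) / (6 * (?p s)^2)) (at s)"
        using nz[OF that] by simp
      moreover have "- 6 * ?p s * (- (2 * s - 1) / (36 * (?p s)^3)) = (2 * s - 1) / (6 * (?p s)^2)"
        using nz[OF that] by (simp add: divide_simps; algebra)
      ultimately show ?thesis by (simp only:)
    qed
    show "(s, s^2 * (3 - 2 * s)) \<in> curve (poly5 1 4) \<inter> regular_region" if "s \<in> ?S" for s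
      using that reg[of s] by (simp add: curve_def poly5_def) algebra
    show "fst (l, t) \<in> ?S \<and> fst (l, t) = l \<and> (fst (l, t))^2 * (3 - 2 * fst (l, t)) = t"
      if lt: "(l, t) \<in> curve (poly5 1 4) \<inter> regular_region" for l t
    proof -
      have "2 * l^3 - 3 * l^2 + t = 0" using lt by (simp add: curve_def poly5_def)
      then have "l^2 * (3 - 2 * l) = t" by algebra
      then show ?thesis using lt reg[of l] by simp
    qed
  qed (simp_all add: complex_eq_iff)
qed

text \<open>Here \<open>s = \<lambda>\<close> with \<open>t = s\<^sup>3(s - 2)/(1 - 2s)\<close>.\<close>

lemma reference_solution_4:
  "algebraic_PVI_solution (curve (poly4 4)) (params_of (params4 1 4)) \<and> rational_curve (curve (poly4 4))"
proof -
  let ?p = "\<lambda>s :: complex. s * (s - 1)" and ?e = "\<lambda>s :: complex. 1 - 2 * s"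
  let ?S = "{s. s \<noteq> 0 \<and> s - 1 \<noteq> 0 \<and> ?e s \<noteq> 0 \<and> s - 2 \<noteq> 0 \<and> s + 1 \<noteq> 0 \<and> ?p s + 1 \<noteq> 0}"
  have reg: "(s, s^3 * (s - 2) / ?e s) \<in> regular_region \<longleftrightarrow> s \<in> ?S" if e: "?e s \<noteq> 0" for s
  proof -
    have "s^3 * (s - 2) - ?e s = (s - 1)^3 * (s + 1)" "s * ?e s - s^3 * (s - 2) = - (?p s * (?p s + 1))"
      by algebra+
    then have "s^3 * (s - 2) / ?e s - 1 = (s - 1)^3 * (s + 1) / ?e s"
      "s - s^3 * (s - 2) / ?e s = - (?p s * (?p s + 1)) / ?e s"
      using e by (simp_all add: divide_simps)
    then have "s^3 * (s - 2) / ?e s = 1 \<longleftrightarrow> (s - 1)^3 * (s + 1) / ?e s = 0"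
      "s = s^3 * (s - 2) / ?e s \<longleftrightarrow> - (?p s * (?p s + 1)) / ?e s = 0"
      by (metis right_minus_eq)+
    then show ?thesis using e unfolding regular_region_def by auto
  qed
  have der: "((\<lambda>s. s^3 * (s - 2) / ?e s) has_field_derivative - 6 * (?p s)^2 / (?e s)^2) (at s)" if "?e s \<noteq> 0" for s
  proof -
    have "((\<lambda>s. s^3 * (s - 2) / ?e s) has_field_derivative
        ((3 * s^2 * (s - 2) + s^3) * ?e s - s^3 * (s - 2) * - 2) / (?e s)^2) (at s)"
      using that by (auto intro!: derivative_eq_intros simp: power2_eq_square algebra_simps)
    moreover have "(3 * s^2 * (s - 2) + s^3) * ?e s - s^3 * (s - 2) * - 2 = - 6 * (?p s)^2" by algebra
    ultimately show ?thesis by (simp only:)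
  qed
  have excluded: "- ?S \<subseteq> {s. poly ([:0, 1:] * [:- 1, 1:] * [:1, - 2:] * [:- 2, 1:] * [:1, 1:] * [:1, - 1, 1:]) s = 0}"
  proof -
    have "poly ([:0, 1:] * [:- 1, 1:] * [:1, - 2:] * [:- 2, 1:] * [:1, 1:] * [:1, - 1, 1:]) s =
        s * (s - 1) * ?e s * (s - 2) * (s + 1) * (?p s + 1)" for s
      unfolding poly_mult poly_pCons poly_0 by algebra
    then show ?thesis by (auto simp only: Compl_iff mem_Collect_eq mult_eq_0_iff intro!: subsetI)
  qed
  show ?thesis
  proof (rule algebraic_PVI_solution_parametrized[where S = ?S and u = "\<lambda>s. s" and v = "\<lambda>s. s^3 * (s - 2) / ?e s"
      and dv = "\<lambda>s. - 6 * (?p s)^2 / (?e s)^2" and w = "\<lambda>s. - ((?e s)^2) / (6 * (?p s)^2)" and \<sigma> = fst and pt = 3])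
    show "open ?S" by (intro open_Collect_conj open_Collect_neq continuous_intros)
    show "finite (- ?S)" by (rule finite_subset[OF excluded poly_roots_finite]) simp
    show "((\<lambda>s. s) has_field_derivative - ((?e s)^2) / (6 * (?p s)^2) * (- 6 * (?p s)^2 / (?e s)^2)) (at s)" if "s \<in> ?S" for s
      using that by (auto intro!: derivative_eq_intros)
    show "((\<lambda>s. s^3 * (s - 2) / ?e s) has_field_derivative - 6 * (?p s)^2 / (?e s)^2) (at s)" if "s \<in> ?S" for s
      using that der by simp
    show "((\<lambda>s. - ((?e s)^2) / (6 * (?p s)^2)) has_field_derivative
        - 6 * (?p s)^2 / (?e s)^2 * PVI_rhs (params_of (params4 1 4)) (s^3 * (s - 2) / ?e s) s (- ((?e s)^2) / (6 * (?p s)^2))) (at s)"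
      if s: "s \<in> ?S" for s
    proof -
      have nz: "?p s \<noteq> 0" "?e s \<noteq> 0" using s by auto
      have "PVI_rhs (params_of (params4 1 4)) (s^3 * (s - 2) / ?e s) s (- ((?e s)^2) / (6 * (?p s)^2)) =
          (?e s)^3 * (1 + 2 * ?p s) / (18 * (?p s)^5)"
        using PVI_rhs_parametrization_4[of s] s by (simp add: params_of_def params4_def)
      moreover have "- 6 * (?p s)^2 / (?e s)^2 * ((?e s)^3 * (1 + 2 * ?p s) / (18 * (?p s)^5)) = - (?e s * (1 + 2 * ?p s)) / (3 * (?p s)^3)"
        using nz by (simp add: divide_simps; algebra)
      moreover have "((\<lambda>s. - ((?e s)^2)) has_field_derivative 4 * ?e s) (at s)"
        "(?p has_field_derivative - ?e s) (at s)"
        by (auto intro!: derivative_eq_intros simp: algebra_simps)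
      from DERIV_quotient_squares(2)[OF this, of 6]
      have "((\<lambda>s. - ((?e s)^2) / (6 * (?p s)^2)) has_field_derivative
          (4 * ?e s * ?p s - 2 * - ((?e s)^2) * - ?e s) / (6 * (?p s)^3)) (at s)"
        using nz by simp
      moreover have "4 * ?e s * ?p s - 2 * - ((?e s)^2) * - ?e s = 2 * - (?e s * (1 + 2 * ?p s))" by algebra
      moreover have "2 * - (?e s * (1 + 2 * ?p s)) / (6 * (?p s)^3) = - (?e s * (1 + 2 * ?p s)) / (3 * (?p s)^3)"
        by (simp add: divide_simps; algebra)
      ultimately show ?thesis by (simp only:)
    qed
    show "(s, s^3 * (s - 2) / ?e s) \<in> curve (poly4 4) \<inter> regular_region" if "s \<in> ?S" for s
    proof -
      have e: "?e s \<noteq> 0" using that by simp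
      have "s^4 - 2 * s^3 + 2 * t * s - t = 0" if "t * ?e s = s^3 * (s - 2)" for t
        using that by algebra
      from this[of "s^3 * (s - 2) / ?e s"] e show ?thesis using that reg[OF e] by (simp add: curve_def poly4_def)
    qed
    show "fst (l, t) \<in> ?S \<and> fst (l, t) = l \<and> (fst (l, t))^3 * (fst (l, t) - 2) / ?e (fst (l, t)) = t"
      if lt: "(l, t) \<in> curve (poly4 4) \<inter> regular_region" for l t
    proof -
      have c: "l^4 - 2 * l^3 + 2 * t * l - t = 0" using lt by (simp add: curve_def poly4_def)
      have e: "?e l \<noteq> 0"
      proof
        assume "?e l = 0"
        with c have "l^3 * (l - 2) = 0" "2 * l = 1" by algebra+
        then show False by auto
      qed
      have "l^3 * (l - 2) = t * ?e l" using c by algebra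
      then have "l^3 * (l - 2) / ?e l = t" using e by simp
      then show ?thesis using lt reg[OF e] by simp
    qed
  qed simp_all
qed

text \<open>This curve has degree two in \<open>t\<close>, so \<open>\<lambda>\<close> is not a parameter. It has genus zero with the parametrization
  \<open>\<lambda> = (1 - s\<^sup>2)/(1 + 2s)\<close>, \<open>t = (1 + s)(1 - s)\<^sup>3/(1 + 2s)\<^sup>3\<close>, whose inverse is \<open>\<sigma>\<close>.\<close>

lemma reference_solution_3:
  "algebraic_PVI_solution (curve (poly3 4)) (params_of (params3 1 4)) \<and> rational_curve (curve (poly3 4))"
proof -
  let ?p = "\<lambda>s :: complex. s * (s + 1)" and ?d = "\<lambda>s :: complex. 1 + 2 * s"
  let ?u = "\<lambda>s :: complex. (1 - s^2) / ?d s" and ?v = "\<lambda>s :: complex. (1 + s) * (1 - s)^3 / (?d s)^3"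
  let ?S = "{s. s \<noteq> 0 \<and> s + 1 \<noteq> 0 \<and> 1 - s \<noteq> 0 \<and> s + 2 \<noteq> 0 \<and> ?d s \<noteq> 0}"
  let ?\<sigma> = "\<lambda>(l, t). (t - 2 * l^3 + 3 * l^2 - 2 * l) / (2 * l * (l - 1)) - l"
  have reg: "(?u s, ?v s) \<in> regular_region \<longleftrightarrow> s \<in> ?S" if d: "?d s \<noteq> 0" for s
  proof -
    have "1 - s^2 - ?d s = - (s * (s + 2))" "(1 + s) * (1 - s)^3 - (?d s)^3 = - (s * (s + 2)^3)"
      "(1 - s^2) * (?d s)^2 - (1 + s) * (1 - s)^3 = 3 * s * (1 + s) * (1 - s) * (s + 2)"
      "1 - s^2 = (1 - s) * (1 + s)"
      by algebra+
    note poly = this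
    have "?u s - 1 = (1 - s^2 - ?d s) / ?d s" "?v s - 1 = ((1 + s) * (1 - s)^3 - (?d s)^3) / (?d s)^3"
      by (simp_all only: diff_divide_distrib divide_self[OF d] divide_self[OF power_not_zero[OF d]])
    moreover have "?u s = (1 - s^2) * (?d s)^2 / (?d s)^3"
      using d by (simp add: power2_eq_square power3_eq_cube)
    then have "?u s - ?v s = ((1 - s^2) * (?d s)^2 - (1 + s) * (1 - s)^3) / (?d s)^3"
      by (simp only: diff_divide_distrib)
    moreover have "?u s = (1 - s) * (1 + s) / ?d s" by (simp only: poly(4))
    ultimately have "?u s - 1 = - (s * (s + 2)) / ?d s" "?v s - 1 = - (s * (s + 2)^3) / (?d s)^3"
      "?u s - ?v s = 3 * s * (1 + s) * (1 - s) * (s + 2) / (?d s)^3" "?u s = (1 - s) * (1 + s) / ?d s"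
      by (simp_all only: poly(1-3))
    then have "?u s = 1 \<longleftrightarrow> - (s * (s + 2)) / ?d s = 0" "?v s = 1 \<longleftrightarrow> - (s * (s + 2)^3) / (?d s)^3 = 0"
      "?u s = ?v s \<longleftrightarrow> 3 * s * (1 + s) * (1 - s) * (s + 2) / (?d s)^3 = 0"
      "?u s = 0 \<longleftrightarrow> (1 - s) * (1 + s) / ?d s = 0"
      by (metis right_minus_eq)+
    then show ?thesis using d unfolding regular_region_def by (auto simp: add.commute)
  qed
  have r: "(1 - s) * (s + 2) = 2 - ?p s" for s by algebra
  have excluded: "- ?S \<subseteq> {s. poly ([:0, 1:] * [:1, 1:] * [:1, - 1:] * [:2, 1:] * [:1, 2:]) s = 0}"
  proof -
    have "poly ([:0, 1:] * [:1, 1:] * [:1, - 1:] * [:2, 1:] * [:1, 2:]) s =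
        s * (s + 1) * (1 - s) * (s + 2) * ?d s" for s
      unfolding poly_mult poly_pCons poly_0 by algebra
    then show ?thesis by (auto simp only: Compl_iff mem_Collect_eq mult_eq_0_iff intro!: subsetI)
  qed
  show ?thesis
  proof (rule algebraic_PVI_solution_parametrized[where S = ?S and u = ?u and v = ?v
      and dv = "\<lambda>s. - 2 * (2 - ?p s)^2 / (?d s)^4" and w = "\<lambda>s. (1 + ?p s) * (?d s)^2 / (2 - ?p s)^2"
      and \<sigma> = ?\<sigma> and pt = 3])
    show "open ?S" by (intro open_Collect_conj open_Collect_neq continuous_intros)
    show "finite (- ?S)" by (rule finite_subset[OF excluded poly_roots_finite]) simp
    fix s assume s: "s \<in> ?S"
    have nz: "?p s \<noteq> 0" "?d s \<noteq> 0" "2 - ?p s \<noteq> 0" using s unfolding r[symmetric] by auto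
    show "(?u has_field_derivative (1 + ?p s) * (?d s)^2 / (2 - ?p s)^2 * (- 2 * (2 - ?p s)^2 / (?d s)^4)) (at s)"
    proof -
      have "(?u has_field_derivative (- 2 * s * ?d s - (1 - s^2) * 2) / (?d s)^2) (at s)"
        using nz by (auto intro!: derivative_eq_intros simp: power2_eq_square algebra_simps)
      moreover have "- 2 * s * ?d s - (1 - s^2) * 2 = - 2 * (1 + ?p s)" by algebra
      moreover have "- 2 * (1 + ?p s) / (?d s)^2 = (1 + ?p s) * (?d s)^2 / (2 - ?p s)^2 * (- 2 * (2 - ?p s)^2 / (?d s)^4)"
        using nz by (simp add: divide_simps; algebra)
      ultimately show ?thesis by (simp only:)
    qed
    show "(?v has_field_derivative - 2 * (2 - ?p s)^2 / (?d s)^4) (at s)"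
    proof -
      have "((\<lambda>s. (1 + s) * (1 - s)^3) has_field_derivative (1 - s)^3 - (1 + s) * (3 * (1 - s)^2)) (at s)"
        by (auto intro!: derivative_eq_intros simp: power2_eq_square power3_eq_cube algebra_simps)
      moreover have "((\<lambda>s. (?d s)^3) has_field_derivative 3 * (?d s)^2 * 2) (at s)"
        by (auto intro!: derivative_eq_intros simp: power2_eq_square power3_eq_cube algebra_simps)
      moreover have "(?d s)^3 \<noteq> 0" using nz by simp
      ultimately have "(?v has_field_derivative
          (((1 - s)^3 - (1 + s) * (3 * (1 - s)^2)) * (?d s)^3 - (1 + s) * (1 - s)^3 * (3 * (?d s)^2 * 2)) / ((?d s)^3 * (?d s)^3)) (at s)"
        by (rule DERIV_divide)
      moreover have "((1 - s)^3 - (1 + s) * (3 * (1 - s)^2)) * (?d s)^3 - (1 + s) * (1 - s)^3 * (3 * (?d s)^2 * 2) =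
          (?d s)^2 * (- 2 * (2 - ?p s)^2)"
        unfolding r[symmetric] by algebra
      moreover have "(?d s)^2 * (- 2 * (2 - ?p s)^2) / ((?d s)^3 * (?d s)^3) = - 2 * (2 - ?p s)^2 / (?d s)^4"
        using nz by (simp add: divide_simps; algebra)
      ultimately show ?thesis by (simp only:)
    qed
    show "((\<lambda>s. (1 + ?p s) * (?d s)^2 / (2 - ?p s)^2) has_field_derivative
        - 2 * (2 - ?p s)^2 / (?d s)^4 * PVI_rhs (params_of (params3 1 4)) (?v s) (?u s) ((1 + ?p s) * (?d s)^2 / (2 - ?p s)^2)) (at s)"
    proof -
      have "PVI_rhs (params_of (params3 1 4)) (?v s) (?u s) ((1 + ?p s) * (?d s)^2 / (2 - ?p s)^2) =
          - 3 * (?d s)^5 * (4 + 7 * ?p s) / (2 * (2 - ?p s)^5)"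
        using PVI_rhs_parametrization_3[of s] s by (simp add: params_of_def params3_def)
      moreover have "- 2 * (2 - ?p s)^2 / (?d s)^4 * (- 3 * (?d s)^5 * (4 + 7 * ?p s) / (2 * (2 - ?p s)^5)) =
          3 * ?d s * (4 + 7 * ?p s) / (2 - ?p s)^3"
        using nz by (simp add: divide_simps; algebra)
      moreover have "((\<lambda>s. (1 + ?p s) * (?d s)^2) has_field_derivative ?d s * (?d s)^2 + (1 + ?p s) * (4 * ?d s)) (at s)"
        "((\<lambda>s. 2 - ?p s) has_field_derivative - ?d s) (at s)"
        by (auto intro!: derivative_eq_intros simp: algebra_simps)
      from DERIV_quotient_squares(2)[OF this, of 1]
      have "((\<lambda>s. (1 + ?p s) * (?d s)^2 / (2 - ?p s)^2) has_field_derivative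
          ((?d s * (?d s)^2 + (1 + ?p s) * (4 * ?d s)) * (2 - ?p s) - 2 * ((1 + ?p s) * (?d s)^2) * - ?d s) / (2 - ?p s)^3) (at s)"
        using nz by simp
      moreover have "(?d s * (?d s)^2 + (1 + ?p s) * (4 * ?d s)) * (2 - ?p s) - 2 * ((1 + ?p s) * (?d s)^2) * - ?d s =
          3 * ?d s * (4 + 7 * ?p s)"
        by algebra
      ultimately show ?thesis by (simp only:)
    qed
    show "(?u s, ?v s) \<in> curve (poly3 4) \<inter> regular_region"
    proof -
      have key: "l^4 - 4*t*l^3 + 6*t*l^2 - 4*t*l + t^2 = 0" if "l * d = a" "t * d^3 = b" "d \<noteq> 0"
        "d^2 * a^4 - 4 * b * a^3 + 6 * b * a^2 * d - 4 * b * a * d^2 + b^2 = 0" for l t a b d :: complex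
      proof -
        have "d^6 * (l^4 - 4*t*l^3 + 6*t*l^2 - 4*t*l + t^2) = d^2 * (l * d)^4 - 4 * (t * d^3) * (l * d)^3
            + 6 * (t * d^3) * (l * d)^2 * d - 4 * (t * d^3) * (l * d) * d^2 + (t * d^3)^2"
          by algebra
        also have "\<dots> = 0" unfolding that(1,2) by (rule that(4))
        finally have "d^6 * (l^4 - 4*t*l^3 + 6*t*l^2 - 4*t*l + t^2) = 0" .
        then show ?thesis using that(3) by simp
      qed
      have "(?d s)^2 * (1 - s^2)^4 - 4 * ((1 + s) * (1 - s)^3) * (1 - s^2)^3
          + 6 * ((1 + s) * (1 - s)^3) * (1 - s^2)^2 * ?d s - 4 * ((1 + s) * (1 - s)^3) * (1 - s^2) * (?d s)^2
          + ((1 + s) * (1 - s)^3)^2 = 0" by algebra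
      then have "(?u s)^4 - 4 * ?v s * (?u s)^3 + 6 * ?v s * (?u s)^2 - 4 * ?v s * ?u s + (?v s)^2 = 0"
        by (rule key[rotated 3]) (use nz in simp_all)
      then have "(?u s, ?v s) \<in> curve (poly3 4)"
        by (simp add: curve_def poly3_def)
      then show ?thesis using reg[OF nz(2)] s by simp
    qed
  next
    fix l t assume lt: "(l, t) \<in> curve (poly3 4) \<inter> regular_region"
    have nz: "l \<noteq> 0" "l - 1 \<noteq> 0" using lt by (auto simp: regular_region_def)
    have c: "l^4 - 4*t*l^3 + 6*t*l^2 - 4*t*l + t^2 = 0" using lt by (simp add: curve_def poly3_def)
    define s where "s = ?\<sigma> (l, t)"
    have w: "2 * l * (l - 1) * (s + l) = t - 2 * l^3 + 3 * l^2 - 2 * l"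
      using nz by (simp add: s_def)
    have "(2 * l * (l - 1))^2 * ((s + l)^2 - (l^2 - l + 1)) = 0"
      using w c by algebra
    then have w2: "(s + l)^2 = l^2 - l + 1" using nz by simp
    then have l: "l * ?d s = 1 - s^2" by algebra
    have d: "?d s \<noteq> 0"
    proof
      assume "?d s = 0"
      with l have "1 - s^2 = 0" "1 + 2 * s = 0" by simp_all
      then have "(3 :: complex) = 0" by algebra
      then show False by simp
    qed
    have u: "?u s = l" using l d by (simp add: divide_simps)
    have "t * (?d s)^3 = (1 + s) * (1 - s)^3"
      using w l by algebra
    then have v: "?v s = t" using d by (simp add: divide_simps)
    show "?\<sigma> (l, t) \<in> ?S \<and> ?u (?\<sigma> (l, t)) = l \<and> ?v (?\<sigma> (l, t)) = t"
      using lt reg[OF d] u v unfolding s_def[symmetric] by simp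
  next
    fix U and f :: "complex \<Rightarrow> complex"
    assume f: "f holomorphic_on U" "\<And>t. t \<in> U \<Longrightarrow> (f t, t) \<in> curve (poly3 4) \<inter> regular_region"
    have "f t \<noteq> 0 \<and> f t - 1 \<noteq> 0" if "t \<in> U" for t using f(2)[OF that] by (simp add: regular_region_def)
    then show "(\<lambda>t. ?\<sigma> (f t, t)) holomorphic_on U"
      using f(1) by (auto intro!: holomorphic_intros)
  qed simp_all
qed

section \<open>Local exponents of the Picard--Fuchs equation\<close>

text \<open>In terms of logarithmic derivatives, the coefficients depend only on the behaviour of \<open>\<triangle>\<close>, \<open>\<delta>\<close> and \<open>g\<^sub>2\<close>.\<close>

lemma elim_p_PF:
  assumes "poly (disc_poly g2 g3) z \<noteq> 0" "poly (delta_poly g2 g3) z \<noteq> 0"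
  shows "elim_p (PF_matrix g2 g3) z =
    1/2 * (poly (pderiv (disc_poly g2 g3)) z / poly (disc_poly g2 g3) z)
      - poly (pderiv (delta_poly g2 g3)) z / poly (delta_poly g2 g3) z"
    and "elim_q (PF_matrix g2 g3) z =
    1/18 * (poly (pderiv (disc_poly g2 g3)) z / poly (disc_poly g2 g3) z)^2
      - 3/2 * (poly g2 z * (poly (delta_poly g2 g3) z / poly (disc_poly g2 g3) z)^2)
      - 1/6 * (poly (pderiv (pderiv (disc_poly g2 g3))) z / poly (disc_poly g2 g3) z)
      + 1/6 * (poly (pderiv (disc_poly g2 g3)) z / poly (disc_poly g2 g3) z
        * (poly (pderiv (delta_poly g2 g3)) z / poly (delta_poly g2 g3) z))"
proof -
  define f h f' h' f'' where "f = poly (disc_poly g2 g3) z" and "h = poly (delta_poly g2 g3) z"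
    and "f' = poly (pderiv (disc_poly g2 g3)) z" and "h' = poly (pderiv (delta_poly g2 g3)) z"
    and "f'' = poly (pderiv (pderiv (disc_poly g2 g3))) z"
  have nz: "f \<noteq> 0" "h \<noteq> 0" using assms by (simp_all add: f_def h_def)
  have 1: "deriv (\<lambda>w. PF_matrix g2 g3 w $ 1 $ 2) z = (- 3 * h' * f - (- 3 * h) * f') / f^2"
    unfolding PF_matrix_components f_def h_def f'_def h'_def
    by (intro DERIV_imp_deriv)
      (use assms in \<open>auto intro!: derivative_eq_intros poly_DERIV
        simp: power2_eq_square minus_divide_left algebra_simps simp del: divide_minus_left\<close>)
  have 2: "deriv (\<lambda>w. PF_matrix g2 g3 w $ 1 $ 1) z = (f'' / 6 * f - f' / 6 * f') / f^2"
    unfolding PF_matrix_components f_def f'_def f''_def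
    by (intro DERIV_imp_deriv)
      (use assms in \<open>auto intro!: derivative_eq_intros poly_DERIV simp: power2_eq_square field_simps\<close>)
  have 3: "(- 3 * h' * f - (- 3 * h) * f') / f^2 / (- 3 * h / f) = h' / h - f' / f"
    using nz by (simp add: divide_simps; algebra)
  have 4: "(f'' / 6 * f - f' / 6 * f') / f^2 = 1/6 * (f'' / f) - 1/6 * (f' / f)^2"
    using nz by (simp add: divide_simps; algebra)
  have 5: "f' / 6 / f * x / y = 1/6 * (f' / f) * (x / y)" for x y :: complex by simp
  show "elim_p (PF_matrix g2 g3) z = 1/2 * (f' / f) - h' / h"
    unfolding elim_p_def 1 unfolding PF_matrix_components
    unfolding f_def[symmetric] h_def[symmetric] f'_def[symmetric] h'_def[symmetric] 3
    by (simp add: field_simps)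
  have 6: "f' / 6 / f * (f' / 3 / f) = 1/18 * (f' / f)^2"
    "- 3 * h / f * (- (x * h) / 2 / f) = 3/2 * (x * (h / f)^2)" for x
    by (simp_all add: power2_eq_square ac_simps)
  have 7: "1/18 * u^2 - 3/2 * x - (1/6 * w - 1/6 * u^2) + 1/6 * u * (v - u) =
    1/18 * u^2 - 3/2 * x - 1/6 * w + 1/6 * (u * v)" for u v w x :: complex
    by (simp add: field_simps power2_eq_square)
  have 8: "f' / 6 / f * y / x = 1/6 * (f' / f) * (y / x)" for x y by simp
  show "elim_q (PF_matrix g2 g3) z =
    1/18 * (f' / f)^2 - 3/2 * (poly g2 z * (h / f)^2) - 1/6 * (f'' / f) + 1/6 * (f' / f * (h' / h))"
    unfolding elim_q_def 1 2 unfolding PF_matrix_components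
    unfolding f_def[symmetric] h_def[symmetric] f'_def[symmetric] 6 4 8 3 7 ..
qed

text \<open>The squared difference of the roots of a monic quadratic polynomial is its discriminant.\<close>

lemma exponent_difference_iff_aux:
  fixes p0 q0 \<kappa> :: complex
  shows "(\<exists>r1 r2. [:- r1, 1:] * [:- r2, 1:] = [:q0, p0, 1:] \<and> \<kappa> = r1 - r2) \<longleftrightarrow> \<kappa>^2 = p0^2 - 4 * q0"
proof
  assume "\<exists>r1 r2. [:- r1, 1:] * [:- r2, 1:] = [:q0, p0, 1:] \<and> \<kappa> = r1 - r2"
  then obtain r1 r2 where e: "[:- r1, 1:] * [:- r2, 1:] = [:q0, p0, 1:]" and k: "\<kappa> = r1 - r2" by blast
  have "r1 * r2 = q0" "- r2 - r1 = p0" using e by (simp_all add: mult.commute)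
  with k show "\<kappa>^2 = p0^2 - 4 * q0" by algebra
next
  assume k: "\<kappa>^2 = p0^2 - 4 * q0"
  define r1 r2 where "r1 = (\<kappa> - p0) / 2" and "r2 = (- \<kappa> - p0) / 2"
  have "4 * (r1 * r2) = (\<kappa> - p0) * (- \<kappa> - p0)" by (simp add: r1_def r2_def)
  also have "\<dots> = p0^2 - \<kappa>^2" by algebra
  finally have "4 * (r1 * r2) = p0^2 - \<kappa>^2" .
  with k have "4 * (r1 * r2) = 4 * q0" by simp
  then have "r1 * r2 = q0" by simp
  moreover have "- r2 - r1 = p0" "\<kappa> = r1 - r2" by (simp_all add: r1_def r2_def field_simps)
  ultimately show "\<exists>r1 r2. [:- r1, 1:] * [:- r2, 1:] = [:q0, p0, 1:] \<and> \<kappa> = r1 - r2"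
    by (intro exI[of _ r1] exI[of _ r2]) auto
qed

lemma exponent_difference_finite_iff:
  assumes "((\<lambda>z. (z - s) * p z) \<longlongrightarrow> p0) (at s)" "((\<lambda>z. (z - s)^2 * q z) \<longlongrightarrow> q0) (at s)"
  shows "exponent_difference p q (Some s) \<kappa> \<longleftrightarrow> \<kappa>^2 = (p0 - 1)^2 - 4 * q0"
proof -
  have "indicial_poly p q (Some s) F \<longleftrightarrow> F = [:q0, p0 - 1, 1:]" for F
    using assms tendsto_unique[OF at_neq_bot] by fastforce
  then show ?thesis
    by (simp only: exponent_difference_def exponent_difference_iff_aux)
qed

lemma exponent_difference_infinity_iff:
  assumes "((\<lambda>z. z * p z) \<longlongrightarrow> p0) at_infinity" "((\<lambda>z. z^2 * q z) \<longlongrightarrow> q0) at_infinity"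
  shows "exponent_difference p q None \<kappa> \<longleftrightarrow> \<kappa>^2 = (p0 - 1)^2 - 4 * q0"
proof -
  have "indicial_poly p q None F \<longleftrightarrow> F = [:q0, 1 - p0, 1:]" for F
    using assms tendsto_unique[OF trivial_limit_at_infinity] by fastforce
  then show ?thesis
    by (simp only: exponent_difference_def exponent_difference_iff_aux power2_commute[of 1 p0])
qed

text \<open>The discriminant of the indicial polynomial at a point where \<open>\<triangle>\<close> and \<open>\<delta>\<close> have orders \<open>m\<close> and \<open>n\<close>, where
  \<open>c\<close> is the limit of \<open>(z - s)\<^sup>2 g\<^sub>2 \<delta>\<^sup>2 / \<triangle>\<^sup>2\<close>; at infinity the orders are replaced by the degrees.\<close>

definition exponent_discriminant :: "nat \<Rightarrow> nat \<Rightarrow> complex \<Rightarrow> complex" where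
  "exponent_discriminant m n c =
    (of_nat m / 2 - of_nat n - 1)^2
      - 4 * ((of_nat m)^2 / 18 - 3/2 * c - (of_nat m)^2 / 6 + of_nat m / 6 + of_nat m * of_nat n / 6)"

text \<open>The function \<open>\<phi>\<close> is \<open>z - s\<close> at a finite point and \<open>z\<close> at infinity, so both kinds of singular points are
  treated at once.\<close>

lemma PF_limits:
  fixes \<phi> :: "complex \<Rightarrow> complex" and g2 g3 :: "complex poly"
  defines "D \<equiv> disc_poly g2 g3" and "\<delta> \<equiv> delta_poly g2 g3"
  assumes ev: "eventually (\<lambda>z. poly D z \<noteq> 0 \<and> poly \<delta> z \<noteq> 0) F"
    and 1: "((\<lambda>z. \<phi> z * poly (pderiv D) z / poly D z) \<longlongrightarrow> of_nat m) F"
    and 2: "((\<lambda>z. (\<phi> z)^2 * poly (pderiv (pderiv D)) z / poly D z) \<longlongrightarrow> (of_nat m)^2 - of_nat m) F"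
    and 3: "((\<lambda>z. \<phi> z * poly (pderiv \<delta>) z / poly \<delta> z) \<longlongrightarrow> of_nat n) F"
    and 4: "((\<lambda>z. (\<phi> z)^2 * (poly g2 z * (poly \<delta> z / poly D z)^2)) \<longlongrightarrow> c) F"
  shows "((\<lambda>z. \<phi> z * elim_p (PF_matrix g2 g3) z) \<longlongrightarrow> of_nat m / 2 - of_nat n) F"
    "((\<lambda>z. (\<phi> z)^2 * elim_q (PF_matrix g2 g3) z) \<longlongrightarrow>
      (of_nat m)^2 / 18 - 3/2 * c - (of_nat m)^2 / 6 + of_nat m / 6 + of_nat m * of_nat n / 6) F"
proof -
  have "((\<lambda>z. 1/2 * (\<phi> z * poly (pderiv D) z / poly D z) - \<phi> z * poly (pderiv \<delta>) z / poly \<delta> z)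
      \<longlongrightarrow> 1/2 * of_nat m - of_nat n) F"
    by (intro tendsto_intros 1 3)
  then have "((\<lambda>z. 1/2 * (\<phi> z * poly (pderiv D) z / poly D z) - \<phi> z * poly (pderiv \<delta>) z / poly \<delta> z)
      \<longlongrightarrow> of_nat m / 2 - of_nat n) F" by simp
  then show "((\<lambda>z. \<phi> z * elim_p (PF_matrix g2 g3) z) \<longlongrightarrow> of_nat m / 2 - of_nat n) F"
    by (rule Lim_transform_eventually)
      (use ev in eventually_elim, simp add: D_def \<delta>_def elim_p_PF algebra_simps)
  have "((\<lambda>z. 1/18 * (\<phi> z * poly (pderiv D) z / poly D z)^2
      - 3/2 * ((\<phi> z)^2 * (poly g2 z * (poly \<delta> z / poly D z)^2))
      - 1/6 * ((\<phi> z)^2 * poly (pderiv (pderiv D)) z / poly D z)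
      + 1/6 * ((\<phi> z * poly (pderiv D) z / poly D z) * (\<phi> z * poly (pderiv \<delta>) z / poly \<delta> z)))
      \<longlongrightarrow> 1/18 * (of_nat m)^2 - 3/2 * c - 1/6 * ((of_nat m)^2 - of_nat m) + 1/6 * (of_nat m * of_nat n)) F"
    by (intro tendsto_intros 1 2 3 4)
  moreover have "1/18 * (of_nat m)^2 - 3/2 * c - 1/6 * ((of_nat m)^2 - of_nat m) + 1/6 * (of_nat m * of_nat n) =
      (of_nat m)^2 / 18 - 3/2 * c - (of_nat m)^2 / 6 + of_nat m / 6 + of_nat m * of_nat n / (6 :: complex)"
    by (simp add: field_simps)
  ultimately have "((\<lambda>z. 1/18 * (\<phi> z * poly (pderiv D) z / poly D z)^2
      - 3/2 * ((\<phi> z)^2 * (poly g2 z * (poly \<delta> z / poly D z)^2))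
      - 1/6 * ((\<phi> z)^2 * poly (pderiv (pderiv D)) z / poly D z)
      + 1/6 * ((\<phi> z * poly (pderiv D) z / poly D z) * (\<phi> z * poly (pderiv \<delta>) z / poly \<delta> z)))
      \<longlongrightarrow> (of_nat m)^2 / 18 - 3/2 * c - (of_nat m)^2 / 6 + of_nat m / 6 + of_nat m * of_nat n / 6) F"
    by (simp only:)
  then show "((\<lambda>z. (\<phi> z)^2 * elim_q (PF_matrix g2 g3) z) \<longlongrightarrow>
      (of_nat m)^2 / 18 - 3/2 * c - (of_nat m)^2 / 6 + of_nat m / 6 + of_nat m * of_nat n / 6) F"
    by (rule Lim_transform_eventually)
      (use ev in eventually_elim, simp add: D_def \<delta>_def elim_p_PF algebra_simps power2_eq_square)
qed

text \<open>The Euler operator \<open>(z - s) d/dz\<close> preserves both the order of vanishing at \<open>s\<close> and, for \<open>s = 0\<close>, the degree, and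
  multiplies the leading term by it.\<close>

definition euler :: "complex \<Rightarrow> complex poly \<Rightarrow> complex poly" where
  "euler s f = [:- s, 1:] * pderiv f"

lemma poly_euler: "poly (euler s f) z = (z - s) * poly (pderiv f) z"
  by (simp add: euler_def algebra_simps)

lemma poly_euler_euler: "(z - s)^2 * poly (pderiv (pderiv f)) z = poly (euler s (euler s f)) z - poly (euler s f) z"
proof -
  have e: "pderiv (euler s f) = pderiv f + [:- s, 1:] * pderiv (pderiv f)"
    unfolding euler_def pderiv_mult by (simp add: pderiv_pCons)
  have "poly (euler s (euler s f)) z = (z - s) * (poly (pderiv f) z + (z - s) * poly (pderiv (pderiv f)) z)"
    unfolding poly_euler[of s "euler s f"] e by (simp add: algebra_simps)
  then show ?thesis by (simp add: poly_euler algebra_simps power2_eq_square)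
qed

lemma euler_zero_order:
  assumes "f = [:- s, 1:] ^ m * h"
  obtains h' where "euler s f = [:- s, 1:] ^ m * h'" "poly h' s = of_nat m * poly h s"
proof -
  have "[:- s, 1:] * pderiv ([:- s, 1:] ^ m) = of_nat m * [:- s, 1:] ^ m"
  proof (cases m)
    case (Suc k)
    show ?thesis
      unfolding Suc pderiv_power_Suc by (rule poly_ext) (simp add: pderiv_pCons of_nat_poly algebra_simps)
  qed simp
  then have "euler s f = [:- s, 1:] ^ m * (of_nat m * h + [:- s, 1:] * pderiv h)"
    by (simp add: assms euler_def pderiv_mult algebra_simps)
  then show ?thesis by (rule that) (simp add: of_nat_poly)
qed

text \<open>The relation between the orders makes \<open>(z - s)\<^sup>2 g\<^sub>2 \<delta>\<^sup>2 / \<triangle>\<^sup>2\<close> regular at \<open>s\<close>. The number \<open>k\<close> need not be the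
  exact order of \<open>g\<^sub>2\<close>; if \<open>g\<^sub>2\<close> vanishes to a higher order, the limit is zero.\<close>

lemma exponent_difference_finite:
  fixes s :: complex and g2 g3 :: "complex poly"
  defines "D \<equiv> disc_poly g2 g3" and "\<delta> \<equiv> delta_poly g2 g3"
  assumes D: "\<And>z. poly D z = (z - s)^m * poly D1 z" "poly D1 s \<noteq> 0"
    and \<delta>: "\<And>z. poly \<delta> z = (z - s)^n * poly \<delta>1 z" "poly \<delta>1 s \<noteq> 0"
    and g2: "\<And>z. poly g2 z = (z - s)^k * poly G z" and k: "2 + k + 2 * n = 2 * m"
  shows "exponent_difference (elim_p (PF_matrix g2 g3)) (elim_q (PF_matrix g2 g3)) (Some s) \<kappa> \<longleftrightarrow>
    \<kappa>^2 = exponent_discriminant m n (poly G s * (poly \<delta>1 s)^2 / (poly D1 s)^2)"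
proof -
  have lims: "((\<lambda>z. (z - s) * poly (pderiv f) z / poly f z) \<longlongrightarrow> of_nat m) (at s)"
    "((\<lambda>z. (z - s)^2 * poly (pderiv (pderiv f)) z / poly f z) \<longlongrightarrow> (of_nat m)^2 - of_nat m) (at s)"
    if f: "\<And>z. poly f z = (z - s)^m * poly h z" "poly h s \<noteq> 0" for f h m
  proof -
    have "f = [:- s, 1:] ^ m * h" by (rule poly_ext) (simp add: f(1) algebra_simps)
    then obtain h1 where h1: "euler s f = [:- s, 1:] ^ m * h1" "poly h1 s = of_nat m * poly h s"
      by (rule euler_zero_order)
    obtain h2 where h2: "euler s (euler s f) = [:- s, 1:] ^ m * h2" "poly h2 s = of_nat m * poly h1 s"
      by (rule euler_zero_order[OF h1(1)])
    have "poly (euler s f) z = (z - s)^m * poly h1 z" for z by (simp add: h1(1))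
    moreover have "poly (euler s (euler s f)) z = (z - s)^m * poly h2 z" for z by (subst h2(1)) simp
    ultimately have e: "poly (euler s f) z = (z - s)^m * poly h1 z"
      "poly (euler s (euler s f)) z = (z - s)^m * poly h2 z" for z by blast+
    have ne: "eventually (\<lambda>z. z \<noteq> s) (at s)" by (simp add: eventually_at_filter)
    have "((\<lambda>z. poly h1 z / poly h z) \<longlongrightarrow> poly h1 s / poly h s) (at s)"
      using f(2) by (intro tendsto_intros)
    then have "((\<lambda>z. poly h1 z / poly h z) \<longlongrightarrow> of_nat m) (at s)" using f(2) h1 by simp
    then show "((\<lambda>z. (z - s) * poly (pderiv f) z / poly f z) \<longlongrightarrow> of_nat m) (at s)"
      by (rule Lim_transform_eventually) (use ne in eventually_elim, simp add: poly_euler[symmetric] e f)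
    have "((\<lambda>z. poly h2 z / poly h z - poly h1 z / poly h z) \<longlongrightarrow> poly h2 s / poly h s - poly h1 s / poly h s) (at s)"
      using f(2) by (intro tendsto_intros)
    then have "((\<lambda>z. poly h2 z / poly h z - poly h1 z / poly h z) \<longlongrightarrow> (of_nat m)^2 - of_nat m) (at s)"
      using f(2) h1 h2 by (simp add: power2_eq_square)
    then show "((\<lambda>z. (z - s)^2 * poly (pderiv (pderiv f)) z / poly f z) \<longlongrightarrow> (of_nat m)^2 - of_nat m) (at s)"
      by (rule Lim_transform_eventually)
        (use ne in eventually_elim, simp add: poly_euler_euler e f diff_divide_distrib)
  qed
  have ne: "eventually (\<lambda>z. z \<noteq> s) (at s)" by (simp add: eventually_at_filter)
  have ev: "eventually (\<lambda>z. poly f z \<noteq> 0) (at s)" if "poly f s \<noteq> 0" for f :: "complex poly"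
    using tendsto_imp_eventually_ne[OF poly_isCont[unfolded isCont_def] that] .
  have 1: "eventually (\<lambda>z. poly D z \<noteq> 0 \<and> poly \<delta> z \<noteq> 0) (at s)"
    using ne ev[OF D(2)] ev[OF \<delta>(2)] by eventually_elim (simp add: D(1) \<delta>(1))
  have 2: "((\<lambda>z. (z - s)^2 * (poly g2 z * (poly \<delta> z / poly D z)^2)) \<longlongrightarrow>
      poly G s * (poly \<delta>1 s)^2 / (poly D1 s)^2) (at s)"
  proof -
    have "((\<lambda>z. poly G z * (poly \<delta>1 z)^2 / (poly D1 z)^2) \<longlongrightarrow> poly G s * (poly \<delta>1 s)^2 / (poly D1 s)^2) (at s)"
      using D(2) by (intro tendsto_intros) simp
    then show ?thesis
    proof (rule Lim_transform_eventually)
      show "eventually (\<lambda>z. poly G z * (poly \<delta>1 z)^2 / (poly D1 z)^2 =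
          (z - s)^2 * (poly g2 z * (poly \<delta> z / poly D z)^2)) (at s)"
        using ne
      proof eventually_elim
        fix z assume z: "z \<noteq> s"
        have "(z - s)^2 * ((z - s)^k * ((z - s)^n)^2) = ((z - s)^m)^2"
          using k by (simp flip: power_add power_mult add: mult.commute)
        moreover have "x * (x' * G * (y * d / (w * e))^2) = (x * (x' * y^2)) / w^2 * (G * d^2 / e^2)" for x x' y w G d e :: complex
          by (simp add: power_mult_distrib power_divide)
        ultimately show "poly G z * (poly \<delta>1 z)^2 / (poly D1 z)^2 =
          (z - s)^2 * (poly g2 z * (poly \<delta> z / poly D z)^2)"
          using z by (simp only: D(1) \<delta>(1) g2) simp
      qed
    qed
  qed
  note L = 1 lims[OF D] lims(1)[OF \<delta>] 2
  show ?thesis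
    unfolding exponent_discriminant_def
    by (rule exponent_difference_finite_iff[OF PF_limits[OF L[unfolded D_def \<delta>_def]]])
qed

lemma poly_at_infinity_coeff:
  fixes f :: "complex poly"
  assumes "degree f \<le> N"
  shows "((\<lambda>z. poly f z / z ^ N) \<longlongrightarrow> coeff f N) at_infinity"
proof (cases "degree f = N")
  case True
  then show ?thesis using poly_divide_tendsto_aux[of f] by simp
next
  case False
  with assms have "degree f < degree (monom 1 N :: complex poly)" by (simp add: degree_monom_eq)
  from poly_divide_tendsto_0_at_infinity[OF this] show ?thesis
    using False assms by (simp add: poly_monom coeff_eq_0)
qed

lemma exponent_difference_infinity:
  fixes g2 g3 :: "complex poly"
  defines "D \<equiv> disc_poly g2 g3" and "\<delta> \<equiv> delta_poly g2 g3"
  assumes D: "degree D \<le> m" "coeff D m \<noteq> 0" and \<delta>: "degree \<delta> \<le> n" "coeff \<delta> n \<noteq> 0"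
    and g2: "degree g2 \<le> k" and k: "2 + k + 2 * n = 2 * m"
  shows "exponent_difference (elim_p (PF_matrix g2 g3)) (elim_q (PF_matrix g2 g3)) None \<kappa> \<longleftrightarrow>
    \<kappa>^2 = exponent_discriminant m n (coeff g2 k * (coeff \<delta> n)^2 / (coeff D m)^2)"
proof -
  have ne: "eventually (\<lambda>z :: complex. z \<noteq> 0) at_infinity"
    by (rule eventually_not_equal_at_infinity)
  have ev: "eventually (\<lambda>z. poly f z \<noteq> 0) at_infinity" if "degree f \<le> m" "coeff f m \<noteq> 0" for f :: "complex poly" and m
    using tendsto_imp_eventually_ne[OF poly_at_infinity_coeff[OF that(1)] that(2)] by eventually_elim auto
  have coeff_euler: "coeff (euler 0 f) i = of_nat i * coeff f i" for f :: "complex poly" and i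
    by (cases i) (simp_all add: euler_def coeff_pCons coeff_pderiv)
  have deg_euler: "degree (euler 0 f) \<le> i" if "degree f \<le> i" for f :: "complex poly" and i
    using that by (intro degree_le) (auto simp: coeff_euler coeff_eq_0)
  have lims: "((\<lambda>z. z * poly (pderiv f) z / poly f z) \<longlongrightarrow> of_nat m) at_infinity"
    "((\<lambda>z. z^2 * poly (pderiv (pderiv f)) z / poly f z) \<longlongrightarrow> (of_nat m)^2 - of_nat m) at_infinity"
    if f: "degree f \<le> m" "coeff f m \<noteq> 0" for f :: "complex poly" and m
  proof -
    let ?h = "\<lambda>f z. poly f z / z ^ m"
    have h: "(?h f \<longlongrightarrow> coeff f m) at_infinity" "(?h (euler 0 f) \<longlongrightarrow> of_nat m * coeff f m) at_infinity"
      "(?h (euler 0 (euler 0 f)) \<longlongrightarrow> of_nat m * (of_nat m * coeff f m)) at_infinity"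
      using poly_at_infinity_coeff[OF f(1)] poly_at_infinity_coeff[OF deg_euler[OF f(1)]]
        poly_at_infinity_coeff[OF deg_euler[OF deg_euler[OF f(1)]]] by (simp_all add: coeff_euler)
    have "((\<lambda>z. ?h (euler 0 f) z / ?h f z) \<longlongrightarrow> of_nat m * coeff f m / coeff f m) at_infinity"
      by (intro tendsto_divide h f)
    then have "((\<lambda>z. ?h (euler 0 f) z / ?h f z) \<longlongrightarrow> of_nat m) at_infinity" using f by simp
    then show "((\<lambda>z. z * poly (pderiv f) z / poly f z) \<longlongrightarrow> of_nat m) at_infinity"
      by (rule Lim_transform_eventually) (use ne in eventually_elim, simp add: poly_euler)
    have "((\<lambda>z. (?h (euler 0 (euler 0 f)) z - ?h (euler 0 f) z) / ?h f z)
        \<longlongrightarrow> (of_nat m * (of_nat m * coeff f m) - of_nat m * coeff f m) / coeff f m) at_infinity"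
      by (intro tendsto_intros h f)
    then have "((\<lambda>z. (?h (euler 0 (euler 0 f)) z - ?h (euler 0 f) z) / ?h f z) \<longlongrightarrow> (of_nat m)^2 - of_nat m) at_infinity"
      using f by (simp add: power2_eq_square diff_divide_distrib)
    then show "((\<lambda>z. z^2 * poly (pderiv (pderiv f)) z / poly f z) \<longlongrightarrow> (of_nat m)^2 - of_nat m) at_infinity"
    proof (rule Lim_transform_eventually)
      show "eventually (\<lambda>z. (?h (euler 0 (euler 0 f)) z - ?h (euler 0 f) z) / ?h f z =
          z^2 * poly (pderiv (pderiv f)) z / poly f z) at_infinity"
        using ne
      proof eventually_elim
        fix z :: complex assume "z \<noteq> 0"
        then show "(?h (euler 0 (euler 0 f)) z - ?h (euler 0 f) z) / ?h f z = z^2 * poly (pderiv (pderiv f)) z / poly f z"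
          using poly_euler_euler[of z 0 f] by (simp flip: diff_divide_distrib)
      qed
    qed
  qed
  have 1: "eventually (\<lambda>z. poly D z \<noteq> 0 \<and> poly \<delta> z \<noteq> 0) at_infinity"
    using ev[OF D] ev[OF \<delta>] by eventually_elim simp
  have 2: "((\<lambda>z. z^2 * (poly g2 z * (poly \<delta> z / poly D z)^2)) \<longlongrightarrow>
      coeff g2 k * (coeff \<delta> n / coeff D m)^2) at_infinity"
  proof -
    have "((\<lambda>z. poly g2 z / z^k * (poly \<delta> z / z^n / (poly D z / z^m))^2) \<longlongrightarrow>
        coeff g2 k * (coeff \<delta> n / coeff D m)^2) at_infinity"
      by (intro tendsto_intros poly_at_infinity_coeff D \<delta> g2)
    then show ?thesis
    proof (rule Lim_transform_eventually)
      show "eventually (\<lambda>z. poly g2 z / z^k * (poly \<delta> z / z^n / (poly D z / z^m))^2 =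
          z^2 * (poly g2 z * (poly \<delta> z / poly D z)^2)) at_infinity"
        using ne
      proof eventually_elim
        fix z :: complex assume z: "z \<noteq> 0"
        have "(z^m)^2 = z^2 * (z^k * (z^n)^2)"
          using k by (simp flip: power_add power_mult add: mult.commute)
        moreover have "g / x * (d / y / (e / w))^2 = w^2 / (x * y^2) * (g * (d / e)^2)" for g x d y e w :: complex
          by (simp add: power_mult_distrib power_divide ac_simps)
        ultimately show "poly g2 z / z^k * (poly \<delta> z / z^n / (poly D z / z^m))^2 =
            z^2 * (poly g2 z * (poly \<delta> z / poly D z)^2)"
          using z by simp
      qed
    qed
  qed
  note L = 1 lims[OF D] lims(1)[OF \<delta>] 2
  have "coeff g2 k * (coeff \<delta> n)^2 / (coeff D m)^2 = coeff g2 k * (coeff \<delta> n / coeff D m)^2"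
    by (simp add: power_divide)
  then show ?thesis
    unfolding exponent_discriminant_def
    using exponent_difference_infinity_iff[OF PF_limits[OF L[unfolded D_def \<delta>_def]], folded D_def \<delta>_def]
    by (simp only:)
qed

text \<open>At a simple zero of \<open>\<triangle>\<close> the relation \<open>g\<^sub>2\<^sup>3 = 27 g\<^sub>3\<^sup>2\<close> forces \<open>27 g\<^sub>2 \<delta>\<^sup>2 = \<triangle>'\<^sup>2\<close>, so the exponent difference
  is always \<open>1/2\<close>, whatever the deformation.\<close>

lemma exponent_difference_simple_zero:
  fixes g2 g3 :: "complex poly"
  defines "D \<equiv> disc_poly g2 g3"
  assumes "poly D s = 0" "poly (pderiv D) s \<noteq> 0"
  shows "exponent_difference (elim_p (PF_matrix g2 g3)) (elim_q (PF_matrix g2 g3)) (Some s) \<kappa> \<longleftrightarrow> \<kappa>^2 = 1/4"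
proof -
  define \<delta> where "\<delta> = delta_poly g2 g3"
  obtain D1 where D1: "D = [:- s, 1:] * D1" using assms(2) by (auto simp: poly_eq_0_iff_dvd)
  have "poly (pderiv D) s = poly D1 s"
    unfolding D1 pderiv_mult by (simp add: pderiv_pCons)
  define x y x' y' where "x = poly g2 s" and "y = poly g3 s" and "x' = poly (pderiv g2) s" and "y' = poly (pderiv g3) s"
  have e: "poly D s = x^3 - 27 * y^2" "poly (pderiv D) s = 3 * x^2 * x' - 54 * y * y'"
    "poly \<delta> s = 3 * y * x' - 2 * x * y'"
    by (simp_all add: D_def \<delta>_def disc_poly_def delta_poly_def x_def y_def x'_def y'_def
        pderiv_diff pderiv_mult power2_eq_square power3_eq_cube algebra_simps)
  have c: "27 * (x * (poly \<delta> s)^2) = (poly (pderiv D) s)^2"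
    using assms(2) unfolding e by algebra
  then have \<delta>: "poly \<delta> s \<noteq> 0" using assms(3) by auto
  have "exponent_difference (elim_p (PF_matrix g2 g3)) (elim_q (PF_matrix g2 g3)) (Some s) \<kappa> \<longleftrightarrow>
      \<kappa>^2 = exponent_discriminant 1 0 (poly g2 s * (poly \<delta> s)^2 / (poly D1 s)^2)"
    using assms(3) \<delta> \<open>poly (pderiv D) s = poly D1 s\<close> unfolding \<delta>_def
    by (intro exponent_difference_finite[where k = 0]) (simp_all add: D1[unfolded D_def] algebra_simps)
  also have "poly g2 s * (poly \<delta> s)^2 / (poly D1 s)^2 = 1/27"
    using c assms(3) \<open>poly (pderiv D) s = poly D1 s\<close> by (simp add: x_def divide_simps ac_simps)
  finally show ?thesis by (simp add: exponent_discriminant_def power2_eq_square)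
qed

section \<open>Normalized configurations\<close>

definition coords :: "complex option \<Rightarrow> complex \<times> complex" where
  "coords s = (case s of None \<Rightarrow> (1, 0) | Some z \<Rightarrow> (z, 1))"

lemma coords_simps [simp]: "coords None = (1, 0)" "coords (Some z) = (z, 1)"
  by (simp_all add: coords_def)

lemma bracket_coords: "bracket (coords s) (coords s') = 0 \<longleftrightarrow> s = s'"
  by (cases s; cases s') (auto simp: bracket_def)

text \<open>Moebius transformations of the sphere are linear maps up to rescaling, including all cases with infinity.\<close>

lemma moebius_coords:
  assumes "a * d - b * c \<noteq> 0"
  shows "moebius a b c d s = s' \<longleftrightarrow> (\<exists>m. m \<noteq> 0 \<and> lin a b c d (coords s) = scale m (coords s'))"
proof
  have 1: "c \<noteq> 0 \<or> a \<noteq> 0" using assms by auto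
  have 2: "a * z + b \<noteq> 0" if "c * z + d = 0" for z
  proof
    assume "a * z + b = 0"
    with that have "a * d - b * c = 0" by algebra
    with assms show False by simp
  qed
  assume e: "moebius a b c d s = s'"
  show "\<exists>m. m \<noteq> 0 \<and> lin a b c d (coords s) = scale m (coords s')"
  proof (cases s)
    case None
    then show ?thesis using e 1
      by (intro exI[of _ "if c = 0 then a else c"]) (auto simp: lin_def scale_def)
  next
    case (Some z)
    then show ?thesis using e 2[of z]
      by (intro exI[of _ "if c * z + d = 0 then a * z + b else c * z + d"]) (auto simp: lin_def scale_def)
  qed
next
  assume "\<exists>m. m \<noteq> 0 \<and> lin a b c d (coords s) = scale m (coords s')"
  then show "moebius a b c d s = s'"
    by (cases s; cases s') (auto simp: lin_def scale_def)
qed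

lemma moebius_inj:
  assumes "a * d - b * c \<noteq> 0"
  shows "inj (moebius a b c d)"
proof (rule injI)
  fix s s' assume e: "moebius a b c d s = moebius a b c d s'"
  obtain m where m: "m \<noteq> 0" "lin a b c d (coords s) = scale m (coords (moebius a b c d s))"
    using moebius_coords[OF assms] by blast
  obtain n where n: "n \<noteq> 0" "lin a b c d (coords s') = scale n (coords (moebius a b c d s))"
    using moebius_coords[OF assms] e by metis
  have "(a * d - b * c) * bracket (coords s) (coords s') = 0"
    unfolding bracket_lin[symmetric] m n bracket_scale by (simp add: bracket_coords)
  then show "s = s'" using assms by (simp add: bracket_coords)
qed

abbreviation PF_exponent_difference :: "complex poly \<Rightarrow> complex poly \<Rightarrow> complex option \<Rightarrow> complex \<Rightarrow> bool" where
  "PF_exponent_difference g2 g3 \<equiv> exponent_difference (elim_p (PF_matrix g2 g3)) (elim_q (PF_matrix g2 g3))"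

text \<open>The apparent point, followed by the four singular points in some order, with the parameter belonging to each of them.\<close>

definition fuchsian_data ::
  "complex poly \<Rightarrow> complex poly \<Rightarrow> (nat \<Rightarrow> complex option) \<Rightarrow> (nat \<Rightarrow> complex) \<Rightarrow> bool" where
  "fuchsian_data g2 g3 e \<beta> \<longleftrightarrow> inj_on e {..4} \<and> Some ` apparent_points g2 g3 = {e 0} \<and>
     singular_points g2 g3 = e ` {1..4} \<and>
     (\<forall>i\<in>{1..4}. \<forall>\<kappa>. PF_exponent_difference g2 g3 (e i) \<kappa> \<longleftrightarrow> \<kappa>\<^sup>2 / 2 = \<beta> i)"

text \<open>Every equation that can be normalized satisfies this condition; it excludes the degenerate values of the parameter.\<close>

definition nondegenerate :: "complex poly \<Rightarrow> complex poly \<Rightarrow> bool" where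
  "nondegenerate g2 g3 \<longleftrightarrow> card (singular_points g2 g3) = 4 \<and> (\<exists>z. apparent_points g2 g3 = {z})"

lemma generic_coords:
  assumes "inj_on e {..4}"
  shows "generic_config (coords \<circ> e)"
  using assms by (auto simp: generic_config_def bracket_coords inj_on_def)

lemma normalizes_nondegenerate:
  assumes "a * d - b * c \<noteq> 0" "normalizes g2 g3 (moebius a b c d) l t \<alpha>"
  shows "nondegenerate g2 g3"
proof -
  have "card (moebius a b c d ` singular_points g2 g3) = card (singular_points g2 g3)"
    by (rule card_image) (rule inj_on_subset[OF moebius_inj[OF assms(1)] subset_UNIV])
  moreover have "card {None, Some 0, Some 1, Some t} = 4" if "t \<noteq> 0" "t \<noteq> 1"
    using that by (simp add: card_insert_if)
  ultimately show ?thesis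
    using assms(2) unfolding normalizes_def nondegenerate_def Let_def by auto
qed

text \<open>A normalization sends each singular point to one of \<open>\<infinity>, 0, 1, t\<close>; reading off which one gives \<open>p\<close>.\<close>

lemma normalizes_permutation:
  assumes data: "fuchsian_data g2 g3 e \<beta>"
    and det: "a * d - b * c \<noteq> 0" and norm: "normalizes g2 g3 (moebius a b c d) l t \<alpha>"
  obtains p where "p permutes {1..4}" "(l, t) = normal_form (coords \<circ> e \<circ> p)" "\<alpha> = params_of (\<beta> \<circ> p)"
proof -
  let ?M = "moebius a b c d" and ?ed = "PF_exponent_difference g2 g3"
  have inj: "inj_on e {..4}" and app: "Some ` apparent_points g2 g3 = {e 0}"
    and sing: "singular_points g2 g3 = e ` {1..4}"
    and ex: "\<And>i \<kappa>. i \<in> {1..4} \<Longrightarrow> ?ed (e i) \<kappa> \<Longrightarrow> \<kappa>\<^sup>2 / 2 = \<beta> i"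
    using data by (auto simp: fuchsian_data_def)
  note M = moebius_inj[OF det]
  from norm obtain z sinf s0 s1 st kinf k0 k1 kt where t: "t \<noteq> 0" "t \<noteq> 1"
    and im: "?M ` singular_points g2 g3 = {None, Some 0, Some 1, Some t}"
    and z: "apparent_points g2 g3 = {z}" "?M (Some z) = Some l"
    and s: "?M sinf = None" "?M s0 = Some 0" "?M s1 = Some 1" "?M st = Some t"
    and k: "?ed sinf kinf" "?ed s0 k0" "?ed s1 k1" "?ed st kt"
    and \<alpha>: "\<alpha> = (kinf\<^sup>2 / 2, k0\<^sup>2 / 2, k1\<^sup>2 / 2, kt\<^sup>2 / 2)"
    unfolding normalizes_def Let_def by blast
  have e0: "e 0 = Some z" using app z by auto
  have preimage: "\<exists>i\<in>{1..4}. s' = e i" if "?M s' \<in> {None, Some 0, Some 1, Some t}" for s'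
  proof -
    have "?M s' \<in> ?M ` singular_points g2 g3" unfolding im by (rule that)
    then obtain s'' where s'': "?M s' = ?M s''" "s'' \<in> singular_points g2 g3" by (rule imageE)
    from s''(1) have "s' = s''" by (rule injD[OF M])
    with s''(2) show ?thesis unfolding sing by blast
  qed
  obtain i1 where i1: "i1 \<in> {1..4}" "sinf = e i1" using preimage[of sinf] s by auto
  obtain i2 where i2: "i2 \<in> {1..4}" "s0 = e i2" using preimage[of s0] s by auto
  obtain i3 where i3: "i3 \<in> {1..4}" "s1 = e i3" using preimage[of s1] s by auto
  obtain i4 where i4: "i4 \<in> {1..4}" "st = e i4" using preimage[of st] s by auto
  define p where "p i = (if i = 1 then i1 else if i = 2 then i2 else if i = 3 then i3 else if i = 4 then i4 else i)" for i
  have inj_p: "inj_on p {1..4}"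
    unfolding atLeastAtMost_1_4 using s t i1 i2 i3 i4 by (auto simp: p_def inj_on_def)
  moreover have "p ` {1..4} \<subseteq> {1..4}"
    using i1 i2 i3 i4 unfolding atLeastAtMost_1_4 by (auto simp: p_def)
  ultimately have "p ` {1..4} = {1..4}" by (intro endo_inj_surj) auto
  with inj_p have perm: "p permutes {1..4}"
    by (intro bij_imp_permutes) (auto simp: bij_betw_def p_def)
  have Mp: "?M (e (p i)) = (if i = 0 then Some l else if i = 1 then None else if i = 2 then Some 0
      else if i = 3 then Some 1 else Some t)" if "i \<in> {..4}" for i
    using that e0 z s i1 i2 i3 i4 unfolding atMost_4 by (auto simp: p_def)
  have std: "standard_config (l, t) i = coords (if i = 0 then Some l else if i = 1 then None else if i = 2 then Some 0
      else if i = 3 then Some 1 else Some t)" for i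
    by (simp add: standard_config_def)
  have "\<exists>m. m \<noteq> 0 \<and> lin a b c d ((coords \<circ> e \<circ> p) i) = scale m (standard_config (l, t) i)" if "i \<in> {..4}" for i
    using moebius_coords[OF det, of "e (p i)"] Mp[OF that] unfolding std comp_def by blast
  then obtain m where m: "\<And>i. i \<in> {..4} \<Longrightarrow> m i \<noteq> 0"
    "\<And>i. i \<in> {..4} \<Longrightarrow> lin a b c d ((coords \<circ> e \<circ> p) i) = scale (m i) (standard_config (l, t) i)"
    by metis
  have nf: "normal_form (coords \<circ> e \<circ> p) = normal_form (standard_config (l, t))"
    by (rule normal_form_invariant[OF det m])
  have "Some z \<notin> e ` {1..4}" using inj e0 by (force simp: inj_on_def)
  then have "Some l \<notin> {None, Some 0, Some 1, Some t}"
    using preimage[of "Some z"] z(2) by auto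
  then have "(l, t) \<in> regular_region" using t by (simp add: regular_region_def)
  then have "(l, t) = normal_form (coords \<circ> e \<circ> p)" by (simp add: nf normal_form_standard)
  moreover have "\<alpha> = params_of (\<beta> \<circ> p)"
    using ex k i1 i2 i3 i4 by (simp add: \<alpha> params_of_def p_def)
  ultimately show ?thesis using perm by (intro that)
qed

text \<open>Conversely every numbering is realized, by the explicit linear map of \<open>normalization_exists\<close>.\<close>

lemma normalizes_of_permutation:
  fixes e :: "nat \<Rightarrow> complex option"
  assumes data: "fuchsian_data g2 g3 e \<beta>" and p: "p permutes {1..4}"
  defines "v \<equiv> coords \<circ> e \<circ> p"
  defines "a \<equiv> snd (v 2) * bracket (v 3) (v 1)" and "b \<equiv> - fst (v 2) * bracket (v 3) (v 1)"
    and "c \<equiv> snd (v 1) * bracket (v 3) (v 2)" and "d \<equiv> - fst (v 1) * bracket (v 3) (v 2)"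
  shows "a * d - b * c \<noteq> 0"
    and "normalizes g2 g3 (moebius a b c d) (fst (normal_form v)) (snd (normal_form v)) (params_of (\<beta> \<circ> p))"
proof -
  let ?M = "moebius a b c d" and ?ed = "PF_exponent_difference g2 g3"
  obtain l t where lt: "normal_form v = (l, t)" by (cases "normal_form v")
  have inj: "inj_on e {..4}" and app: "Some ` apparent_points g2 g3 = {e 0}"
    and sing: "singular_points g2 g3 = e ` {1..4}"
    and ex: "\<And>i \<kappa>. i \<in> {1..4} \<Longrightarrow> ?ed (e i) \<kappa> \<longleftrightarrow> \<kappa>\<^sup>2 / 2 = \<beta> i"
    using data by (auto simp: fuchsian_data_def)
  have gen: "generic_config v"
    unfolding v_def by (rule generic_config_permute[OF generic_coords[OF inj] p])
  obtain m where det: "a * d - b * c \<noteq> 0"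
    and m: "\<And>i. i \<in> {..4} \<Longrightarrow> m i \<noteq> 0"
      "\<And>i. i \<in> {..4} \<Longrightarrow> lin a b c d (v i) = scale (m i) (standard_config (l, t) i)"
  proof (rule normalization_exists[OF gen])
    fix a' b' c' d' m
    assume h: "a' * d' - b' * c' \<noteq> 0" "\<And>i. i \<in> {..4} \<Longrightarrow> m i \<noteq> 0"
      "\<And>i. i \<in> {..4} \<Longrightarrow> lin a' b' c' d' (v i) = scale (m i) (standard_config (normal_form v) i)"
      and e: "a' = snd (v 2) * bracket (v 3) (v 1)" "b' = - fst (v 2) * bracket (v 3) (v 1)"
        "c' = snd (v 1) * bracket (v 3) (v 2)" "d' = - fst (v 1) * bracket (v 3) (v 2)"
    show thesis
      by (rule that[OF h[unfolded lt e, folded a_def b_def c_def d_def]])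
  qed
  show "a * d - b * c \<noteq> 0" by (fact det)
  have std: "standard_config (l, t) i = coords (if i = 0 then Some l else if i = 1 then None else if i = 2 then Some 0
      else if i = 3 then Some 1 else Some t)" for i
    by (simp add: standard_config_def)
  have M: "?M (e (p i)) = (if i = 0 then Some l else if i = 1 then None else if i = 2 then Some 0
      else if i = 3 then Some 1 else Some t)" if "i \<in> {..4}" for i
    unfolding moebius_coords[OF det] using m[OF that] unfolding std v_def comp_def by blast
  have M': "?M (e (p 0)) = Some l" "?M (e (p 1)) = None" "?M (e (p 2)) = Some 0"
    "?M (e (p 3)) = Some 1" "?M (e (p 4)) = Some t"
    using M[of 0] M[of 1] M[of 2] M[of 3] M[of 4] by simp_all
  have "(l, t) \<in> regular_region" using normal_form_regular[OF gen] lt by simp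
  then have t: "t \<noteq> 0" "t \<noteq> 1" by (auto simp: regular_region_def)
  have "singular_points g2 g3 = (\<lambda>i. e (p i)) ` {1..4}"
    unfolding sing image_image[of e p, symmetric] permutes_image[OF p] ..
  then have im: "?M ` singular_points g2 g3 = {None, Some 0, Some 1, Some t}"
    unfolding atLeastAtMost_1_4 by (simp add: M')
  from app have "e 0 \<in> Some ` apparent_points g2 g3" by simp
  then obtain z where z0: "e 0 = Some z" "z \<in> apparent_points g2 g3" by (rule imageE)
  have "apparent_points g2 g3 \<subseteq> {z}"
  proof
    fix w assume "w \<in> apparent_points g2 g3"
    then have "Some w \<in> {e 0}" unfolding app[symmetric] by (rule imageI)
    then show "w \<in> {z}" by (simp add: z0(1))
  qed
  with z0 have z: "apparent_points g2 g3 = {z}" "e 0 = Some z" by blast+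
  have p0: "p 0 = 0" by (rule permutes_not_in[OF p]) simp
  have sq: "(csqrt (2 * \<beta> (p i)))\<^sup>2 / 2 = \<beta> (p i)" for i by simp
  have k: "?ed (e (p i)) (csqrt (2 * \<beta> (p i)))" if "i \<in> {1..4}" for i
  proof -
    have "p i \<in> {1..4}" unfolding permutes_in_image[OF p] by (rule that)
    then show ?thesis by (rule ex[THEN iffD2]) (rule sq)
  qed
  have k': "?ed (e (p 1)) (csqrt (2 * \<beta> (p 1)))" "?ed (e (p 2)) (csqrt (2 * \<beta> (p 2)))"
    "?ed (e (p 3)) (csqrt (2 * \<beta> (p 3)))" "?ed (e (p 4)) (csqrt (2 * \<beta> (p 4)))"
    by (rule k; simp)+
  have \<alpha>: "params_of (\<beta> \<circ> p) = ((csqrt (2 * \<beta> (p 1)))\<^sup>2 / 2, (csqrt (2 * \<beta> (p 2)))\<^sup>2 / 2,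
      (csqrt (2 * \<beta> (p 3)))\<^sup>2 / 2, (csqrt (2 * \<beta> (p 4)))\<^sup>2 / 2)"
    by (simp add: params_of_def sq)
  have "normalizes g2 g3 ?M l t (params_of (\<beta> \<circ> p))"
    unfolding normalizes_def Let_def
  proof (intro conjI)
    show "\<exists>z. apparent_points g2 g3 = {z} \<and> ?M (Some z) = Some l"
      using z M'(1) p0 by auto
    show "\<exists>sinf s0 s1 st kinf k0 k1 kt.
         ?M sinf = None \<and> ?M s0 = Some 0 \<and> ?M s1 = Some 1 \<and> ?M st = Some t \<and>
         ?ed sinf kinf \<and> ?ed s0 k0 \<and> ?ed s1 k1 \<and> ?ed st kt \<and>
         params_of (\<beta> \<circ> p) = (kinf\<^sup>2 / 2, k0\<^sup>2 / 2, k1\<^sup>2 / 2, kt\<^sup>2 / 2)"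
      by (intro exI conjI; rule M' k' \<alpha>)
  qed (fact t im)+
  then show "normalizes g2 g3 ?M (fst (normal_form v)) (snd (normal_form v)) (params_of (\<beta> \<circ> p))"
    by (simp add: lt)
qed

section \<open>Zariski closures\<close>

definition bipoly :: "(complex \<Rightarrow> complex \<Rightarrow> complex) \<Rightarrow> bool" where
  "bipoly P \<longleftrightarrow> (\<exists>Q. \<forall>l t. P l t = eval2 Q l t)"

lemma eval2_pCons: "eval2 (pCons p Q) l t = poly p t + l * eval2 Q l t"
  by (simp add: eval2_def)

lemma eval2_0: "eval2 0 l t = 0"
  by (simp add: eval2_def)

lemma poly_poly_eq_eval2: "poly (poly Q r) t = eval2 Q (poly r t) t"
  by (induction Q) (simp_all add: eval2_pCons eval2_0)

lemma bipoly_const: "bipoly (\<lambda>l t. c)"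
  unfolding bipoly_def by (rule exI[of _ "[:[:c:]:]"]) (simp add: eval2_def)

lemma bipoly_fst: "bipoly (\<lambda>l t. l)"
  unfolding bipoly_def by (rule exI[of _ "[:0, 1:]"]) (simp add: eval2_def)

lemma bipoly_snd: "bipoly (\<lambda>l t. t)"
  unfolding bipoly_def by (rule exI[of _ "[:[:0, 1:]:]"]) (simp add: eval2_def)

lemma bipoly_ring:
  assumes "bipoly P" "bipoly Q"
  shows "bipoly (\<lambda>l t. P l t + Q l t)" "bipoly (\<lambda>l t. P l t - Q l t)" "bipoly (\<lambda>l t. P l t * Q l t)"
proof -
  obtain p q where "\<And>l t. P l t = eval2 p l t" "\<And>l t. Q l t = eval2 q l t"
    using assms unfolding bipoly_def by blast
  then have "P l t + Q l t = eval2 (p + q) l t" "P l t - Q l t = eval2 (p - q) l t"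
    "P l t * Q l t = eval2 (p * q) l t" for l t
    by (simp_all add: eval2_def)
  then show "bipoly (\<lambda>l t. P l t + Q l t)" "bipoly (\<lambda>l t. P l t - Q l t)" "bipoly (\<lambda>l t. P l t * Q l t)"
    unfolding bipoly_def by blast+
qed

lemma bipoly_uminus: "bipoly P \<Longrightarrow> bipoly (\<lambda>l t. - P l t)"
  using bipoly_ring(2)[OF bipoly_const[of 0]] by simp

lemma bipoly_power: "bipoly P \<Longrightarrow> bipoly (\<lambda>l t. P l t ^ n)"
  by (induction n) (simp_all add: bipoly_const bipoly_ring)

lemmas bipoly_intros = bipoly_const bipoly_fst bipoly_snd bipoly_ring bipoly_uminus bipoly_power

lemma eval2_holomorphic:
  assumes "u holomorphic_on S" "v holomorphic_on S"
  shows "(\<lambda>s. eval2 Q (u s) (v s)) holomorphic_on S"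
  by (induction Q) (simp_all add: eval2_pCons eval2_0 assms holomorphic_intros)

lemma eval2_continuous:
  assumes "continuous_on S u" "continuous_on S v"
  shows "continuous_on S (\<lambda>s. eval2 Q (u s) (v s))"
  by (induction Q) (simp_all add: eval2_pCons eval2_0 assms continuous_intros)

lemma uncountable_zeros_imp_zero:
  assumes "f holomorphic_on S" "open S" "connected S" "uncountable {s \<in> S. f s = 0}" "s \<in> S"
  shows "f s = 0"
proof -
  obtain C where "\<And>n :: nat. compact (C n)" "\<Union> (C ` UNIV) = S"
    using open_Union_compact_subsets[OF assms(2)] by metis
  then have "fsigma S" using fsigma.intros[of C] compact_imp_closed by metis
  from holomorphic_countable_equal[OF assms(1) holomorphic_on_const[of 0 S] assms(2,3) this assms(4)]
  show ?thesis using assms(5) by blast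
qed

lemma uncountable_open_set: "open (V :: complex set) \<Longrightarrow> V \<noteq> {} \<Longrightarrow> uncountable V"
  by (meson countable_subset ex_in_conv open_contains_ball uncountable_ball)

text \<open>The zero set of a nonzero holomorphic function is countable, and a region is not a countable union of countable sets.\<close>

lemma holomorphic_cover_zero:
  assumes "open V" "connected V" "V \<noteq> {}" "finite L"
    and hol: "\<And>i. i \<in> L \<Longrightarrow> f i holomorphic_on V"
    and cover: "\<And>a. a \<in> V \<Longrightarrow> \<exists>i\<in>L. f i a = 0"
  obtains i where "i \<in> L" "\<And>a. a \<in> V \<Longrightarrow> f i a = (0 :: complex)"
proof -
  have "\<exists>i\<in>L. uncountable {a \<in> V. f i a = 0}"
  proof (rule ccontr)
    assume "\<not> (\<exists>i\<in>L. uncountable {a \<in> V. f i a = 0})"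
    then have "countable {a \<in> V. f i a = 0}" if "i \<in> L" for i using that by blast
    then have "countable (\<Union>i\<in>L. {a \<in> V. f i a = 0})" by (rule countable_UN[OF countable_finite[OF assms(4)]])
    moreover have "V \<subseteq> (\<Union>i\<in>L. {a \<in> V. f i a = 0})" using cover by auto
    ultimately show False using uncountable_open_set[OF assms(1,3)] countable_subset by blast
  qed
  then obtain i where i: "i \<in> L" "uncountable {a \<in> V. f i a = 0}" by blast
  show ?thesis
    by (rule that[OF i(1)]) (rule uncountable_zeros_imp_zero[OF hol[OF i(1)] assms(1,2) i(2)])
qed

text \<open>The pull-back of \<open>Q\<close> to the parameter domain has uncountably many zeros.\<close>

lemma eval2_zero_on_parametrized:
  assumes "open S" "connected S" "u holomorphic_on S" "v holomorphic_on S"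
    and X: "X \<subseteq> (\<lambda>s. (u s, v s)) ` S" "uncountable X" "\<And>l t. (l, t) \<in> X \<Longrightarrow> eval2 Q l t = 0"
    and "s \<in> S"
  shows "eval2 Q (u s) (v s) = 0"
proof (rule uncountable_zeros_imp_zero[OF eval2_holomorphic[OF assms(3,4)] assms(1,2) _ \<open>s \<in> S\<close>])
  show "uncountable {s \<in> S. eval2 Q (u s) (v s) = 0}"
  proof
    assume c: "countable {s \<in> S. eval2 Q (u s) (v s) = 0}"
    have "X \<subseteq> (\<lambda>s. (u s, v s)) ` {s \<in> S. eval2 Q (u s) (v s) = 0}"
      using X(1,3) by force
    then show False using X(2) countable_subset[OF _ countable_image[OF c]] by blast
  qed
qed

text \<open>By the theorem of Hurwitz the roots of \<open>P\<close> in \<open>\<lambda>\<close> depend continuously on \<open>t\<close>, so a point of the curve is a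
  limit of points of the curve over nearby values of \<open>t\<close>. For all but finitely many \<open>t\<close> the latter are regular: the
  polynomials \<open>P(0, t)\<close>, \<open>P(1, t)\<close>, \<open>P(t, t)\<close> do not vanish at \<open>t = 3\<close>, hence have finitely many roots.\<close>

lemma regular_points_dense:
  assumes P: "bipoly P" and sep: "\<And>t. \<exists>l. P l t \<noteq> 0"
    and bd: "P 0 3 \<noteq> 0" "P 1 3 \<noteq> 0" "P 3 3 \<noteq> 0"
    and Q: "\<And>l t. (l, t) \<in> curve P \<inter> regular_region \<Longrightarrow> eval2 Q l t = 0"
    and lt: "P l t = 0"
  shows "eval2 Q l t = 0"
proof (rule ccontr)
  assume ne: "eval2 Q l t \<noteq> 0"
  obtain p where p: "\<And>l t. P l t = eval2 p l t" using P unfolding bipoly_def by blast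
  define T where "T = {t. t = 0 \<or> t = 1 \<or> P 0 t = 0 \<or> P 1 t = 0 \<or> P t t = 0}"
  have fin: "finite {t. P (poly r t) t = 0}" if "P (poly r 3) 3 \<noteq> 0" for r
  proof -
    have "poly p r \<noteq> 0" using that unfolding p poly_poly_eq_eval2[symmetric] by auto
    then show ?thesis unfolding p poly_poly_eq_eval2[symmetric] by (rule poly_roots_finite)
  qed
  have "finite {t. P 0 t = 0}" "finite {t. P 1 t = 0}" "finite {t. P t t = 0}"
    using fin[of 0] fin[of 1] fin[of "[:0, 1:]"] bd by simp_all
  moreover have "T = {0, 1} \<union> {t. P 0 t = 0} \<union> {t. P 1 t = 0} \<union> {t. P t t = 0}"
    by (auto simp: T_def)
  ultimately have "finite T" by simp
  have "t islimpt UNIV" by simp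
  then have "t islimpt (T \<union> - T)" by simp
  then have "t islimpt - T" by (simp only: islimpt_Un_finite[OF \<open>finite T\<close>])
  moreover have cont: "continuous_on UNIV (\<lambda>x. eval2 Q (fst x) (snd x))" for Q
    by (intro eval2_continuous continuous_intros)
  then have "open {x. eval2 Q (fst x) (snd x) \<noteq> 0}"
    by (rule open_Collect_neq) (rule continuous_on_const)
  then obtain A B where AB: "open A" "open B" "(l, t) \<in> A \<times> B" "A \<times> B \<subseteq> {x. eval2 Q (fst x) (snd x) \<noteq> 0}"
    using ne by (auto elim!: open_prod_elim)
  ultimately have "t islimpt (- T \<inter> B)" using islimpt_Int_eventually[of t "- T" B] AB eventually_at_topological by (metis mem_Times_iff snd_conv)
  then obtain \<tau> where \<tau>: "\<And>n :: nat. \<tau> n \<in> - T \<inter> B - {t}" "\<tau> \<longlonglongrightarrow> t"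
    unfolding islimpt_sequential by blast
  obtain r where r: "r > 0" "ball l r \<subseteq> A" using AB openE by blast
  have "P l t \<noteq> 0"
  proof (rule Hurwitz_no_zeros[where S = "ball l r" and g = "\<lambda>l. P l t" and ?z0.0 = l and \<F> = "\<lambda>n l. P l (\<tau> n)"])
    show "(\<lambda>l. P l (\<tau> n)) holomorphic_on ball l r" for n
      unfolding p by (intro eval2_holomorphic holomorphic_intros)
    show "(\<lambda>l. P l t) holomorphic_on ball l r"
      unfolding p by (intro eval2_holomorphic holomorphic_intros)
    show "P l' (\<tau> n) \<noteq> 0" if "l' \<in> ball l r" for n l'
    proof
      assume 0: "P l' (\<tau> n) = 0"
      then have "(l', \<tau> n) \<in> curve P \<inter> regular_region"
        using \<tau>(1)[of n] by (auto simp: curve_def regular_region_def T_def)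
      then have "eval2 Q l' (\<tau> n) = 0" by (rule Q)
      moreover have "(l', \<tau> n) \<in> A \<times> B" using \<tau>(1)[of n] r that by auto
      ultimately show False using AB(4) by auto
    qed
    show "\<not> (\<lambda>l. P l t) constant_on ball l r"
    proof
      assume "(\<lambda>l. P l t) constant_on ball l r"
      then have "P l' t = 0" if "l' \<in> ball l r" for l'
        using that lt r unfolding constant_on_def by (metis centre_in_ball)
      then have "ball l r \<subseteq> {l' \<in> UNIV. P l' t = 0}" by blast
      then have "uncountable {l' \<in> UNIV. P l' t = 0}"
        using uncountable_ball[OF r(1), of l] countable_subset by blast
      moreover have "(\<lambda>l. P l t) holomorphic_on UNIV"
        unfolding p by (intro eval2_holomorphic holomorphic_intros)
      ultimately have "P l' t = 0" for l'
        using uncountable_zeros_imp_zero[of "\<lambda>l. P l t" UNIV l'] connected_UNIV by simp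
      moreover obtain l' where "P l' t \<noteq> 0" using sep by blast
      ultimately show False by simp
    qed
    show "uniform_limit K (\<lambda>n l. P l (\<tau> n)) (\<lambda>l. P l t) sequentially" if K: "compact K" "K \<subseteq> ball l r" for K
    proof (rule uniform_limitI)
      fix \<epsilon> :: real assume \<epsilon>: "\<epsilon> > 0"
      have "compact (K \<times> cball t 1)" using K by (intro compact_Times) auto
      moreover have "continuous_on (K \<times> cball t 1) (\<lambda>x. P (fst x) (snd x))"
        unfolding p by (rule continuous_on_subset[OF cont]) simp
      ultimately have "uniformly_continuous_on (K \<times> cball t 1) (\<lambda>x. P (fst x) (snd x))"
        by (intro compact_uniformly_continuous)
      then obtain d where d: "d > 0" "\<And>x y. x \<in> K \<times> cball t 1 \<Longrightarrow> y \<in> K \<times> cball t 1 \<Longrightarrow> dist y x < d \<Longrightarrow>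
          dist (P (fst y) (snd y)) (P (fst x) (snd x)) < \<epsilon>"
        using \<epsilon> unfolding uniformly_continuous_on_def by metis
      have "\<forall>\<^sub>F n in sequentially. dist (\<tau> n) t < min d 1"
        using \<tau>(2) d(1) by (intro tendstoD) auto
      then show "\<forall>\<^sub>F n in sequentially. \<forall>x\<in>K. dist (P x (\<tau> n)) (P x t) < \<epsilon>"
      proof eventually_elim
        case (elim n)
        show ?case
        proof
          fix x assume "x \<in> K"
          then show "dist (P x (\<tau> n)) (P x t) < \<epsilon>"
            using d(2)[of "(x, t)" "(x, \<tau> n)"] elim by (simp add: dist_Pair_Pair dist_commute)
        qed
      qed
    qed
  qed (use r in simp_all)
  with lt show False by simp
qed

lemma normal_form_holomorphic:
  assumes gen: "\<And>s. s \<in> S \<Longrightarrow> generic_config (w s)"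
    and hol: "\<And>i. i \<in> {..4} \<Longrightarrow> (\<lambda>s. fst (w s i)) holomorphic_on S" "\<And>i. i \<in> {..4} \<Longrightarrow> (\<lambda>s. snd (w s i)) holomorphic_on S"
  shows "(\<lambda>s. fst (normal_form (w s))) holomorphic_on S" "(\<lambda>s. snd (normal_form (w s))) holomorphic_on S"
proof -
  have b: "(\<lambda>s. bracket (w s i) (w s j)) holomorphic_on S" if "i \<in> {..4}" "j \<in> {..4}" for i j
    unfolding bracket_def by (intro holomorphic_intros hol that)
  have nz: "bracket (w s i) (w s j) \<noteq> 0" if "s \<in> S" "i \<in> {..4}" "j \<in> {..4}" "i \<noteq> j" for s i j
    using gen[OF that(1)] that by (auto simp: generic_config_def)
  show "(\<lambda>s. fst (normal_form (w s))) holomorphic_on S" "(\<lambda>s. snd (normal_form (w s))) holomorphic_on S"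
    unfolding normal_form_def fst_conv snd_conv
    by (intro holomorphic_on_mult holomorphic_on_divide b; simp add: nz)+
qed

lemma act_holomorphic:
  assumes "u holomorphic_on S" "v holomorphic_on S" "\<And>s. s \<in> S \<Longrightarrow> (u s, v s) \<in> regular_region" "p permutes {1..4}"
  shows "(\<lambda>s. fst (act p (u s, v s))) holomorphic_on S" "(\<lambda>s. snd (act p (u s, v s))) holomorphic_on S"
proof -
  have gen: "generic_config (standard_config (u s, v s) \<circ> inv' p)" if "s \<in> S" for s
    using assms(3)[OF that] assms(4) by (intro generic_config_permute permutes_inv) (simp_all add: generic_standard_config)
  have hol: "(\<lambda>s. fst ((standard_config (u s, v s) \<circ> inv' p) i)) holomorphic_on S"
    "(\<lambda>s. snd ((standard_config (u s, v s) \<circ> inv' p) i)) holomorphic_on S" for i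
    using assms(1,2)
    by (cases "inv' p i = 0"; cases "inv' p i = 1"; cases "inv' p i = 2"; cases "inv' p i = 3";
        simp add: standard_config_def)+
  show "(\<lambda>s. fst (act p (u s, v s))) holomorphic_on S" "(\<lambda>s. snd (act p (u s, v s))) holomorphic_on S"
    unfolding act_def by (rule normal_form_holomorphic[OF gen hol]; assumption)+
qed

text \<open>The value \<open>3\<close> is a convenient witness that the curve contains none of the lines \<open>\<lambda> = 0\<close>, \<open>\<lambda> = 1\<close>, \<open>\<lambda> = t\<close>.\<close>

locale curve_family = label_family +
  assumes polynomial: "\<lbrakk>i \<in> {1..4}; j \<in> {1..4}; i \<noteq> j\<rbrakk> \<Longrightarrow> bipoly (P i j)"
    and separated: "\<lbrakk>i \<in> {1..4}; j \<in> {1..4}; i \<noteq> j\<rbrakk> \<Longrightarrow> \<exists>l. P i j l t \<noteq> 0"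
    and boundary: "\<lbrakk>i \<in> {1..4}; j \<in> {1..4}; i \<noteq> j\<rbrakk> \<Longrightarrow> P i j 0 3 \<noteq> 0 \<and> P i j 1 3 \<noteq> 0 \<and> P i j 3 3 \<noteq> 0"
    and parametrized: "rational_curve (curve (P 1 4))"
begin

text \<open>The parametrization of the reference curve is moved to the label \<open>(i, j)\<close> by a permutation.\<close>

lemma closure_uncountable:
  assumes ij: "i \<in> {1..4}" "j \<in> {1..4}" "i \<noteq> j"
    and X: "X \<subseteq> curve (P i j) \<inter> regular_region" "uncountable X"
  shows "zariski_closure X = curve (P i j)"
proof -
  obtain S u v where S: "open S" "connected S" and uv: "u holomorphic_on S" "v holomorphic_on S"
    and par: "curve (P 1 4) \<inter> regular_region = (\<lambda>s. (u s, v s)) ` S"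
    using parametrized unfolding rational_curve_def by blast
  obtain q where q: "q permutes {1..4}" "q 1 = i" "q 4 = j" by (rule permutes_4_transitive[OF ij])
  have reg: "(u s, v s) \<in> regular_region" if "s \<in> S" for s
    using par that by blast
  have img: "curve (P i j) \<inter> regular_region = (\<lambda>s. (fst (act q (u s, v s)), snd (act q (u s, v s)))) ` S"
    using curve_image[OF q(1), of 1 4] unfolding par q(2,3) image_image by simp
  note hol = act_holomorphic[OF uv reg q(1)]
  have dense: "eval2 Q l t = 0" if Q: "\<And>l t. (l, t) \<in> X \<Longrightarrow> eval2 Q l t = 0" and lt: "P i j l t = 0" for Q l t
  proof (rule regular_points_dense[OF polynomial[OF ij] separated[OF ij] _ _ _ _ lt])
    fix l t assume "(l, t) \<in> curve (P i j) \<inter> regular_region"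
    then obtain s where "s \<in> S" "(l, t) = act q (u s, v s)"
      unfolding img by auto
    then have s: "s \<in> S" "l = fst (act q (u s, v s))" "t = snd (act q (u s, v s))"
      by (metis fst_conv snd_conv)+
    show "eval2 Q l t = 0"
      unfolding s(2,3) using X unfolding img by (intro eval2_zero_on_parametrized[OF S hol _ X(2) Q s(1)])
  qed (use boundary[OF ij] in simp_all)
  obtain p where p: "\<And>l t. P i j l t = eval2 p l t" using polynomial[OF ij] unfolding bipoly_def by blast
  show ?thesis
  proof (intro subset_antisym subrelI)
    fix l t assume lt: "(l, t) \<in> zariski_closure X"
    have "eval2 p l' t' = 0" if "(l', t') \<in> X" for l' t'
      using that X(1) by (auto simp: p[symmetric] curve_def)
    with lt have "eval2 p l t = 0" by (auto simp: zariski_closure_def)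
    then show "(l, t) \<in> curve (P i j)" by (simp add: curve_def p)
  next
    fix l t assume "(l, t) \<in> curve (P i j)"
    then have lt: "P i j l t = 0" by (simp add: curve_def)
    have "eval2 Q l t = 0" if Q: "\<forall>(l', t')\<in>X. eval2 Q l' t' = 0" for Q
      by (rule dense[OF _ lt]) (use Q in blast)
    then show "(l, t) \<in> zariski_closure X"
      by (simp add: zariski_closure_def)
  qed
qed

end

text \<open>If \<open>a\<close> is determined by \<open>f a\<close> up to finitely many choices, \<open>f\<close> has finite fibres.\<close>

lemma uncountable_image_act:
  fixes f :: "complex \<Rightarrow> complex \<times> complex"
  assumes V: "open V" "V \<noteq> {}" and fin: "\<And>x. finite (rec x)"
    and f: "\<And>a. a \<in> V \<Longrightarrow> \<exists>p. p permutes {1..4} \<and> a \<in> rec (act p (f a))"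
  shows "uncountable (f ` V)"
proof
  assume "countable (f ` V)"
  then have "countable (\<Union>x \<in> f ` V. \<Union>p \<in> {p. p permutes {1..4}}. rec (act p x))"
    by (rule countable_UN) (intro countable_finite finite_UN_I fin finite_permutations; simp)
  moreover have "V \<subseteq> (\<Union>x \<in> f ` V. \<Union>p \<in> {p. p permutes {1..4}}. rec (act p x))"
    using f by fastforce
  ultimately show False using uncountable_open_set[OF V] countable_subset by blast
qed

context curve_family begin

text \<open>It suffices to know a single numbering \<open>e\<close> of the singular points of each equation. Then the numbering used by a
  given family of normalizations may vary with \<open>a\<close>, but only finitely many labels are possible, and one of
  them serves the whole region. Conversely, over \<open>V\<close> every label is obtained by permuting \<open>e\<close>.\<close>

theorem comes_from_deformation_iff:
  fixes e :: "complex \<Rightarrow> nat \<Rightarrow> complex option"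
  assumes ij0: "ia \<in> {1..4}" "ja \<in> {1..4}" "ia \<noteq> ja"
    and data: "\<And>a. nondegenerate (g2 a) (g3 a) \<Longrightarrow> fuchsian_data (g2 a) (g3 a) (e a) (\<beta> ia ja)"
    and on_curve: "\<And>a. nondegenerate (g2 a) (g3 a) \<Longrightarrow> normal_form (coords \<circ> e a) \<in> curve (P ia ja)"
    and recover: "\<And>a. nondegenerate (g2 a) (g3 a) \<Longrightarrow> a \<in> rec (normal_form (coords \<circ> e a))" "\<And>x. finite (rec x)"
    and V: "open V" "connected V" "V \<noteq> {}" "\<And>a. a \<in> V \<Longrightarrow> nondegenerate (g2 a) (g3 a)"
    and hol: "\<And>i. i \<in> {..4} \<Longrightarrow> (\<lambda>a. fst (coords (e a i))) holomorphic_on V"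
      "\<And>i. i \<in> {..4} \<Longrightarrow> (\<lambda>a. snd (coords (e a i))) holomorphic_on V"
  shows "comes_from_deformation g2 g3 C \<alpha> \<longleftrightarrow> (C, \<alpha>) \<in> solutions"
proof
  have inj: "inj_on (e a) {..4}" if "nondegenerate (g2 a) (g3 a)" for a
    using data[OF that] by (simp add: fuchsian_data_def)
  have reg: "normal_form (coords \<circ> e a) \<in> regular_region" if "nondegenerate (g2 a) (g3 a)" for a
    by (rule normal_form_regular[OF generic_coords[OF inj[OF that]]])
  {
    assume "comes_from_deformation g2 g3 C \<alpha>"
    then obtain W A B E F l t where h: "open W \<and> connected W \<and> W \<noteq> {} \<and>
        A holomorphic_on W \<and> B holomorphic_on W \<and> E holomorphic_on W \<and> F holomorphic_on W \<and>
        l holomorphic_on W \<and> t holomorphic_on W \<and>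
        (\<forall>a\<in>W. A a * F a - B a * E a \<noteq> 0 \<and>
          normalizes (g2 a) (g3 a) (moebius (A a) (B a) (E a) (F a)) (l a) (t a) \<alpha>) \<and>
        C = zariski_closure ((\<lambda>a. (l a, t a)) ` W)"
      unfolding comes_from_deformation_def by (elim exE) (rule that)
    from h have W: "open W" "connected W" "W \<noteq> {}" and lt: "l holomorphic_on W" "t holomorphic_on W"
      and C: "C = zariski_closure ((\<lambda>a. (l a, t a)) ` W)"
      by simp_all
    from h have all: "\<forall>a\<in>W. A a * F a - B a * E a \<noteq> 0 \<and>
          normalizes (g2 a) (g3 a) (moebius (A a) (B a) (E a) (F a)) (l a) (t a) \<alpha>"
      by simp
    have det: "A a * F a - B a * E a \<noteq> 0"
      and norm: "normalizes (g2 a) (g3 a) (moebius (A a) (B a) (E a) (F a)) (l a) (t a) \<alpha>" if "a \<in> W" for a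
      using bspec[OF all that] by simp_all
    have nd: "nondegenerate (g2 a) (g3 a)" if "a \<in> W" for a
      by (rule normalizes_nondegenerate[OF det[OF that] norm[OF that]])
    have perm: "\<exists>q. q permutes {1..4} \<and> (l a, t a) = act q (normal_form (coords \<circ> e a)) \<and>
        \<alpha> = params_of (\<beta> (q ia) (q ja))" if a: "a \<in> W" for a
    proof -
      obtain p where p: "p permutes {1..4}" "(l a, t a) = normal_form (coords \<circ> e a \<circ> p)" "\<alpha> = params_of (\<beta> ia ja \<circ> p)"
        by (rule normalizes_permutation[OF data[OF nd[OF a]] det[OF a] norm[OF a]])
      note p' = permutes_inv[OF p(1)] permutes_inv_inv[OF p(1)]
      have "(l a, t a) = act (inv' p) (normal_form (coords \<circ> e a))"
        using act_normal_form[OF generic_coords[OF inj[OF nd[OF a]]] p'(1)] p(2) p'(2) by simp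
      moreover have "\<alpha> = params_of (\<beta> (inv' p ia) (inv' p ja))"
        using permute_params_family[OF p'(1), of ia ja] permute_params_of[OF p'(1), of "\<beta> ia ja"] p(3) p'(2) by simp
      ultimately show ?thesis using p'(1) by blast
    qed
    define L where "L = {(i, j). i \<in> {1..4} \<and> j \<in> {1..4} \<and> i \<noteq> j \<and> \<alpha> = params_of (\<beta> i j)}"
    have "finite L" by (rule finite_subset[of _ "{1..4} \<times> {1..4}"]) (auto simp: L_def)
    moreover have "\<exists>x\<in>L. P (fst x) (snd x) (l a) (t a) = 0" if a: "a \<in> W" for a
    proof -
      obtain q where q: "q permutes {1..4}" "(l a, t a) = act q (normal_form (coords \<circ> e a))" "\<alpha> = params_of (\<beta> (q ia) (q ja))"
        using perm[OF a] by blast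
      have "(l a, t a) \<in> curve (P (q ia) (q ja))"
        unfolding q(2) on_curve_act[OF q(1) reg[OF nd[OF a]] ij0] by (rule on_curve[OF nd[OF a]])
      then have "P (q ia) (q ja) (l a) (t a) = 0" by (simp add: curve_def)
      moreover have "(q ia, q ja) \<in> L" unfolding L_def using permutes_label[OF q(1) ij0] q(3) by simp
      ultimately show ?thesis by force
    qed
    moreover have "(\<lambda>a. P (fst x) (snd x) (l a) (t a)) holomorphic_on W" if "x \<in> L" for x
    proof -
      obtain p where p: "\<And>l t. P (fst x) (snd x) l t = eval2 p l t"
        using polynomial[of "fst x" "snd x"] \<open>x \<in> L\<close> unfolding bipoly_def L_def by auto
      show ?thesis unfolding p by (rule eval2_holomorphic[OF lt])
    qed
    ultimately obtain x where x: "x \<in> L" "\<And>a. a \<in> W \<Longrightarrow> P (fst x) (snd x) (l a) (t a) = 0"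
      using holomorphic_cover_zero[OF W, where L = L and f = "\<lambda>x a. P (fst x) (snd x) (l a) (t a)"] by blast
    obtain i j where ij: "x = (i, j)" "i \<in> {1..4}" "j \<in> {1..4}" "i \<noteq> j" "\<alpha> = params_of (\<beta> i j)"
      using x(1) by (auto simp: L_def)
    have sub: "(\<lambda>a. (l a, t a)) ` W \<subseteq> curve (P i j) \<inter> regular_region"
    proof
      fix y assume "y \<in> (\<lambda>a. (l a, t a)) ` W"
      then obtain a where a: "a \<in> W" "y = (l a, t a)" by blast
      obtain q where q: "q permutes {1..4}" "(l a, t a) = act q (normal_form (coords \<circ> e a))"
        using perm[OF a(1)] by blast
      show "y \<in> curve (P i j) \<inter> regular_region"
        using x(2)[OF a(1)] act_regular[OF reg[OF nd[OF a(1)]] q(1)] by (simp add: a(2) curve_def ij(1) q(2)[symmetric])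
    qed
    have "uncountable ((\<lambda>a. (l a, t a)) ` W)"
    proof (rule uncountable_image_act[OF W(1,3) recover(2)])
      fix a assume a: "a \<in> W"
      obtain q where q: "q permutes {1..4}" "(l a, t a) = act q (normal_form (coords \<circ> e a))"
        using perm[OF a] by blast
      have "act (inv' q) (l a, t a) = normal_form (coords \<circ> e a)"
        unfolding q(2) by (rule act_inverse[OF reg[OF nd[OF a]] q(1)])
      then show "\<exists>p. p permutes {1..4} \<and> a \<in> rec (act p (l a, t a))"
        using recover(1)[OF nd[OF a]] permutes_inv[OF q(1)] by auto
    qed
    from closure_uncountable[OF ij(2-4) sub this] show "(C, \<alpha>) \<in> solutions"
      using ij unfolding C solutions_def by blast
  }
  {
    assume "(C, \<alpha>) \<in> solutions"
    then obtain i j where ij: "i \<in> {1..4}" "j \<in> {1..4}" "i \<noteq> j" and C: "C = curve (P i j)"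
      and \<alpha>: "\<alpha> = params_of (\<beta> i j)" by (rule solutions_cases)
    obtain p1 where p1: "p1 permutes {1..4}" "p1 1 = ia" "p1 4 = ja" by (rule permutes_4_transitive[OF ij0])
    obtain p2 where p2: "p2 permutes {1..4}" "p2 1 = i" "p2 4 = j" by (rule permutes_4_transitive[OF ij])
    define p where "p = p1 \<circ> inv' p2"
    have p: "p permutes {1..4}" unfolding p_def by (intro permutes_compose permutes_inv p1 p2)
    have "p i = ia" "p j = ja"
      using p1 p2 permutes_inverses(2)[OF p2(1)] unfolding p_def by auto
    then have q: "inv' p permutes {1..4}" "inv' p ia = i" "inv' p ja = j" "inv' (inv' p) = p"
      using permutes_inverses(2)[OF p] permutes_inv[OF p] permutes_inv_inv[OF p] by auto
    define v where "v a = coords \<circ> e a \<circ> p" for a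
    have nf: "normal_form (v a) = act (inv' p) (normal_form (coords \<circ> e a))" if "a \<in> V" for a
      using act_normal_form[OF generic_coords[OF inj[OF V(4)[OF that]]] q(1)] q(4) by (simp add: v_def)
    have gen: "generic_config (v a)" if "a \<in> V" for a
      unfolding v_def by (rule generic_config_permute[OF generic_coords[OF inj[OF V(4)[OF that]]] p])
    have hv: "(\<lambda>a. fst (v a k)) holomorphic_on V" "(\<lambda>a. snd (v a k)) holomorphic_on V" if "k \<in> {..4}" for k
      unfolding v_def comp_def using that permutes_in_image[OF permutes_atMost_4[OF p], of k] by (intro hol; simp)+
    have \<alpha>': "params_of (\<beta> ia ja \<circ> p) = \<alpha>"
      using permute_params_family[OF q(1), of ia ja] permute_params_of[OF q(1), of "\<beta> ia ja"] unfolding q \<alpha> by simp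
    let ?A = "\<lambda>a. snd (v a 2) * bracket (v a 3) (v a 1)" and ?B = "\<lambda>a. - fst (v a 2) * bracket (v a 3) (v a 1)"
      and ?E = "\<lambda>a. snd (v a 1) * bracket (v a 3) (v a 2)" and ?F = "\<lambda>a. - fst (v a 1) * bracket (v a 3) (v a 2)"
    let ?f = "\<lambda>a. (fst (normal_form (v a)), snd (normal_form (v a)))"
    have norm: "?A a * ?F a - ?B a * ?E a \<noteq> 0"
      "normalizes (g2 a) (g3 a) (moebius (?A a) (?B a) (?E a) (?F a)) (fst (normal_form (v a))) (snd (normal_form (v a))) \<alpha>"
      if "a \<in> V" for a
      using normalizes_of_permutation[OF data[OF V(4)[OF that]] p] unfolding v_def \<alpha>' by blast+
    have sub: "?f ` V \<subseteq> curve (P i j) \<inter> regular_region"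
    proof
      fix y assume "y \<in> ?f ` V"
      then obtain a where a: "a \<in> V" "y = normal_form (v a)" by auto
      have "y \<in> curve (P (inv' p ia) (inv' p ja))"
        unfolding a(2) nf[OF a(1)] on_curve_act[OF q(1) reg[OF V(4)[OF a(1)]] ij0] by (rule on_curve[OF V(4)[OF a(1)]])
      then show "y \<in> curve (P i j) \<inter> regular_region"
        using normal_form_regular[OF gen[OF a(1)]] unfolding q a(2) by simp
    qed
    have "uncountable (?f ` V)"
    proof (rule uncountable_image_act[OF V(1,3) recover(2)])
      fix a assume a: "a \<in> V"
      have "act p (act (inv' p) (normal_form (coords \<circ> e a))) = normal_form (coords \<circ> e a)"
        by (rule act_inverse(1)[OF reg[OF V(4)[OF a]] p])
      then have "act p (?f a) = normal_form (coords \<circ> e a)" by (simp add: nf[OF a])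
      then show "\<exists>p. p permutes {1..4} \<and> a \<in> rec (act p (?f a))"
        using recover(1)[OF V(4)[OF a]] p by auto
    qed
    from closure_uncountable[OF ij sub this] have C': "C = zariski_closure (?f ` V)" by (simp add: C)
    have hol_coeffs: "?A holomorphic_on V" "?B holomorphic_on V" "?E holomorphic_on V" "?F holomorphic_on V"
      unfolding bracket_def by (intro holomorphic_intros hv; simp)+
    have hol_nf: "(\<lambda>a. fst (normal_form (v a))) holomorphic_on V" "(\<lambda>a. snd (normal_form (v a))) holomorphic_on V"
      by (rule normal_form_holomorphic[OF gen hv]; assumption)+
    show "comes_from_deformation g2 g3 C \<alpha>"
      unfolding comes_from_deformation_def
      by (intro exI[of _ V] exI[of _ ?A] exI[of _ ?B] exI[of _ ?E] exI[of _ ?F]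
          exI[of _ "\<lambda>a. fst (normal_form (v a))"] exI[of _ "\<lambda>a. snd (normal_form (v a))"]
          conjI ballI V(1-3) hol_coeffs hol_nf norm C'; assumption)
  }
qed

end

section \<open>Factored discriminants\<close>

text \<open>In all five deformations \<open>0\<close> and \<open>\<infinity>\<close> are singular, so only the other two singular points vary.\<close>

definition points :: "complex \<Rightarrow> complex \<Rightarrow> complex \<Rightarrow> nat \<Rightarrow> complex option" where
  "points z r r' i = (if i = 0 then Some z else if i = 1 then None else if i = 2 then Some 0
     else if i = 3 then Some r else Some r')"

lemma points_simps: "points z r r' 0 = Some z" "points z r r' 1 = None" "points z r r' 2 = Some 0"
  "points z r r' 3 = Some r" "points z r r' 4 = Some r'"
  by (simp_all add: points_def)

lemma points_image: "points z r r' ` {1..4} = {None, Some 0, Some r, Some r'}"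
  unfolding atLeastAtMost_1_4 by (simp add: points_simps)

lemma points_inj:
  "inj_on (points z r r') {..4} \<longleftrightarrow> z \<noteq> 0 \<and> z \<noteq> r \<and> z \<noteq> r' \<and> r \<noteq> 0 \<and> r' \<noteq> 0 \<and> r \<noteq> r'"
  unfolding atMost_4 by (auto simp: points_simps)

lemma normal_form_points: "normal_form (coords \<circ> points z r r') = (z / r, r' / r)"
  by (simp add: normal_form_def points_simps bracket_def)

lemma fuchsian_data_points:
  assumes inj: "z \<noteq> 0" "z \<noteq> r" "z \<noteq> r'" "r \<noteq> 0" "r' \<noteq> 0" "r \<noteq> r'"
    and D: "\<And>w. poly (disc_poly g2 g3) w = 0 \<longleftrightarrow> w = 0 \<or> w = r \<or> w = r'"
    and \<delta>: "\<And>w. poly (delta_poly g2 g3) w = 0 \<longleftrightarrow> w = z \<or> (w \<in> E \<and> (w = 0 \<or> w = r \<or> w = r'))"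
    and ex: "\<And>\<kappa>. PF_exponent_difference g2 g3 None \<kappa> \<longleftrightarrow> \<kappa>\<^sup>2 = 2 * \<beta> 1"
      "\<And>\<kappa>. PF_exponent_difference g2 g3 (Some 0) \<kappa> \<longleftrightarrow> \<kappa>\<^sup>2 = 2 * \<beta> 2"
      "\<And>\<kappa>. PF_exponent_difference g2 g3 (Some r) \<kappa> \<longleftrightarrow> \<kappa>\<^sup>2 = 2 * \<beta> 3"
      "\<And>\<kappa>. PF_exponent_difference g2 g3 (Some r') \<kappa> \<longleftrightarrow> \<kappa>\<^sup>2 = 2 * \<beta> 4"
  shows "fuchsian_data g2 g3 (points z r r') \<beta>"
proof -
  have "apparent_points g2 g3 = {z}"
    unfolding apparent_points_def D \<delta> using inj by blast
  moreover have "singular_points g2 g3 = {None, Some 0, Some r, Some r'}"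
    unfolding singular_points_def D by blast
  moreover have "\<kappa>\<^sup>2 / 2 = b \<longleftrightarrow> \<kappa>\<^sup>2 = 2 * b" for \<kappa> b :: complex by (simp add: divide_eq_eq mult.commute)
  ultimately show ?thesis
    unfolding fuchsian_data_def points_image points_inj using inj ex
    unfolding atLeastAtMost_1_4 by (simp add: points_simps)
qed

lemma fuchsian_data_nondegenerate:
  assumes "fuchsian_data g2 g3 e \<beta>"
  shows "nondegenerate g2 g3"
proof -
  have "inj_on e {1..4}" using assms by (auto simp: fuchsian_data_def inj_on_def)
  from card_image[OF this] have "card (singular_points g2 g3) = 4"
    using assms by (simp add: fuchsian_data_def)
  moreover have *: "Some ` apparent_points g2 g3 = {e 0}" using assms by (simp add: fuchsian_data_def)
  then have "card (apparent_points g2 g3) = 1"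
    using card_image[of Some "apparent_points g2 g3"] by simp
  ultimately show ?thesis unfolding nondegenerate_def by (metis card_1_singletonE)
qed

lemma degree_coeff_times_power:
  fixes f q :: "complex poly"
  assumes "\<And>w. poly f w = w ^ m * poly q w" "degree q \<le> d"
  shows "degree f \<le> m + d" "coeff f (m + d) = coeff q d"
proof -
  have f: "f = monom 1 m * q" by (rule poly_ext) (simp add: poly_monom assms(1))
  show "degree f \<le> m + d"
    unfolding f by (rule order_trans[OF degree_mult_le]) (use assms(2) in \<open>simp add: degree_monom_eq\<close>)
  show "coeff f (m + d) = coeff q d" unfolding f by (simp add: coeff_monom_mult)
qed

lemma pderiv_at_root:
  fixes f h :: "complex poly"
  assumes "\<And>w. poly f w = (w - r) * poly h w"
  shows "poly f r = 0" "poly (pderiv f) r = poly h r"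
proof -
  have f: "f = [:- r, 1:] * h" by (rule poly_ext) (simp add: assms algebra_simps)
  show "poly f r = 0" by (simp add: assms)
  show "poly (pderiv f) r = poly h r" unfolding f pderiv_mult by (simp add: pderiv_pCons)
qed

text \<open>Apart from the multiple root \<open>0\<close>, the polynomial \<open>\<triangle>\<close> has two simple roots, with parameter \<open>1/8\<close> each.\<close>

lemma fuchsian_data_two_roots:
  assumes inj: "z \<noteq> 0" "z \<noteq> r" "z \<noteq> r'" "r \<noteq> 0" "r' \<noteq> 0" "r \<noteq> r'"
    and D: "\<And>w. poly (disc_poly g2 g3) w = c * w^m * ((w - r) * (w - r'))"
    and \<delta>: "\<And>w. poly (delta_poly g2 g3) w = d * w^n * (w - z)"
    and g2: "\<And>w. poly g2 w = w^k * poly G w" "degree G \<le> 2"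
    and nz: "c \<noteq> 0" "d \<noteq> 0" "m > 0" and k: "2 + k + 2 * n = 2 * m"
    and \<beta>: "exponent_discriminant (m + 2) (n + 1) (coeff G 2 * (d / c)^2) = 2 * \<beta> 1"
      "exponent_discriminant m n (poly G 0 * ((d * z) / (c * (r * r')))^2) = 2 * \<beta> 2"
      "\<beta> 3 = 1/8" "\<beta> 4 = 1/8"
  shows "fuchsian_data g2 g3 (points z r r') \<beta>"
proof (rule fuchsian_data_points[OF inj, where E = "if n = 0 then {} else {0}"])
  define q where "q = [:c * (r * r'), - (c * (r + r')), c:]"
  have D': "poly (disc_poly g2 g3) w = w^m * poly q w" for w
    unfolding D q_def by (simp add: algebra_simps)
  have \<delta>': "poly (delta_poly g2 g3) w = w^n * poly [:- (d * z), d:] w" for w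
    unfolding \<delta> by (simp add: algebra_simps)
  show "poly (disc_poly g2 g3) w = 0 \<longleftrightarrow> w = 0 \<or> w = r \<or> w = r'" for w
    unfolding D using nz by auto
  show "poly (delta_poly g2 g3) w = 0 \<longleftrightarrow>
      w = z \<or> (w \<in> (if n = 0 then {} else {0}) \<and> (w = 0 \<or> w = r \<or> w = r'))" for w
    unfolding \<delta> using nz by auto
  have "PF_exponent_difference g2 g3 None \<kappa> \<longleftrightarrow>
      \<kappa>^2 = exponent_discriminant (m + 2) (n + 1) (coeff g2 (k + 2) * (coeff (delta_poly g2 g3) (n + 1))^2
        / (coeff (disc_poly g2 g3) (m + 2))^2)" for \<kappa>
  proof (rule exponent_difference_infinity)
    have q: "degree q \<le> 2" "coeff q 2 = c" unfolding q_def by (simp_all add: numeral_2_eq_2)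
    have l: "degree [:- (d * z), d:] \<le> 1" "coeff [:- (d * z), d:] 1 = d" by (simp_all add: One_nat_def)
    note co = degree_coeff_times_power[OF D' q(1)] degree_coeff_times_power[OF \<delta>' l(1)] degree_coeff_times_power[OF g2]
    show "degree (disc_poly g2 g3) \<le> m + 2" "degree (delta_poly g2 g3) \<le> n + 1" "degree g2 \<le> k + 2"
      by (fact co)+
    show "coeff (disc_poly g2 g3) (m + 2) \<noteq> 0" "coeff (delta_poly g2 g3) (n + 1) \<noteq> 0"
      unfolding co q(2) l(2) using nz by simp_all
  qed (use k in simp)
  moreover have "coeff g2 (k + 2) = coeff G 2" by (rule degree_coeff_times_power(2)[OF g2])
  moreover have "coeff (delta_poly g2 g3) (n + 1) = d"
    using degree_coeff_times_power(2)[OF \<delta>', of 1] by (simp add: One_nat_def)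
  moreover have "coeff (disc_poly g2 g3) (m + 2) = c"
    using degree_coeff_times_power(2)[OF D', of 2] by (simp add: q_def numeral_2_eq_2)
  ultimately show "PF_exponent_difference g2 g3 None \<kappa> \<longleftrightarrow> \<kappa>\<^sup>2 = 2 * \<beta> 1" for \<kappa>
    using \<beta>(1) by (simp add: power_divide)
  have "PF_exponent_difference g2 g3 (Some 0) \<kappa> \<longleftrightarrow>
      \<kappa>^2 = exponent_discriminant m n (poly G 0 * (poly [:- (d * z), d:] 0)^2 / (poly q 0)^2)" for \<kappa>
    by (rule exponent_difference_finite)
      (use D' \<delta>' g2 k inj nz in \<open>simp_all add: q_def\<close>)
  then show "PF_exponent_difference g2 g3 (Some 0) \<kappa> \<longleftrightarrow> \<kappa>\<^sup>2 = 2 * \<beta> 2" for \<kappa>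
    using \<beta>(2) by (simp add: power_divide q_def)
  have simple: "PF_exponent_difference g2 g3 (Some s) \<kappa> \<longleftrightarrow> \<kappa>\<^sup>2 = 1/4"
    if "\<And>w. poly (disc_poly g2 g3) w = (w - s) * poly (smult c (monom 1 m * [:- s', 1:])) w" "s \<noteq> s'" "s \<noteq> 0" for s s' \<kappa>
    using pderiv_at_root[OF that(1)] that(2,3) nz
    by (intro exponent_difference_simple_zero) (simp_all add: poly_monom)
  have D1: "poly (disc_poly g2 g3) w = (w - r) * poly (smult c (monom 1 m * [:- r', 1:])) w"
    and D2: "poly (disc_poly g2 g3) w = (w - r') * poly (smult c (monom 1 m * [:- r, 1:])) w" for w
    unfolding D poly_smult poly_mult poly_monom by (simp_all add: algebra_simps)
  show "PF_exponent_difference g2 g3 (Some r) \<kappa> \<longleftrightarrow> \<kappa>\<^sup>2 = 2 * \<beta> 3" for \<kappa>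
    using simple[of r r', OF D1 inj(6,4)] unfolding \<beta>(3) by simp
  show "PF_exponent_difference g2 g3 (Some r') \<kappa> \<longleftrightarrow> \<kappa>\<^sup>2 = 2 * \<beta> 4" for \<kappa>
    using simple[of r' r, OF D2 inj(6)[symmetric] inj(5)] unfolding \<beta>(4) by simp
qed

definition quadratic_root :: "complex \<Rightarrow> complex \<Rightarrow> complex \<Rightarrow> complex \<Rightarrow> complex" where
  "quadratic_root s A B Q = (s * csqrt (B^2 - 4 * A * Q) - B) / (2 * A)"

lemma quadratic_root_sum_prod:
  fixes A B Q w :: complex
  assumes "A \<noteq> 0"
  defines "r \<equiv> quadratic_root 1 A B Q" and "r' \<equiv> quadratic_root (- 1) A B Q"
  shows "A * (r + r') = - B" "A * (r * r') = Q" "(A * (r - r'))^2 = B^2 - 4 * A * Q"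
    "A * w^2 + B * w + Q = A * ((w - r) * (w - r'))"
proof -
  define e where "e = csqrt (B^2 - 4 * A * Q)"
  have e: "e^2 = B^2 - 4 * A * Q" by (simp add: e_def)
  have r: "2 * A * r = e - B" "2 * A * r' = - e - B"
    using assms(1) by (simp_all add: r_def r'_def quadratic_root_def e_def)
  show 1: "A * (r + r') = - B" using r by algebra
  have "2 * A * (2 * (A * (r * r'))) = 2 * A * (2 * Q)" using r e by algebra
  then show 2: "A * (r * r') = Q" using assms(1) by simp
  show "(A * (r - r'))^2 = B^2 - 4 * A * Q" using r e by algebra
  show "A * w^2 + B * w + Q = A * ((w - r) * (w - r'))" using 1 2 by algebra
qed

text \<open>Four singular points force the quadratic factor of \<open>\<triangle>\<close> to have two distinct nonzero roots, and an apparent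
  point that is none of them must exist.\<close>

lemma nondegenerate_two_roots:
  assumes nd: "nondegenerate g2 g3"
    and D: "\<And>w. poly (disc_poly g2 g3) w = c * w^m * (A * w^2 + B * w + Q)"
    and \<delta>: "\<And>w. poly (delta_poly g2 g3) w = d * w^n * (y * w - x)"
    and m: "m > 0" and imp: "c \<noteq> 0 \<Longrightarrow> d \<noteq> 0" "A \<noteq> 0 \<Longrightarrow> y \<noteq> 0"
  shows "c \<noteq> 0" "A \<noteq> 0" "Q \<noteq> 0" "B^2 - 4 * A * Q \<noteq> 0" "x \<noteq> 0" "A * x^2 + B * x * y + Q * y^2 \<noteq> 0"
proof -
  obtain z where "apparent_points g2 g3 = {z}" and card: "card (singular_points g2 g3) = 4"
    using nd by (auto simp: nondegenerate_def)
  then have "z \<in> apparent_points g2 g3" by simp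
  then have z: "d * z^n * (y * z - x) = 0" "c * z^m * (A * z^2 + B * z + Q) \<noteq> 0"
    by (simp_all add: apparent_points_def D \<delta>)
  then have c: "c \<noteq> 0" "z \<noteq> 0" "A * z^2 + B * z + Q \<noteq> 0" using m by auto
  then have yz: "y * z = x" using imp(1) z(1) by simp
  show "c \<noteq> 0" by (fact c)
  let ?R = "{w. A * w^2 + B * w + Q = 0}"
  have sing: "singular_points g2 g3 = insert None (Some ` insert 0 ?R)"
    unfolding singular_points_def D using c m by auto
  have few: False if "?R \<subseteq> R" "card (insert 0 R) \<le> 2" "finite R" for R
  proof -
    have "singular_points g2 g3 \<subseteq> insert None (Some ` insert 0 R)" unfolding sing using that(1) by blast
    then have "4 \<le> card (insert None (Some ` insert 0 R))"
      unfolding card[symmetric] using that(3) by (intro card_mono) auto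
    also have "\<dots> = Suc (card (Some ` insert 0 R))"
      by (rule card_insert_disjoint) (use that(3) in auto)
    also have "card (Some ` insert 0 R) = card (insert 0 R)" by (rule card_image, rule inj_onI) simp
    finally show False using that(2) by simp
  qed
  have two: "card {a, b} \<le> 2" for a b :: complex
    using card_length[of "[a, b]"] by (simp add: numeral_2_eq_2)
  show A: "A \<noteq> 0"
  proof
    assume A: "A = 0"
    have "?R \<subseteq> {- Q / B}"
    proof
      fix w assume w: "w \<in> ?R"
      then have Bw: "B * w + Q = 0" using A by simp
      have "B \<noteq> 0"
      proof
        assume "B = 0"
        with A Bw c(3) show False by simp
      qed
      moreover have "B * w = - Q" using Bw by algebra
      ultimately have "w = - Q / B" by (metis nonzero_mult_div_cancel_left)
      then show "w \<in> {- Q / B}" by simp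
    qed
    from few[OF this two] show False by simp
  qed
  define r r' where "r = quadratic_root 1 A B Q" and "r' = quadratic_root (- 1) A B Q"
  note root = quadratic_root_sum_prod[OF A, where B = B and Q = Q, folded r_def r'_def]
  have R: "?R \<subseteq> {r, r'}" unfolding root(4) using A by auto
  have three: "\<not> card (insert 0 {r, r'}) \<le> 2" using few[OF R] by blast
  have "insert 0 {r, r'} = {0, r'}" if "r = 0" using that by auto
  moreover have "insert 0 {r, r'} = {0, r}" if "r' = 0 \<or> r = r'" using that by auto
  ultimately have rr: "r \<noteq> 0" "r' \<noteq> 0" "r \<noteq> r'" using three two by metis+
  show "Q \<noteq> 0" using root(2) A rr by auto
  show "B^2 - 4 * A * Q \<noteq> 0" unfolding root(3)[symmetric] using A rr by simp
  show "x \<noteq> 0" using yz imp(2)[OF A] c(2) by auto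
  have "A * x^2 + B * x * y + Q * y^2 = y^2 * (A * z^2 + B * z + Q)" unfolding yz[symmetric] by algebra
  then show "A * x^2 + B * x * y + Q * y^2 \<noteq> 0" using c(3) imp(2)[OF A] by simp
qed

context curve_family begin

text \<open>Common treatment of the deformations with \<open>\<triangle> = c z\<^sup>m (A z\<^sup>2 + B z + Q)\<close> and \<open>\<delta> = d z\<^sup>n (y z - x)\<close>, whose coefficients are
  functions of \<open>a\<close>. The point \<open>pt\<close> is chosen such that the discriminant of the quadratic factor avoids the branch cut of
  the square root, which makes the two roots holomorphic near \<open>pt\<close>.\<close>

theorem comes_from_two_roots:
  fixes A B Q x y c d :: "complex \<Rightarrow> complex" and G :: "complex \<Rightarrow> complex poly" and rec :: "complex \<times> complex \<Rightarrow> complex set"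
  assumes label: "ia \<in> {1..4}" "ja \<in> {1..4}" "ia \<noteq> ja"
    and D: "\<And>a w. poly (disc_poly (g2 a) (g3 a)) w = c a * w^m * (A a * w^2 + B a * w + Q a)"
    and \<delta>: "\<And>a w. poly (delta_poly (g2 a) (g3 a)) w = d a * w^n * (y a * w - x a)"
    and g2: "\<And>a w. poly (g2 a) w = w^k * poly (G a) w" "\<And>a. degree (G a) \<le> 2"
    and m: "m > 0" "2 + k + 2 * n = 2 * m"
    and imp: "\<And>a. c a \<noteq> 0 \<Longrightarrow> d a \<noteq> 0" "\<And>a. A a \<noteq> 0 \<Longrightarrow> y a \<noteq> 0"
    and \<beta>: "\<And>a. c a \<noteq> 0 \<Longrightarrow> A a \<noteq> 0 \<Longrightarrow>
        exponent_discriminant (m + 2) (n + 1) (coeff (G a) 2 * (d a * y a / (c a * A a))^2) = 2 * \<beta> ia ja 1"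
      "\<And>a. c a \<noteq> 0 \<Longrightarrow> Q a \<noteq> 0 \<Longrightarrow>
        exponent_discriminant m n (poly (G a) 0 * (d a * x a / (c a * Q a))^2) = 2 * \<beta> ia ja 2"
      "\<beta> ia ja 3 = 1/8" "\<beta> ia ja 4 = 1/8"
    and on_curve: "\<And>a r r'. \<lbrakk>A a \<noteq> 0; y a \<noteq> 0; x a \<noteq> 0; r \<noteq> 0; r \<noteq> r'; A a * (r + r') = - B a; A a * (r * r') = Q a\<rbrakk>
        \<Longrightarrow> (x a / y a / r, r' / r) \<in> curve (P ia ja) \<and> a \<in> rec (x a / y a / r, r' / r)"
    and fin: "\<And>p. finite (rec p)"
    and hol: "A holomorphic_on UNIV" "B holomorphic_on UNIV" "Q holomorphic_on UNIV" "x holomorphic_on UNIV"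
      "y holomorphic_on UNIV" "c holomorphic_on UNIV"
    and pt: "c pt \<noteq> 0" "A pt \<noteq> 0" "Q pt \<noteq> 0" "x pt \<noteq> 0"
      "A pt * (x pt)^2 + B pt * x pt * y pt + Q pt * (y pt)^2 \<noteq> 0" "(B pt)^2 - 4 * A pt * Q pt \<notin> \<real>\<^sub>\<le>\<^sub>0"
  shows "comes_from_deformation g2 g3 C \<alpha> \<longleftrightarrow> (C, \<alpha>) \<in> solutions"
proof -
  define r r' z where "r a = quadratic_root 1 (A a) (B a) (Q a)"
    and "r' a = quadratic_root (- 1) (A a) (B a) (Q a)" and "z a = x a / y a" for a
  let ?res = "\<lambda>a. A a * (x a)^2 + B a * x a * y a + Q a * (y a)^2"
  let ?disc = "\<lambda>a. (B a)^2 - 4 * A a * Q a"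
  define good where "good a \<longleftrightarrow> c a \<noteq> 0 \<and> A a \<noteq> 0 \<and> Q a \<noteq> 0 \<and> x a \<noteq> 0 \<and> ?res a \<noteq> 0 \<and> ?disc a \<noteq> 0" for a
  have nd_good: "good a" if "nondegenerate (g2 a) (g3 a)" for a
    using nondegenerate_two_roots[OF that D \<delta> m(1) imp] by (simp add: good_def)
  have facts: "c a \<noteq> 0" "A a \<noteq> 0" "Q a \<noteq> 0" "x a \<noteq> 0" "y a \<noteq> 0" "r a \<noteq> 0" "r' a \<noteq> 0" "r a \<noteq> r' a"
    "z a \<noteq> 0" "z a \<noteq> r a" "z a \<noteq> r' a" "A a * (r a + r' a) = - B a" "A a * (r a * r' a) = Q a" if good: "good a" for a
  proof -
    show g: "c a \<noteq> 0" "A a \<noteq> 0" "Q a \<noteq> 0" "x a \<noteq> 0" "y a \<noteq> 0"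
      using good imp(2)[of a] by (simp_all add: good_def)
    note root = quadratic_root_sum_prod[OF g(2), where B = "B a" and Q = "Q a", folded r_def r'_def]
    show "A a * (r a + r' a) = - B a" "A a * (r a * r' a) = Q a" by (fact root)+
    show "r a \<noteq> 0" "r' a \<noteq> 0" using root(2) g by auto
    show "r a \<noteq> r' a" using root(3) good by (auto simp: good_def)
    show "z a \<noteq> 0" using g by (simp add: z_def)
    have yz: "y a * z a = x a" using g by (simp add: z_def)
    have "(y a)^2 * (A a * ((z a - r a) * (z a - r' a))) = ?res a"
      unfolding root(4)[symmetric] yz[symmetric] by (simp add: algebra_simps power2_eq_square)
    then have "(y a)^2 * (A a * ((z a - r a) * (z a - r' a))) \<noteq> 0" using good by (simp add: good_def)
    then show "z a \<noteq> r a" "z a \<noteq> r' a" by auto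
  qed
  have data: "fuchsian_data (g2 a) (g3 a) (points (z a) (r a) (r' a)) (\<beta> ia ja)" if good: "good a" for a
  proof (rule fuchsian_data_two_roots[where c = "c a * A a" and d = "d a * y a" and m = m and n = n and k = k and G = "G a"])
    note f = facts[OF good]
    note root = quadratic_root_sum_prod[OF f(2), where B = "B a" and Q = "Q a", folded r_def r'_def]
    show "poly (disc_poly (g2 a) (g3 a)) w = c a * A a * w ^ m * ((w - r a) * (w - r' a))" for w
      unfolding D root(4) by (simp add: ac_simps)
    have "y a * w - x a = y a * (w - z a)" for w using f by (simp add: z_def right_diff_distrib)
    then show "poly (delta_poly (g2 a) (g3 a)) w = d a * y a * w ^ n * (w - z a)" for w
      unfolding \<delta> by (simp add: ac_simps)
    show "exponent_discriminant (m + 2) (n + 1) (coeff (G a) 2 * (d a * y a / (c a * A a))^2) = 2 * \<beta> ia ja 1"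
      by (rule \<beta>(1)[OF f(1,2)])
    have "d a * y a * z a = d a * x a" "c a * A a * (r a * r' a) = c a * Q a"
      using f by (simp_all add: z_def mult.assoc)
    then show "exponent_discriminant m n (poly (G a) 0 * (d a * y a * z a / (c a * A a * (r a * r' a)))^2) = 2 * \<beta> ia ja 2"
      using \<beta>(2)[OF f(1,3)] by (simp only:)
    show "c a * A a \<noteq> 0" "d a * y a \<noteq> 0" using f imp by simp_all
  qed (fact facts[OF good] g2 m \<beta>)+
  (* U: all nondegeneracy conditions hold and the roots are holomorphic. *)
  define U where "U = {a. c a * A a * Q a * x a * ?res a \<noteq> 0} \<inter> ?disc -` (- \<real>\<^sub>\<le>\<^sub>0)"
  have "(\<lambda>a. c a * A a * Q a * x a * ?res a) holomorphic_on UNIV" "?disc holomorphic_on UNIV"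
    by (intro holomorphic_intros hol)+
  then have cont: "continuous_on UNIV (\<lambda>a. c a * A a * Q a * x a * ?res a)" "continuous_on UNIV ?disc"
    by (blast intro: holomorphic_on_imp_continuous_on)+
  have "open U"
    unfolding U_def
    by (intro open_Int open_Collect_neq open_vimage cont continuous_on_const open_Compl closed_nonpos_Reals_complex)
  moreover have "pt \<in> U" using pt by (simp add: U_def)
  ultimately obtain \<epsilon> where \<epsilon>: "\<epsilon> > 0" "ball pt \<epsilon> \<subseteq> U" using openE by blast
  have disc: "?disc a \<notin> \<real>\<^sub>\<le>\<^sub>0" if "a \<in> ball pt \<epsilon>" for a using \<epsilon>(2) that by (auto simp: U_def)
  have "good a" if a: "a \<in> ball pt \<epsilon>" for a
  proof -
    have "?disc a \<noteq> 0"
    proof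
      assume "?disc a = 0"
      then have "?disc a \<in> \<real>\<^sub>\<le>\<^sub>0" by simp
      with disc[OF a] show False by contradiction
    qed
    then show ?thesis using \<epsilon>(2) a by (auto simp: U_def good_def)
  qed
  note good = this
  have ball: "open (ball pt \<epsilon>)" "connected (ball pt \<epsilon>)" "ball pt \<epsilon> \<noteq> {}" using \<epsilon> by simp_all
  have holV: "A holomorphic_on ball pt \<epsilon>" "B holomorphic_on ball pt \<epsilon>" "Q holomorphic_on ball pt \<epsilon>"
    "x holomorphic_on ball pt \<epsilon>" "y holomorphic_on ball pt \<epsilon>"
    using hol by (blast intro: holomorphic_on_subset)+
  have "z holomorphic_on ball pt \<epsilon>"
    unfolding z_def using facts(5)[OF good] by (intro holomorphic_intros holV) blast
  moreover have "r holomorphic_on ball pt \<epsilon>"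
    unfolding r_def quadratic_root_def using facts(2)[OF good] disc
    by (intro holomorphic_intros holV) auto
  moreover have "r' holomorphic_on ball pt \<epsilon>"
    unfolding r'_def quadratic_root_def using facts(2)[OF good] disc
    by (intro holomorphic_intros holV) auto
  ultimately have hol_points: "(\<lambda>a. fst (coords (points (z a) (r a) (r' a) i))) holomorphic_on ball pt \<epsilon>"
    "(\<lambda>a. snd (coords (points (z a) (r a) (r' a) i))) holomorphic_on ball pt \<epsilon>" for i
    by (cases "i = 0"; cases "i = 1"; cases "i = 2"; cases "i = 3"; simp add: points_def)+
  show ?thesis
  proof (rule comes_from_deformation_iff[OF label, where e = "\<lambda>a. points (z a) (r a) (r' a)" and V = "ball pt \<epsilon>" and rec = rec])
    show "fuchsian_data (g2 a) (g3 a) (points (z a) (r a) (r' a)) (\<beta> ia ja)" if "nondegenerate (g2 a) (g3 a)" for a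
      by (rule data[OF nd_good[OF that]])
    show "normal_form (coords \<circ> points (z a) (r a) (r' a)) \<in> curve (P ia ja)" if "nondegenerate (g2 a) (g3 a)" for a
      using on_curve[OF facts(2,5,4,6,8,12,13)[OF nd_good[OF that]]] unfolding normal_form_points z_def by blast
    show "a \<in> rec (normal_form (coords \<circ> points (z a) (r a) (r' a)))" if "nondegenerate (g2 a) (g3 a)" for a
      using on_curve[OF facts(2,5,4,6,8,12,13)[OF nd_good[OF that]]] unfolding normal_form_points z_def by blast
    show "nondegenerate (g2 a) (g3 a)" if "a \<in> ball pt \<epsilon>" for a
      by (rule fuchsian_data_nondegenerate[OF data[OF good[OF that]]])
  qed (fact fin ball | rule hol_points)+
qed

end

section \<open>The five deformations and the classification\<close>

lemma label_cases:
  assumes "i \<in> {1..4::nat}" "j \<in> {1..4}" "i \<noteq> j"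
    and "\<Phi> 1 2" "\<Phi> 1 3" "\<Phi> 1 4" "\<Phi> 2 1" "\<Phi> 2 3" "\<Phi> 2 4"
    and "\<Phi> 3 1" "\<Phi> 3 2" "\<Phi> 3 4" "\<Phi> 4 1" "\<Phi> 4 2" "\<Phi> 4 3"
  shows "\<Phi> i j"
  using assms(1-3) unfolding atLeastAtMost_1_4
  by (elim insertE emptyE) (simp_all add: assms(4-))

lemma polys_bivariate:
  assumes "i \<in> {1..4}" "j \<in> {1..4}" "i \<noteq> j"
  shows "bipoly (poly2 i j)" "bipoly (poly3 j)" "bipoly (poly4 j)" "bipoly (poly5 i j)"
  by (rule label_cases[OF assms]; simp add: poly2_def poly3_def poly4_def poly5_def Let_def;
      intro bipoly_intros)+

lemma polys_boundary:
  assumes "i \<in> {1..4}" "j \<in> {1..4}" "i \<noteq> j"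
  shows "poly2 i j 0 3 \<noteq> 0 \<and> poly2 i j 1 3 \<noteq> 0 \<and> poly2 i j 3 3 \<noteq> 0"
    and "poly3 j 0 3 \<noteq> 0 \<and> poly3 j 1 3 \<noteq> 0 \<and> poly3 j 3 3 \<noteq> 0"
    and "poly4 j 0 3 \<noteq> 0 \<and> poly4 j 1 3 \<noteq> 0 \<and> poly4 j 3 3 \<noteq> 0"
    and "poly5 i j 0 3 \<noteq> 0 \<and> poly5 i j 1 3 \<noteq> 0 \<and> poly5 i j 3 3 \<noteq> 0"
  by (rule label_cases[OF assms]; simp add: poly2_def poly3_def poly4_def poly5_def Let_def)+

text \<open>The curves have degree at most four in \<open>\<lambda>\<close>, so it is enough to compare their values at five places.\<close>

lemma not_identically_zero:
  assumes "f 0 = 0 \<longrightarrow> f 1 = 0 \<longrightarrow> f (- 1) = 0 \<longrightarrow> f 2 = 0 \<longrightarrow> f (- 2) = 0 \<longrightarrow> False"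
  shows "\<exists>l. f l \<noteq> (0 :: complex)"
  using assms by blast

lemma polys_separated:
  assumes "i \<in> {1..4}" "j \<in> {1..4}" "i \<noteq> j"
  shows "\<exists>l. poly2 i j l t \<noteq> 0" "\<exists>l. poly3 j l t \<noteq> 0" "\<exists>l. poly4 j l t \<noteq> 0" "\<exists>l. poly5 i j l t \<noteq> 0"
  by (rule not_identically_zero, rule label_cases[OF assms];
      intro impI; simp add: poly2_def poly3_def poly4_def poly5_def Let_def; algebra)+

interpretation cf2: curve_family poly2 "params2 c" for c
  by (intro curve_family.intro fam2.label_family_axioms curve_family_axioms.intro
      polys_bivariate polys_separated polys_boundary reference_solution_2[THEN conjunct2])

interpretation cf3: curve_family "\<lambda>i. poly3" params3
  by (intro curve_family.intro fam3.label_family_axioms curve_family_axioms.intro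
      polys_bivariate polys_separated polys_boundary reference_solution_3[THEN conjunct2])

interpretation cf4: curve_family "\<lambda>i. poly4" params4
  by (intro curve_family.intro fam4.label_family_axioms curve_family_axioms.intro
      polys_bivariate polys_separated polys_boundary reference_solution_4[THEN conjunct2])

interpretation cf5: curve_family poly5 params5
  by (intro curve_family.intro fam5.label_family_axioms curve_family_axioms.intro
      polys_bivariate polys_separated polys_boundary reference_solution_5[THEN conjunct2])

lemmas poly_eval = poly_diff poly_power poly_mult poly_add poly_minus poly_pCons poly_0 poly_1 poly_numeral

text \<open>The two simple roots are \<open>r\<close> and \<open>1/r\<close> and the apparent point is \<open>1\<close>, so \<open>\<lambda> = 1/r\<close> and \<open>t = 1/r\<^sup>2\<close>; the sum of the roots
  recovers \<open>a\<close>.\<close>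

lemma deformation_2:
  "comes_from_deformation (\<lambda>a. 12 * Z ^ 2 * (Z ^ 2 + [:a:] * Z + 1))
     (\<lambda>a. 4 * Z ^ 3 * (2 * Z ^ 3 + 3 * [:a:] * Z ^ 2 + 3 * [:a:] * Z + 2)) C \<alpha> \<longleftrightarrow> (C, \<alpha>) \<in> fam2.solutions (1/2)"
proof (rule cf2.comes_from_two_roots[where ia = 3 and ja = 4 and m = 8 and n = 6 and k = 2
      and c = "\<lambda>a. 432 * (a - 2)^2" and A = "\<lambda>a. 3" and B = "\<lambda>a. 4 * a - 2" and Q = "\<lambda>a. 3"
      and d = "\<lambda>a. - 144 * (a - 2)^2" and y = "\<lambda>a. 1" and x = "\<lambda>a. 1" and G = "\<lambda>a. [:12, 12 * a, 12:]"
      and rec = "\<lambda>(l, t). {(2 - 3 * (l + 1 / l)) / 4}" and pt = 3])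
  fix a w :: complex
  have p: "12 * Z ^ 2 * (Z ^ 2 + [:a:] * Z + 1) = [:0, 0, 12, 12 * a, 12:]"
    "4 * Z ^ 3 * (2 * Z ^ 3 + 3 * [:a:] * Z ^ 2 + 3 * [:a:] * Z + 2) = [:0, 0, 0, 8, 12 * a, 12 * a, 8:]"
    by (rule poly_ext, unfold poly_eval, algebra)+
  show "poly (disc_poly (12 * Z ^ 2 * (Z ^ 2 + [:a:] * Z + 1)) (4 * Z ^ 3 * (2 * Z ^ 3 + 3 * [:a:] * Z ^ 2 + 3 * [:a:] * Z + 2))) w =
      432 * (a - 2)^2 * w^8 * (3 * w^2 + (4 * a - 2) * w + 3)"
    unfolding p disc_poly_def poly_eval by algebra
  show "poly (delta_poly (12 * Z ^ 2 * (Z ^ 2 + [:a:] * Z + 1)) (4 * Z ^ 3 * (2 * Z ^ 3 + 3 * [:a:] * Z ^ 2 + 3 * [:a:] * Z + 2))) w =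
      - 144 * (a - 2)^2 * w^6 * (1 * w - 1)"
    unfolding p delta_poly_def pderiv_pCons pderiv_0 poly_eval by algebra
  show "poly (12 * Z ^ 2 * (Z ^ 2 + [:a:] * Z + 1)) w = w^2 * poly [:12, 12 * a, 12:] w"
    unfolding p poly_eval by algebra
next
  fix a :: complex assume c: "432 * (a - 2)^2 \<noteq> 0"
  then have "(- 144 * (a - 2)^2) / (1296 * (a - 2)^2) = - 144 / 1296" by (intro nonzero_mult_divide_mult_cancel_right) auto
  then have ratio: "- 144 * (a - 2)^2 * 1 / (432 * (a - 2)^2 * 3) = - 1 / 9" by (simp add: ac_simps)
  show "exponent_discriminant (8 + 2) (6 + 1) (coeff [:12, 12 * a, 12:] 2 * (- 144 * (a - 2)^2 * 1 / (432 * (a - 2)^2 * 3))^2)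
      = 2 * params2 (1/2) 3 4 1"
    and "exponent_discriminant 8 6 (poly [:12, 12 * a, 12:] 0 * (- 144 * (a - 2)^2 * 1 / (432 * (a - 2)^2 * 3))^2)
      = 2 * params2 (1/2) 3 4 2"
    unfolding ratio by (simp_all add: exponent_discriminant_def params2_def power2_eq_square numeral_2_eq_2)
next
  fix a r r' :: complex assume r: "r \<noteq> 0" "3 * (r + r') = - (4 * a - 2)" "3 * (r * r') = 3"
  then have r': "r' = 1 / r" by (simp add: eq_divide_eq mult.commute)
  have a: "a = (2 - 3 * (r + r')) / 4" unfolding r(2) by simp
  show "(1 / 1 / r, r' / r) \<in> curve (poly2 3 4) \<and> a \<in> (case (1 / 1 / r, r' / r) of (l, t) \<Rightarrow> {(2 - 3 * (l + 1 / l)) / 4})"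
    using a by (simp add: curve_def poly2_def Let_def r' power2_eq_square add.commute)
qed (auto simp: params2_def complex_nonpos_Reals_iff intro!: holomorphic_intros)

text \<open>The product of the roots is \<open>(a + 2)/3\<close> and the apparent point is \<open>a + 2\<close>, so \<open>\<lambda> = 3r'\<close> and \<open>\<lambda>\<^sup>2/(3t) = a + 2\<close>.\<close>

lemma deformation_3:
  "comes_from_deformation (\<lambda>a. 12 * Z ^ 2 * (Z ^ 2 + 2 * [:a:] * Z + 1))
     (\<lambda>a. 4 * Z ^ 3 * (2 * Z ^ 3 + 3 * [:a\<^sup>2 + 1:] * Z ^ 2 + 6 * [:a:] * Z + 2)) C \<alpha> \<longleftrightarrow> (C, \<alpha>) \<in> fam3.solutions"
proof (rule cf3.comes_from_two_roots[where ia = 1 and ja = 2 and m = 9 and n = 7 and k = 2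
      and c = "\<lambda>a. - 432 * (a - 1)^2" and A = "\<lambda>a. 12" and B = "\<lambda>a. 3 * (3 * a^2 + 6 * a - 1)" and Q = "\<lambda>a. 4 * (a + 2)"
      and d = "\<lambda>a. 288 * (a - 1)^2" and y = "\<lambda>a. 1" and x = "\<lambda>a. a + 2" and G = "\<lambda>a. [:12, 24 * a, 12:]"
      and rec = "\<lambda>(l, t). {l^2 / (3 * t) - 2}" and pt = 2])
  fix a w :: complex
  have p: "12 * Z ^ 2 * (Z ^ 2 + 2 * [:a:] * Z + 1) = [:0, 0, 12, 24 * a, 12:]"
    "4 * Z ^ 3 * (2 * Z ^ 3 + 3 * [:a\<^sup>2 + 1:] * Z ^ 2 + 6 * [:a:] * Z + 2) = [:0, 0, 0, 8, 24 * a, 12 * (a^2 + 1), 8:]"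
    by (rule poly_ext, unfold poly_eval, algebra)+
  show "poly (disc_poly (12 * Z ^ 2 * (Z ^ 2 + 2 * [:a:] * Z + 1)) (4 * Z ^ 3 * (2 * Z ^ 3 + 3 * [:a\<^sup>2 + 1:] * Z ^ 2 + 6 * [:a:] * Z + 2))) w =
      - 432 * (a - 1)^2 * w^9 * (12 * w^2 + 3 * (3 * a^2 + 6 * a - 1) * w + 4 * (a + 2))"
    unfolding p disc_poly_def poly_eval by algebra
  show "poly (delta_poly (12 * Z ^ 2 * (Z ^ 2 + 2 * [:a:] * Z + 1)) (4 * Z ^ 3 * (2 * Z ^ 3 + 3 * [:a\<^sup>2 + 1:] * Z ^ 2 + 6 * [:a:] * Z + 2))) w =
      288 * (a - 1)^2 * w^7 * (1 * w - (a + 2))"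
    unfolding p delta_poly_def pderiv_pCons pderiv_0 poly_eval by algebra
  show "poly (12 * Z ^ 2 * (Z ^ 2 + 2 * [:a:] * Z + 1)) w = w^2 * poly [:12, 24 * a, 12:] w"
    unfolding p poly_eval by algebra
next
  fix a :: complex assume c: "- 432 * (a - 1)^2 \<noteq> 0"
  then have "(288 * (a - 1)^2) / (- 5184 * (a - 1)^2) = 288 / - 5184" by (intro nonzero_mult_divide_mult_cancel_right) auto
  then have ratio: "288 * (a - 1)^2 * 1 / (- 432 * (a - 1)^2 * 12) = - 1 / 18" by (simp add: ac_simps)
  show "exponent_discriminant (9 + 2) (7 + 1) (coeff [:12, 24 * a, 12:] 2 * (288 * (a - 1)^2 * 1 / (- 432 * (a - 1)^2 * 12))^2)
      = 2 * params3 1 2 1"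
    unfolding ratio by (simp add: exponent_discriminant_def params3_def power2_eq_square numeral_2_eq_2)
  assume "4 * (a + 2) \<noteq> 0"
  then have "a + 2 \<noteq> 0" by (metis mult_zero_right)
  moreover have "a - 1 \<noteq> 0" using c by auto
  ultimately have "(a - 1)^2 * (a + 2) \<noteq> 0" by (metis no_zero_divisors power_not_zero)
  then have "(288 * ((a - 1)^2 * (a + 2))) / (- 1728 * ((a - 1)^2 * (a + 2))) = 288 / - 1728"
    by (rule nonzero_mult_divide_mult_cancel_right)
  moreover have "288 * (a - 1)^2 * (a + 2) = 288 * ((a - 1)^2 * (a + 2))"
    "- 432 * (a - 1)^2 * (4 * (a + 2)) = - 1728 * ((a - 1)^2 * (a + 2))" by algebra+
  ultimately have ratio: "288 * (a - 1)^2 * (a + 2) / (- 432 * (a - 1)^2 * (4 * (a + 2))) = 288 / - 1728" by (simp only:)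
  show "exponent_discriminant 9 7 (poly [:12, 24 * a, 12:] 0 * (288 * (a - 1)^2 * (a + 2) / (- 432 * (a - 1)^2 * (4 * (a + 2))))^2)
      = 2 * params3 1 2 2"
    unfolding ratio by (simp add: exponent_discriminant_def params3_def power2_eq_square)
next
  fix a r r' :: complex assume r: "a + 2 \<noteq> 0" "r \<noteq> 0" "12 * (r + r') = - (3 * (3 * a^2 + 6 * a - 1))" "12 * (r * r') = 4 * (a + 2)"
  have a: "a = 3 * (r * r') - 2" using r(4) by algebra
  then have r'0: "r' \<noteq> 0" using r(1) by auto
  have l: "(a + 2) / 1 / r = 3 * r'" using r(2) by (simp add: a)
  have e: "27 * r^2 * r'^2 - 18 * r * r' + 4 * r + 4 * r' - 1 = 0" using r(3) unfolding a by algebra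
  have "(3 * r')^4 - 6 * (3 * r')^2 * (r' / r) + 4 * (3 * r') * (r' / r) + 4 * (3 * r') * (r' / r)^2 - 3 * (r' / r)^2
      = 3 * r'^2 / r^2 * (27 * r^2 * r'^2 - 18 * r * r' + 4 * r + 4 * r' - 1)"
    using r(2) by (simp add: divide_simps; algebra)
  then have "(3 * r')^4 - 6 * (3 * r')^2 * (r' / r) + 4 * (3 * r') * (r' / r) + 4 * (3 * r') * (r' / r)^2 - 3 * (r' / r)^2 = 0"
    unfolding e by (simp only: mult_zero_right)
  then have "(3 * r', r' / r) \<in> curve (poly3 2)" by (simp add: curve_def poly3_def)
  moreover have "(3 * r')^2 / (3 * (r' / r)) - 2 = a"
    unfolding a using r(2) r'0 by (simp add: divide_simps; algebra)
  ultimately show "((a + 2) / 1 / r, r' / r) \<in> curve (poly3 2) \<and> a \<in> (case ((a + 2) / 1 / r, r' / r) of (l, t) \<Rightarrow> {l^2 / (3 * t) - 2})"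
    unfolding l by (simp only: case_prod_conv singleton_iff simp_thms)
qed (auto simp: params3_def complex_nonpos_Reals_iff intro!: holomorphic_intros)

text \<open>With the coefficients of the quadratic factor inserted, the equation of the curve is symmetric in the two roots and
  becomes an identity in \<open>a\<close>.\<close>

lemma deformation_4:
  "comes_from_deformation (\<lambda>a. 3 * Z ^ 3 * (Z + [:a:])) (\<lambda>a. Z ^ 5 * (Z + 1)) C \<alpha> \<longleftrightarrow> (C, \<alpha>) \<in> fam4.solutions"
proof (rule cf4.comes_from_two_roots[where ia = 1 and ja = 2 and m = 9 and n = 7 and k = 2
      and c = "\<lambda>a. 27" and A = "\<lambda>a. 3 * a - 2" and B = "\<lambda>a. 3 * a^2 - 1" and Q = "\<lambda>a. a^3"
      and d = "\<lambda>a. - 3" and y = "\<lambda>a. 3 * a - 2" and x = "\<lambda>a. - a" and G = "\<lambda>a. [:0, 3 * a, 3:]"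
      and rec = "\<lambda>(l, t). {(l^2 - t) / (l * (2 * l - 1 - t))}" and pt = "1/2"])
  fix a w :: complex
  have p: "3 * Z ^ 3 * (Z + [:a:]) = [:0, 0, 0, 3 * a, 3:]" "Z ^ 5 * (Z + 1) = [:0, 0, 0, 0, 0, 1, 1:]"
    by (rule poly_ext, unfold poly_eval, algebra)+
  show "poly (disc_poly (3 * Z ^ 3 * (Z + [:a:])) (Z ^ 5 * (Z + 1))) w =
      27 * w^9 * ((3 * a - 2) * w^2 + (3 * a^2 - 1) * w + a^3)"
    unfolding p disc_poly_def poly_eval by algebra
  show "poly (delta_poly (3 * Z ^ 3 * (Z + [:a:])) (Z ^ 5 * (Z + 1))) w = - 3 * w^7 * ((3 * a - 2) * w - (- a))"
    unfolding p delta_poly_def pderiv_pCons pderiv_0 poly_eval by algebra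
  show "poly (3 * Z ^ 3 * (Z + [:a:])) w = w^2 * poly [:0, 3 * a, 3:] w"
    unfolding p poly_eval by algebra
next
  fix a :: complex assume "3 * a - 2 \<noteq> 0"
  then have "- 3 * (3 * a - 2) / (27 * (3 * a - 2)) = - 1 / 9" by (simp add: divide_simps)
  then show "exponent_discriminant (9 + 2) (7 + 1) (coeff [:0, 3 * a, 3:] 2 * (- 3 * (3 * a - 2) / (27 * (3 * a - 2)))^2)
      = 2 * params4 1 2 1"
    by (simp add: exponent_discriminant_def params4_def power2_eq_square numeral_2_eq_2)
next
  fix a r r' :: complex
  assume r: "3 * a - 2 \<noteq> 0" "- a \<noteq> 0" "r \<noteq> 0" "r \<noteq> r'" "(3 * a - 2) * (r + r') = - (3 * a^2 - 1)" "(3 * a - 2) * (r * r') = a^3"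
  define l t where "l = - a / (3 * a - 2) / r" and "t = r' / r"
  have l: "(3 * a - 2) * (r * l) = - a" and t: "r * t = r'" using r(1,3) by (simp_all add: l_def t_def)
  have s: "(3 * a - 2) * (r * (1 + t)) = - (3 * a^2 - 1)" "(3 * a - 2) * (r^2 * t) = a^3"
    using r(5,6) unfolding t[symmetric] by algebra+
  have nz: "(3 * a - 2)^4 * r^4 \<noteq> 0" "(3 * a - 2)^2 * r^2 \<noteq> 0" using r by simp_all
  have "((3 * a - 2)^4 * r^4) * (l^4 - 2*t*l^3 - 2*l^3 + 6*t*l^2 - 2*t^2*l - 2*t*l + t^3 - t^2 + t) = 0"
  proof -
    define b R L where "b = 3 * a - 2" and "R = b * (r * (1 + t))" and "L = b * (r * l)"
    have "b^4 * r^4 * (l^4 - 2*t*l^3 - 2*l^3 + 6*t*l^2 - 2*t^2*l - 2*t*l + t^3 - t^2 + t) =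
        L^4 - 2 * L^3 * R + 6 * L^2 * b * (b * (r^2 * t)) - 2 * L * R * b * (b * (r^2 * t))
          + b * (b * (r^2 * t)) * (R^2 - 3 * b * (b * (r^2 * t)))"
      unfolding R_def L_def by algebra
    also have "\<dots> = (- a)^4 - 2 * (- a)^3 * - (3 * a^2 - 1) + 6 * (- a)^2 * b * a^3 - 2 * (- a) * - (3 * a^2 - 1) * b * a^3
          + b * a^3 * ((- (3 * a^2 - 1))^2 - 3 * b * a^3)"
      unfolding R_def L_def b_def s l ..
    also have "\<dots> = 0" unfolding b_def by algebra
    finally show ?thesis unfolding b_def .
  qed
  then have c: "l^4 - 2*t*l^3 - 2*l^3 + 6*t*l^2 - 2*t^2*l - 2*t*l + t^3 - t^2 + t = 0" using nz by simp
  have "((3 * a - 2)^2 * r^2) * (a * (l * (2 * l - 1 - t)) - (l^2 - t)) = 0"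
  proof -
    define b R L where "b = 3 * a - 2" and "R = b * (r * (1 + t))" and "L = b * (r * l)"
    have "b^2 * r^2 * (a * (l * (2 * l - 1 - t)) - (l^2 - t)) = a * (L * (2 * L - R)) - (L^2 - b * (b * (r^2 * t)))"
      unfolding R_def L_def by algebra
    also have "\<dots> = a * (- a * (2 * - a - - (3 * a^2 - 1))) - ((- a)^2 - b * a^3)"
      unfolding R_def L_def b_def s l ..
    also have "\<dots> = 0" unfolding b_def by algebra
    finally show ?thesis unfolding b_def .
  qed
  then have e: "a * (l * (2 * l - 1 - t)) = l^2 - t" using nz by simp
  have "l \<noteq> 0" using l r by auto
  moreover have "2 * l - 1 - t \<noteq> 0"
  proof
    assume 0: "2 * l - 1 - t = 0"
    then have "l^2 - t = 0" using e by simp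
    with 0 have "(t - 1)^2 = 0" by algebra
    then have "t = 1" by simp
    with t r(4) show False by simp
  qed
  ultimately have "a = (l^2 - t) / (l * (2 * l - 1 - t))" using e by (simp add: nonzero_eq_divide_eq)
  with c show "(- a / (3 * a - 2) / r, r' / r) \<in> curve (poly4 2) \<and>
      a \<in> (case (- a / (3 * a - 2) / r, r' / r) of (l, t) \<Rightarrow> {(l^2 - t) / (l * (2 * l - 1 - t))})"
    unfolding l_def[symmetric] t_def[symmetric] by (simp add: curve_def poly4_def)
qed (auto simp: params4_def exponent_discriminant_def power2_eq_square complex_nonpos_Reals_iff Re_divide power3_eq_cube intro!: holomorphic_intros)

text \<open>Here \<open>(1 + t)/\<lambda> = 6 - 8a\<^sup>2\<close>, which determines \<open>a\<close> only up to its sign.\<close>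

lemma deformation_5:
  "comes_from_deformation (\<lambda>a. 3 * Z ^ 3 * (Z + 2 * [:a:])) (\<lambda>a. Z ^ 4 * (Z ^ 2 + 3 * [:a:] * Z + 1)) C \<alpha>
    \<longleftrightarrow> (C, \<alpha>) \<in> fam5.solutions"
proof (rule cf5.comes_from_two_roots[where ia = 1 and ja = 2 and m = 8 and n = 6 and k = 2
      and c = "\<lambda>a. 27" and A = "\<lambda>a. 3 * a^2 - 2" and B = "\<lambda>a. 8 * a^3 - 6 * a" and Q = "\<lambda>a. - 1"
      and d = "\<lambda>a. - 6" and y = "\<lambda>a. 3 * a^2 - 2" and x = "\<lambda>a. a" and G = "\<lambda>a. [:0, 6 * a, 3:]"
      and rec = "\<lambda>(l, t). {csqrt ((6 - (1 + t) / l) / 8), - csqrt ((6 - (1 + t) / l) / 8)}" and pt = 1])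
  fix a w :: complex
  have p: "3 * Z ^ 3 * (Z + 2 * [:a:]) = [:0, 0, 0, 6 * a, 3:]"
    "Z ^ 4 * (Z ^ 2 + 3 * [:a:] * Z + 1) = [:0, 0, 0, 0, 1, 3 * a, 1:]"
    by (rule poly_ext, unfold poly_eval, algebra)+
  show "poly (disc_poly (3 * Z ^ 3 * (Z + 2 * [:a:])) (Z ^ 4 * (Z ^ 2 + 3 * [:a:] * Z + 1))) w =
      27 * w^8 * ((3 * a^2 - 2) * w^2 + (8 * a^3 - 6 * a) * w + - 1)"
    unfolding p disc_poly_def poly_eval by algebra
  show "poly (delta_poly (3 * Z ^ 3 * (Z + 2 * [:a:])) (Z ^ 4 * (Z ^ 2 + 3 * [:a:] * Z + 1))) w =
      - 6 * w^6 * ((3 * a^2 - 2) * w - a)"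
    unfolding p delta_poly_def pderiv_pCons pderiv_0 poly_eval by algebra
  show "poly (3 * Z ^ 3 * (Z + 2 * [:a:])) w = w^2 * poly [:0, 6 * a, 3:] w"
    unfolding p poly_eval by algebra
next
  fix a :: complex assume "3 * a^2 - 2 \<noteq> 0"
  then have "- 6 * (3 * a^2 - 2) / (27 * (3 * a^2 - 2)) = - 2 / 9" by (simp add: divide_simps)
  then show "exponent_discriminant (8 + 2) (6 + 1) (coeff [:0, 6 * a, 3:] 2 * (- 6 * (3 * a^2 - 2) / (27 * (3 * a^2 - 2)))^2)
      = 2 * params5 1 2 1"
    by (simp add: exponent_discriminant_def params5_def power2_eq_square numeral_2_eq_2)
next
  fix a r r' :: complex
  assume r: "3 * a^2 - 2 \<noteq> 0" "a \<noteq> 0" "r \<noteq> 0" "(3 * a^2 - 2) * (r + r') = - (8 * a^3 - 6 * a)" "(3 * a^2 - 2) * (r * r') = - 1"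
  define l t where "l = a / (3 * a^2 - 2) / r" and "t = r' / r"
  have l: "(3 * a^2 - 2) * (r * l) = a" and t: "r * t = r'" using r(1,3) by (simp_all add: l_def t_def)
  have s: "(3 * a^2 - 2) * (r * (1 + t)) = - (8 * a^3 - 6 * a)" "(3 * a^2 - 2) * (r^2 * t) = - 1"
    using r(4,5) unfolding t[symmetric] by algebra+
  have nz: "(3 * a^2 - 2)^3 * r^3 \<noteq> 0" "(3 * a^2 - 2) * r \<noteq> 0" "l \<noteq> 0" using r l by auto
  have "((3 * a^2 - 2)^3 * r^3) * (- 2*l^3 + 3*t*l^2 + 3*l^2 - 6*t*l + t^2 + t) = 0"
  proof -
    define b R L where "b = 3 * a^2 - 2" and "R = b * (r * (1 + t))" and "L = b * (r * l)"
    have "b^3 * r^3 * (- 2*l^3 + 3*t*l^2 + 3*l^2 - 6*t*l + t^2 + t) =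
        - 2 * L^3 + 3 * L^2 * R - 6 * L * b * (b * (r^2 * t)) + R * b * (b * (r^2 * t))"
      unfolding R_def L_def by algebra
    also have "\<dots> = - 2 * a^3 + 3 * a^2 * - (8 * a^3 - 6 * a) - 6 * a * b * - 1 + - (8 * a^3 - 6 * a) * b * - 1"
      unfolding R_def L_def b_def s l ..
    also have "\<dots> = 0" unfolding b_def by algebra
    finally show ?thesis unfolding b_def .
  qed
  then have c: "- 2*l^3 + 3*t*l^2 + 3*l^2 - 6*t*l + t^2 + t = 0" using nz by simp
  have "((3 * a^2 - 2) * r) * ((1 + t) - (6 - 8 * a^2) * l) =
      (3 * a^2 - 2) * (r * (1 + t)) - (6 - 8 * a^2) * ((3 * a^2 - 2) * (r * l))"
    by algebra
  also have "\<dots> = 0" unfolding s l by algebra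
  finally have "1 + t = (6 - 8 * a^2) * l" using nz by simp
  then have "(6 - (1 + t) / l) / 8 = a^2" using nz(3) by simp
  then have "(csqrt ((6 - (1 + t) / l) / 8))^2 = a^2" by simp
  then have "a \<in> {csqrt ((6 - (1 + t) / l) / 8), - csqrt ((6 - (1 + t) / l) / 8)}"
    unfolding power2_eq_iff by auto
  with c show "(a / (3 * a^2 - 2) / r, r' / r) \<in> curve (poly5 1 2) \<and> a \<in> (case (a / (3 * a^2 - 2) / r, r' / r) of
      (l, t) \<Rightarrow> {csqrt ((6 - (1 + t) / l) / 8), - csqrt ((6 - (1 + t) / l) / 8)})"
    unfolding l_def[symmetric] t_def[symmetric] by (simp add: curve_def poly5_def)
qed (auto simp: params5_def exponent_discriminant_def power2_eq_square complex_nonpos_Reals_iff intro!: holomorphic_intros)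

lemma poly_delta:
  assumes "(poly g2 has_field_derivative x) (at w)" "(poly g3 has_field_derivative y) (at w)"
  shows "poly (delta_poly g2 g3) w = 3 * poly g3 w * x - 2 * poly g2 w * y"
  using DERIV_unique[OF assms(1) poly_DERIV] DERIV_unique[OF assms(2) poly_DERIV] by (simp add: delta_poly_def)

lemma degree_coeff_linear_power_times:
  fixes q :: "complex poly"
  assumes "degree q \<le> d"
  shows "degree ([:- s, 1:] ^ m * q) \<le> m + d \<and> coeff ([:- s, 1:] ^ m * q) (m + d) = coeff q d"
proof (induction m)
  case 0
  then show ?case using assms by simp
next
  case (Suc m)
  define f where "f = [:- s, 1:] ^ m * q"
  have f: "degree f \<le> m + d" "coeff f (m + d) = coeff q d" using Suc by (simp_all add: f_def)
  have eq: "[:- s, 1:] ^ Suc m * q = pCons 0 f - smult s f"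
    by (rule poly_ext) (simp add: f_def algebra_simps)
  have "coeff f (Suc (m + d)) = 0" using f(1) by (intro coeff_eq_0) simp
  moreover have "degree (pCons 0 f - smult s f) \<le> Suc (m + d)"
    using f(1) by (intro degree_diff_le) (auto intro: order_trans[OF degree_pCons_le] order_trans[OF degree_smult_le])
  ultimately show ?case unfolding eq using f(2) by simp
qed

text \<open>All singular points \<open>\<infinity>, 0, 1, a\<^sup>2\<close> and the apparent point \<open>a\<close> are explicit, and \<open>\<lambda> = a\<close>, \<open>t = a\<^sup>2\<close>.\<close>

lemma deformation_1:
  "comes_from_deformation (\<lambda>a. 3 * (Z - 1) * (Z - [:a\<^sup>2:]) ^ 3)
     (\<lambda>a. (Z - 1) * (Z - [:a\<^sup>2:]) ^ 4 * (Z + [:a:])) C \<alpha> \<longleftrightarrow> (C, \<alpha>) \<in> fam2.solutions (1/18)"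
proof -
  define g h :: "complex \<Rightarrow> complex poly" where "g a = 3 * (Z - 1) * (Z - [:a\<^sup>2:]) ^ 3"
    and "h a = (Z - 1) * (Z - [:a\<^sup>2:]) ^ 4 * (Z + [:a:])" for a
  have pg: "poly (g a) = (\<lambda>w. 3 * (w - 1) * (w - a^2)^3)" and ph: "poly (h a) = (\<lambda>w. (w - 1) * (w - a^2)^4 * (w + a))" for a
    unfolding g_def h_def poly_eval by (rule ext, algebra)+
  have D: "poly (disc_poly (g a) (h a)) w = - 27 * (a + 1)^2 * (w * (w - 1)^2 * (w - a^2)^8)" for a w
    unfolding disc_poly_def poly_eval pg ph by algebra
  have \<delta>: "poly (delta_poly (g a) (h a)) w = 3 * (a + 1)^2 * ((w - 1) * (w - a^2)^6 * (w - a))" for a w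
  proof -
    have "((\<lambda>w. 3 * (w - 1) * (w - b)^3) has_field_derivative 3 * (w - b)^3 + 9 * (w - 1) * (w - b)^2) (at w)" for b
      by (auto intro!: derivative_eq_intros simp: algebra_simps)
    moreover have "((\<lambda>w. (w - 1) * (w - b)^4 * (w + a)) has_field_derivative
        (w - b)^4 * (w + a) + 4 * (w - 1) * (w - b)^3 * (w + a) + (w - 1) * (w - b)^4) (at w)" for b
      by (auto intro!: derivative_eq_intros simp: algebra_simps)
    ultimately have "poly (delta_poly (g a) (h a)) w = 3 * poly (h a) w * (3 * (w - a^2)^3 + 9 * (w - 1) * (w - a^2)^2)
        - 2 * poly (g a) w * ((w - a^2)^4 * (w + a) + 4 * (w - 1) * (w - a^2)^3 * (w + a) + (w - 1) * (w - a^2)^4)"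
      by (intro poly_delta) (simp_all only: pg ph)
    also have "\<dots> = 3 * (a + 1)^2 * ((w - 1) * (w - a^2)^6 * (w - a))" unfolding pg ph by algebra
    finally show ?thesis .
  qed
  have data: "fuchsian_data (g a) (h a) (points a 1 (a^2)) (params2 (1/18) 1 2)" if a: "a \<noteq> 0" "a \<noteq> 1" "a \<noteq> - 1" for a
  proof -
    define \<kappa> \<mu> where "\<kappa> = - 27 * (a + 1)^2" and "\<mu> = 3 * (a + 1)^2"
    have a1: "a + 1 \<noteq> 0" using a(3) by (simp add: add_eq_0_iff2)
    have \<kappa>: "\<kappa> \<noteq> 0" "\<mu> \<noteq> 0" "\<mu> / \<kappa> = - 1 / 9" using a1 by (simp_all add: \<kappa>_def \<mu>_def)
    have aa: "a^2 \<noteq> 1" using a by (simp add: power2_eq_1_iff)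
    have aa': "a \<noteq> a^2" using a by (simp add: power2_eq_square)
    define X :: "complex \<Rightarrow> complex poly" where "X s = [:- s, 1:]" for s
    have X: "poly (X s) w = w - s" for s w by (simp add: X_def)
    have pD: "disc_poly (g a) (h a) = X 0 ^ 1 * (X 1 ^ 2 * (X (a^2) ^ 8 * [:\<kappa>:]))"
      and p\<delta>: "delta_poly (g a) (h a) = X 1 ^ 1 * (X (a^2) ^ 6 * (X a ^ 1 * [:\<mu>:]))"
      and p2: "g a = X 1 ^ 1 * (X (a^2) ^ 3 * [:3:])"
      by (rule poly_ext, unfold D \<delta> pg poly_mult poly_power X \<kappa>_def \<mu>_def, simp)+
    have c: "degree [:b:] \<le> 0" for b :: complex by simp
    note lp = degree_coeff_linear_power_times[folded X_def]
    note lp1 = lp[OF c] note lp2 = lp[OF lp1[THEN conjunct1]] note lp3 = lp[OF lp2[THEN conjunct1]]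
    have nums: "2 + 8 = (10 :: nat)" "1 + 10 = (11 :: nat)" "6 + 1 = (7 :: nat)" "1 + 7 = (8 :: nat)" "1 + 3 = (4 :: nat)"
      by simp_all
    have deg: "degree (disc_poly (g a) (h a)) \<le> 11" "coeff (disc_poly (g a) (h a)) 11 = \<kappa>"
      "degree (delta_poly (g a) (h a)) \<le> 8" "coeff (delta_poly (g a) (h a)) 8 = \<mu>" "degree (g a) \<le> 4" "coeff (g a) 4 = 3"
      unfolding pD p\<delta> unfolding p2
      using lp3[of 0 1 1 2 "a^2" 8 \<kappa>] lp2[of 1 2 "a^2" 8 \<kappa>] lp1[of "a^2" 8 \<kappa>]
        lp3[of 1 1 "a^2" 6 a 1 \<mu>] lp2[of "a^2" 6 a 1 \<mu>] lp1[of a 1 \<mu>]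
        lp2[of 1 1 "a^2" 3 3] lp1[of "a^2" 3 3]
      by (simp_all only: add_0_right nums coeff_pCons_0)
    show ?thesis
    proof (rule fuchsian_data_points[where E = "{1, a^2}"])
      show "poly (disc_poly (g a) (h a)) w = 0 \<longleftrightarrow> w = 0 \<or> w = 1 \<or> w = a^2" for w
        unfolding D using a1 by auto
      show "poly (delta_poly (g a) (h a)) w = 0 \<longleftrightarrow> w = a \<or> (w \<in> {1, a^2} \<and> (w = 0 \<or> w = 1 \<or> w = a^2))" for w
        unfolding \<delta> using a1 by auto
      have "PF_exponent_difference (g a) (h a) None k \<longleftrightarrow> k^2 = exponent_discriminant 11 8
          (coeff (g a) 4 * (coeff (delta_poly (g a) (h a)) 8)^2 / (coeff (disc_poly (g a) (h a)) 11)^2)" for k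
        by (rule exponent_difference_infinity) (use deg \<kappa> in simp_all)
      moreover have "3 * \<mu>^2 / \<kappa>^2 = 3 * (\<mu> / \<kappa>)^2" by (simp add: power_divide)
      then have "3 * \<mu>^2 / \<kappa>^2 = 1 / 27" unfolding \<kappa>(3) by (simp add: power2_eq_square)
      moreover have "exponent_discriminant 11 8 (1 / 27) = 2 * params2 (1/18) 1 2 1"
        by (simp add: exponent_discriminant_def params2_def power2_eq_square)
      ultimately show "PF_exponent_difference (g a) (h a) None k \<longleftrightarrow> k^2 = 2 * params2 (1/18) 1 2 1" for k
        by (simp only: deg)
      have h0: "poly (disc_poly (g a) (h a)) w = (w - 0) * poly (X 1 ^ 2 * (X (a^2) ^ 8 * [:\<kappa>:])) w" for w
        unfolding pD poly_mult poly_power X by simp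
      have "PF_exponent_difference (g a) (h a) (Some 0) k \<longleftrightarrow> k^2 = 1/4" for k
        by (rule exponent_difference_simple_zero) (use pderiv_at_root[OF h0] a \<kappa> in \<open>simp_all add: X\<close>)
      then show "PF_exponent_difference (g a) (h a) (Some 0) k \<longleftrightarrow> k^2 = 2 * params2 (1/18) 1 2 2" for k
        by (simp add: params2_def)
      have "PF_exponent_difference (g a) (h a) (Some 1) k \<longleftrightarrow> k^2 = exponent_discriminant 2 1
          (poly (g a) 1 * (poly (X (a^2) ^ 6 * (X a ^ 1 * [:\<mu>:])) 1)^2 / (poly (X 0 * (X (a^2) ^ 8 * [:\<kappa>:])) 1)^2)" for k
        by (rule exponent_difference_finite[where k = 0]) (use a aa \<kappa> in \<open>simp_all add: pD p\<delta> X\<close>)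
      then show "PF_exponent_difference (g a) (h a) (Some 1) k \<longleftrightarrow> k^2 = 2 * params2 (1/18) 1 2 3" for k
        by (simp add: pg exponent_discriminant_def params2_def power2_eq_square)
      have "PF_exponent_difference (g a) (h a) (Some (a^2)) k \<longleftrightarrow> k^2 = exponent_discriminant 8 6
          (poly (X 1 * (X (a^2) * [:3:])) (a^2) * (poly (X 1 * (X a ^ 1 * [:\<mu>:])) (a^2))^2 / (poly (X 0 * (X 1 ^ 2 * [:\<kappa>:])) (a^2))^2)" for k
      proof (rule exponent_difference_finite[where k = 2])
        show "poly (disc_poly (g a) (h a)) w = (w - a^2)^8 * poly (X 0 * (X 1 ^ 2 * [:\<kappa>:])) w"
          "poly (delta_poly (g a) (h a)) w = (w - a^2)^6 * poly (X 1 * (X a ^ 1 * [:\<mu>:])) w"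
          "poly (g a) w = (w - a^2)^2 * poly (X 1 * (X (a^2) * [:3:])) w" for w
          unfolding pD p\<delta> unfolding p2 poly_mult poly_power X by (simp_all add: ac_simps power2_eq_square power3_eq_cube)
      qed (use a aa aa' \<kappa> in \<open>simp_all add: X\<close>)
      then show "PF_exponent_difference (g a) (h a) (Some (a^2)) k \<longleftrightarrow> k^2 = 2 * params2 (1/18) 1 2 4" for k
        by (simp add: X exponent_discriminant_def params2_def power2_eq_square)
    qed (use a aa aa' in auto)
  qed
  have nd: "a \<noteq> 0" "a \<noteq> 1" "a \<noteq> - 1" if nd: "nondegenerate (g a) (h a)" for a
  proof -
    have card: "card (singular_points (g a) (h a)) = 4" and app: "apparent_points (g a) (h a) \<noteq> {}"
      using nd by (auto simp: nondegenerate_def)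
    show m1: "a \<noteq> - 1"
    proof
      assume "a = - 1"
      with app show False by (simp add: apparent_points_def D)
    qed
    have "card (singular_points (g a) (h a)) \<le> card (set [None, Some 0, Some (1 :: complex)])" if "a^2 = 0 \<or> a^2 = 1"
    proof (rule card_mono)
      have "a + 1 \<noteq> 0" using m1 by (simp add: add_eq_0_iff2)
      then show "singular_points (g a) (h a) \<subseteq> set [None, Some 0, Some 1]"
        unfolding singular_points_def D using that by auto
    qed simp
    moreover have "card (set [None, Some 0, Some (1 :: complex)]) \<le> 3"
      by (rule order_trans[OF card_length]) simp
    ultimately have "\<not> (a^2 = 0 \<or> a^2 = 1)" using card by fastforce
    then show "a \<noteq> 0" "a \<noteq> 1" by auto
  qed
  have V: "a \<noteq> 0" "a \<noteq> 1" "a \<noteq> - 1" if "a \<in> ball (3 :: complex) 1" for a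
    using that by (auto simp: dist_norm)
  have "comes_from_deformation g h C \<alpha> \<longleftrightarrow> (C, \<alpha>) \<in> fam2.solutions (1/18)"
  proof (rule cf2.comes_from_deformation_iff[where e = "\<lambda>a. points a 1 (a^2)" and V = "ball 3 1"
        and rec = "\<lambda>x. {fst x}" and ia = 1 and ja = 2])
    show "fuchsian_data (g a) (h a) (points a 1 (a^2)) (params2 (1/18) 1 2)" if "nondegenerate (g a) (h a)" for a
      by (rule data[OF nd[OF that]])
    show "nondegenerate (g a) (h a)" if "a \<in> ball 3 1" for a
      by (rule fuchsian_data_nondegenerate[OF data[OF V[OF that]]])
    show "normal_form (coords \<circ> points a 1 (a^2)) \<in> curve (poly2 1 2)" for a
      unfolding normal_form_points by (simp add: curve_def poly2_def Let_def)
    show "a \<in> {fst (normal_form (coords \<circ> points a 1 (a^2)))}" for a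
      unfolding normal_form_points by simp
    show "(\<lambda>a. fst (coords (points a 1 (a^2) i))) holomorphic_on ball 3 1"
      "(\<lambda>a. snd (coords (points a 1 (a^2) i))) holomorphic_on ball 3 1" for i
      by (cases "i = 0"; cases "i = 1"; cases "i = 2"; cases "i = 3"; simp add: points_def holomorphic_intros)+
  qed simp_all
  then show ?thesis unfolding g_def h_def .
qed

theorem theorem3:
  shows
    "{(C, \<alpha>). \<exists>(g2, g3) \<in> deformations. comes_from_deformation g2 g3 C \<alpha>}
       = solutions_2 \<union> solutions_3 \<union> solutions_4 \<union> solutions_5 \<and>
     (\<forall>(C, \<alpha>) \<in> solutions_2 \<union> solutions_3 \<union> solutions_4 \<union> solutions_5.
        algebraic_PVI_solution C \<alpha>) \<and>
     (\<forall>(C, \<alpha>) \<in> solutions_2.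
        solution_stabilizer C \<cong> dihedral_group 4 \<and>
        PVI_stabilizer \<alpha> \<cong> sym_group 2 \<times>\<times> sym_group 2) \<and>
     (\<forall>(C, \<alpha>) \<in> solutions_3.
        solution_stabilizer C \<cong> sym_group 3 \<and> PVI_stabilizer \<alpha> \<cong> sym_group 3) \<and>
     (\<forall>(C, \<alpha>) \<in> solutions_4.
        solution_stabilizer C \<cong> sym_group 3 \<and> PVI_stabilizer \<alpha> \<cong> sym_group 4) \<and>
     (\<forall>(C, \<alpha>) \<in> solutions_5.
        solution_stabilizer C \<cong> sym_group 2 \<and> PVI_stabilizer \<alpha> \<cong> sym_group 2)"
proof -
  have "(\<exists>(g2, g3) \<in> deformations. comes_from_deformation g2 g3 C \<alpha>) \<longleftrightarrow>
      (C, \<alpha>) \<in> fam2.solutions (1/18) \<or> (C, \<alpha>) \<in> fam2.solutions (1/2) \<or> (C, \<alpha>) \<in> fam3.solutions \<or>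
      (C, \<alpha>) \<in> fam4.solutions \<or> (C, \<alpha>) \<in> fam5.solutions" for C \<alpha>
    unfolding deformations_def
    by (simp only: bex_simps case_prod_conv deformation_1 deformation_2 deformation_3 deformation_4 deformation_5 simp_thms)
  then have 1: "{(C, \<alpha>). \<exists>(g2, g3) \<in> deformations. comes_from_deformation g2 g3 C \<alpha>}
       = solutions_2 \<union> solutions_3 \<union> solutions_4 \<union> solutions_5"
    unfolding solutions_lists by (simp only:) blast
  have sol: "algebraic_PVI_solution C \<alpha>" if "(C, \<alpha>) \<in> solutions_2 \<union> solutions_3 \<union> solutions_4 \<union> solutions_5" for C \<alpha>
    using that unfolding solutions_lists Un_iff
  proof (elim disjE)
    assume "(C, \<alpha>) \<in> fam2.solutions (1/18)"
    then show ?thesis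
      by (rule fam2.solutions_cases) (simp only:, rule fam2.algebraic_PVI_solution_labels[OF reference_solution_2[THEN conjunct1]]; assumption)
  next
    assume "(C, \<alpha>) \<in> fam2.solutions (1/2)"
    then show ?thesis
      by (rule fam2.solutions_cases) (simp only:, rule fam2.algebraic_PVI_solution_labels[OF reference_solution_2[THEN conjunct1]]; assumption)
  next
    assume "(C, \<alpha>) \<in> fam3.solutions"
    then show ?thesis
      by (rule fam3.solutions_cases) (simp only:, rule fam3.algebraic_PVI_solution_labels[OF reference_solution_3[THEN conjunct1]]; assumption)
  next
    assume "(C, \<alpha>) \<in> fam4.solutions"
    then show ?thesis
      by (rule fam4.solutions_cases) (simp only:, rule fam4.algebraic_PVI_solution_labels[OF reference_solution_4[THEN conjunct1]]; assumption)
  next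
    assume "(C, \<alpha>) \<in> fam5.solutions"
    then show ?thesis
      by (rule fam5.solutions_cases) (simp only:, rule fam5.algebraic_PVI_solution_labels[OF reference_solution_5[THEN conjunct1]]; assumption)
  qed
  have stab2: "solution_stabilizer C \<cong> dihedral_group 4 \<and> PVI_stabilizer \<alpha> \<cong> sym_group 2 \<times>\<times> sym_group 2"
    if "(C, \<alpha>) \<in> solutions_2" for C \<alpha>
    using that unfolding solutions_lists Un_iff
  proof (elim disjE)
    assume "(C, \<alpha>) \<in> fam2.solutions (1/18)"
    then show ?thesis by (rule fam2.solutions_cases) (simp only:, rule stabilizers_2; simp)
  next
    assume "(C, \<alpha>) \<in> fam2.solutions (1/2)"
    then show ?thesis by (rule fam2.solutions_cases) (simp only:, rule stabilizers_2; simp)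
  qed
  have stab3: "solution_stabilizer C \<cong> sym_group 3 \<and> PVI_stabilizer \<alpha> \<cong> sym_group 3" if "(C, \<alpha>) \<in> solutions_3" for C \<alpha>
    using that unfolding solutions_lists by (rule fam3.solutions_cases) (simp only:, rule stabilizers_3; assumption)
  have stab4: "solution_stabilizer C \<cong> sym_group 3 \<and> PVI_stabilizer \<alpha> \<cong> sym_group 4" if "(C, \<alpha>) \<in> solutions_4" for C \<alpha>
    using that unfolding solutions_lists by (rule fam4.solutions_cases) (simp only:, rule stabilizers_4; assumption)
  have stab5: "solution_stabilizer C \<cong> sym_group 2 \<and> PVI_stabilizer \<alpha> \<cong> sym_group 2" if "(C, \<alpha>) \<in> solutions_5" for C \<alpha>
    using that unfolding solutions_lists by (rule fam5.solutions_cases) (simp only:, rule stabilizers_5; assumption)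
  show ?thesis
    by (intro conjI 1 ballI; clarify; intro sol stab2 stab3 stab4 stab5; assumption)
qed

end
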